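(* Let $m\ge 2$, $n\ge 3$, let $S$ be the $(m,n)$ Bouw-Möller surface, and let $$M=2\cot\frac{\pi}{n}+2\,\frac{\cos(\pi/m)}{\sin(\pi/n)},$$ which is the modulus of the cylinders of the horizontal cylinder decomposition of $S$. Consider a geodesic trajectory on $S$ whose angle $\theta$ (measured from the positive horizontal direction) satisfies $0\le\theta<\theta_S$, and its associated cutting sequence. Mark a letter in the cutting sequence if: (i) it corresponds to a gluing edge, and it is the middle letter of a $(00)$ word or of a $(11)$ word; or (ii) it corresponds to a horizontal edge. Then the derived sequence (the cutting sequence of the image of the trajectory under the flip-shear $V_M$) consists precisely of the marked letters, read from left to right.
   Context: **Bouw-Möller surfaces.** For $a,b\ge 0$ not both zero, $P_n(a,b)$ is the $2n$-gon with consecutive edge vectors $\mathbf v_i=a[\cos\frac{i\pi}{n},\sin\frac{i\pi}{n}]$ for $i$ even and $\mathbf v_i=b[\cos\frac{i\pi}{n},\sin\frac{i\pi}{n}]$ for $i$ odd, $i=0,\dots,2n-1$; if $a=0$ or $b=0$ it degenerates to a regular $n$-gon. Edges with $i$ even (odd) are called even (odd) edges. The $(m,n)$ Bouw-Möller surface is obtained from the polygons $P(0),\dots,P(m-1)$, where $P(k)=P_n(\sin\frac{(k+1)\pi}{m},\sin\frac{k\pi}{m})$ if $n$ is odd, or if $n$ is even and $k$ is odd, and $P(k)=P_n(\sin\frac{k\pi}{m},\sin\frac{(k+1)\pi}{m})$ if $n$ is even and $k$ is even. For each odd $k$, each even edge of $P(k)$ is identified by translation with the opposite edge (oppositely oriented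 parallel edge) of $P(k+1)$, and each odd edge of $P(k)$ with the opposite edge of $P(k-1)$ (edges of length zero are ignored). Each $P(k)$ is convex and symmetric under reflection in a vertical axis, and no horizontal line through a vertex crosses the interior of an edge. **Cylinders.** Cutting $S$ along all horizontal segments that join two vertices of one of the polygons (horizontal edges included) divides it into horizontal flat cylinders (the horizontal cylinder decomposition) and cuts each polygon into vertically symmetric isosceles trapezoids (rectangles and isosceles triangles allowed as degenerate cases); each cylinder is thereby partitioned into two such trapezoids. The modulus of a cylinder is $W/H$, where $H$ is its height and $W$ its circumference. **Automorphisms.** The flip $R$ is the automorphism of $S$ that reflects each polygon in its vertical axis of symmetry (derivative $\begin{bmatrix}-1&0\\0&1\end{bmatrix}$). The shear $S_M$ is the affine automorphism that preserves each horizontal cylinder, fixes the tops and bottoms of the cylinders pointwise, and has derivative $\begin{bmatrix}1&M\\0&1\end{bmatrix}$. The flip-shear is $V_M=S_M\circ R$. **Edges.** Letters are (labels of) the glued pairs of polygon edges. A gluing edge is a non-horizontal glued polygon edge. A horizontal edge is a horizontal polygon edge. The slanted edges are the positive-slope diagonals of the trapezoids of the partition, i.e. in each trapezoid the segment joining the bottom-left vertex to the top-right vertex (for a triangle, the two bottom or the two top vertices coincide). The number $\theta_S$ is the smallest angle between a slanted edge and the positive horizontal direction. **Cutting sequences.** The cutting sequence of a geodesic trajectory is the bi-infinite sequence of polygon edges it crosses, in order (by convention a trajectory hitting a vertex stops, and then the sequence is not bi-infinite). The derived trajectory is the image of the trajectory under $V_M$, and the derived sequence is the cutting sequence of the derived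 trajectory. **Words.** If $h_0<\dots<h_r$ are the heights of the vertices of a polygon, then for each $i=1,\dots,r$ the polygon has exactly one left and one right non-horizontal edge between heights $h_{i-1}$ and $h_i$; these have level $i$. A bottom horizontal edge counts as a left-side edge of level $0$, and a top horizontal edge as a right-side edge of level $r+1$. A trajectory with $\theta\in[0,\theta_S)$ crossing a polygon enters through a left-side edge and leaves through a right-side edge; the crossing is of type $(0)$ if these have the same level and of type $(1)$ if the right one is one level above. Three consecutive letters of the cutting sequence correspond to crossing two consecutive polygons; the three-letter word is a $(00)$, $(01)$, $(10)$ or $(11)$ word according to the types of these two crossings in order. *)

theory Defs
  imports "HOL-Analysis.Analysis"
begin

section \<open>The polygons\<close>

text \<open>
  The plane is identified with the complex numbers.  Every polygon has its vertex \<open>0\<close> at the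
  origin, and edge \<open>i\<close> runs from vertex \<open>i\<close> to vertex \<open>i + 1\<close>; as the direction angle of edge \<open>i\<close>
  is \<open>i * pi / n\<close>, the boundary is traversed counterclockwise.  Edges of length zero occur exactly
  when \<open>a = 0\<close> or \<open>b = 0\<close>; consecutive vertices then coincide.
\<close>

definition sg_vec :: "nat \<Rightarrow> real \<Rightarrow> real \<Rightarrow> nat \<Rightarrow> complex" where
  "sg_vec n a b i = of_real (if even i then a else b) * cis (real i * pi / real n)"

definition bm_even_len :: "nat \<Rightarrow> nat \<Rightarrow> nat \<Rightarrow> real" where
  "bm_even_len m n k =
     (if even n \<and> even k then sin (real k * pi / real m) else sin (real (k + 1) * pi / real m))"

definition bm_odd_len :: "nat \<Rightarrow> nat \<Rightarrow> nat \<Rightarrow> real" where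
  "bm_odd_len m n k =
     (if even n \<and> even k then sin (real (k + 1) * pi / real m) else sin (real k * pi / real m))"

definition bm_vec :: "nat \<Rightarrow> nat \<Rightarrow> nat \<Rightarrow> nat \<Rightarrow> complex" where
  "bm_vec m n k i = sg_vec n (bm_even_len m n k) (bm_odd_len m n k) i"

definition bm_vert :: "nat \<Rightarrow> nat \<Rightarrow> nat \<Rightarrow> nat \<Rightarrow> complex" where
  "bm_vert m n k j = (\<Sum>i<j. bm_vec m n k i)"

definition bm_verts :: "nat \<Rightarrow> nat \<Rightarrow> nat \<Rightarrow> complex set" where
  "bm_verts m n k = bm_vert m n k ` {..<2 * n}"

definition bm_polygon :: "nat \<Rightarrow> nat \<Rightarrow> nat \<Rightarrow> complex set" where
  "bm_polygon m n k = convex hull (bm_verts m n k)"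

definition bm_edge :: "nat \<Rightarrow> nat \<Rightarrow> nat \<Rightarrow> nat \<Rightarrow> complex set" where
  "bm_edge m n k i = closed_segment (bm_vert m n k i) (bm_vert m n k (i + 1))"

section \<open>The surface\<close>

text \<open>The pair \<open>(k, i)\<close> stands for edge \<open>i\<close> of polygon \<open>k\<close>; the edge opposite to
  edge \<open>i\<close> has index \<open>i + n\<close> modulo \<open>2 * n\<close>.\<close>

definition bm_edges :: "nat \<Rightarrow> nat \<Rightarrow> (nat \<times> nat) set" where
  "bm_edges m n = {(k, i). k < m \<and> i < 2 * n \<and> bm_vec m n k i \<noteq> 0}"

definition bm_glued_odd :: "nat \<Rightarrow> nat \<Rightarrow> nat \<times> nat \<Rightarrow> nat \<times> nat \<Rightarrow> bool" where
  "bm_glued_odd m n e e' \<longleftrightarrow> e \<in> bm_edges m n \<and> e' \<in> bm_edges m n \<and>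
     (case (e, e') of ((k, i), (k', i')) \<Rightarrow>
        odd k \<and> i' = (i + n) mod (2 * n) \<and> (if even i then k' = k + 1 else k = k' + 1))"

definition bm_glued :: "nat \<Rightarrow> nat \<Rightarrow> nat \<times> nat \<Rightarrow> nat \<times> nat \<Rightarrow> bool" where
  "bm_glued m n e e' \<longleftrightarrow> bm_glued_odd m n e e' \<or> bm_glued_odd m n e' e"

definition bm_carrier :: "nat \<Rightarrow> nat \<Rightarrow> (nat \<times> complex) set" where
  "bm_carrier m n = Sigma {..<m} (bm_polygon m n)"

text \<open>Glued edges are oppositely oriented, so the gluing translation takes the start of one edge to
  the end of the other.\<close>

definition bm_ident :: "nat \<Rightarrow> nat \<Rightarrow> ((nat \<times> complex) \<times> (nat \<times> complex)) set" where
  "bm_ident m n = {((k, z), (k', z')). \<exists>i i'. bm_glued m n (k, i) (k', i') \<and> z \<in> bm_edge m n k i \<and>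
     z' = z + (bm_vert m n k' (i' + 1) - bm_vert m n k i)}"

definition bm_rel :: "nat \<Rightarrow> nat \<Rightarrow> ((nat \<times> complex) \<times> (nat \<times> complex)) set" where
  "bm_rel m n = (bm_ident m n)\<^sup>* \<inter> bm_carrier m n \<times> bm_carrier m n"

type_synonym bm_point = "(nat \<times> complex) set"

definition bm_surface :: "nat \<Rightarrow> nat \<Rightarrow> bm_point set" where
  "bm_surface m n = bm_carrier m n // bm_rel m n"

definition bm_singular :: "nat \<Rightarrow> nat \<Rightarrow> bm_point set" where
  "bm_singular m n = {p \<in> bm_surface m n. \<exists>(k, z) \<in> p. z \<in> bm_verts m n k}"

text \<open>The quotient topology of the disjoint union of the polygons.\<close>

definition bm_topology :: "nat \<Rightarrow> nat \<Rightarrow> bm_point topology" where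
  "bm_topology m n = topology (\<lambda>U. U \<subseteq> bm_surface m n \<and>
     openin (sum_topology (\<lambda>k. top_of_set (bm_polygon m n k)) {..<m})
       {x \<in> bm_carrier m n. bm_rel m n `` {x} \<in> U})"

lemma openin_bm_topology:
  "openin (bm_topology m n) U \<longleftrightarrow> U \<subseteq> bm_surface m n \<and>
     openin (sum_topology (\<lambda>k. top_of_set (bm_polygon m n k)) {..<m})
       {x \<in> bm_carrier m n. bm_rel m n `` {x} \<in> U}"
proof -
  let ?T = "sum_topology (\<lambda>k. top_of_set (bm_polygon m n k)) {..<m}"
  let ?pre = "\<lambda>U. {x \<in> bm_carrier m n. bm_rel m n `` {x} \<in> U}"
  have "istopology (\<lambda>U. U \<subseteq> bm_surface m n \<and> openin ?T (?pre U))"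
    unfolding istopology_def
  proof (intro conjI allI impI)
    fix U V
    assume "U \<subseteq> bm_surface m n \<and> openin ?T (?pre U)" "V \<subseteq> bm_surface m n \<and> openin ?T (?pre V)"
    moreover have "?pre (U \<inter> V) = ?pre U \<inter> ?pre V" by auto
    ultimately show "U \<inter> V \<subseteq> bm_surface m n" "openin ?T (?pre (U \<inter> V))" by auto
  next
    fix K
    assume K: "\<forall>U\<in>K. U \<subseteq> bm_surface m n \<and> openin ?T (?pre U)"
    then show "\<Union>K \<subseteq> bm_surface m n" by auto
    have "?pre (\<Union>K) = (\<Union>U\<in>K. ?pre U)" by auto
    then show "openin ?T (?pre (\<Union>K))" using K by auto
  qed
  then show ?thesis unfolding bm_topology_def by (simp add: topology_inverse')
qed

section \<open>Flat structure, trajectories and affine automorphisms\<close>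

text \<open>\<open>bm_move m n p w q\<close>: some representative of \<open>p\<close>, translated by \<open>w\<close> inside its polygon, is a
  representative of \<open>q\<close>.  If \<open>p\<close> is not a vertex, then (the polygons being convex, with two of them
  meeting along a glued edge) for all small \<open>w\<close> there is exactly one such \<open>q\<close>, namely \<open>p + w\<close> in a
  chart of the translation structure around \<open>p\<close>.\<close>

definition bm_move :: "nat \<Rightarrow> nat \<Rightarrow> bm_point \<Rightarrow> complex \<Rightarrow> bm_point \<Rightarrow> bool" where
  "bm_move m n p w q \<longleftrightarrow> p \<in> bm_surface m n \<and> q \<in> bm_surface m n \<and>
     (\<exists>k z. (k, z) \<in> p \<and> (k, z + w) \<in> q)"

text \<open>A bi-infinite geodesic in direction \<open>\<theta>\<close>, parametrised by arc length; it never hits a vertex.\<close>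

definition bm_trajectory :: "nat \<Rightarrow> nat \<Rightarrow> real \<Rightarrow> (real \<Rightarrow> bm_point) \<Rightarrow> bool" where
  "bm_trajectory m n \<theta> \<gamma> \<longleftrightarrow>
     (\<forall>t. \<gamma> t \<in> bm_surface m n - bm_singular m n \<and>
       (\<exists>\<epsilon>>0. \<forall>s. \<bar>s\<bar> < \<epsilon> \<longrightarrow> bm_move m n (\<gamma> t) (of_real s * cis \<theta>) (\<gamma> (t + s))))"

definition bm_affine_aut ::
    "nat \<Rightarrow> nat \<Rightarrow> (complex \<Rightarrow> complex) \<Rightarrow> (bm_point \<Rightarrow> bm_point) \<Rightarrow> bool" where
  "bm_affine_aut m n A f \<longleftrightarrow> linear A \<and>
     homeomorphic_map (bm_topology m n) (bm_topology m n) f \<and>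
     f ` bm_singular m n = bm_singular m n \<and>
     (\<forall>p \<in> bm_surface m n - bm_singular m n. \<exists>\<epsilon>>0. \<forall>w q.
        norm w < \<epsilon> \<and> bm_move m n p w q \<longrightarrow> bm_move m n (f p) (A w) (f q))"

text \<open>The vertical symmetry axis of a polygon is the perpendicular bisector of the horizontal edge
  \<open>0\<close>, i.e. the line \<open>Re z = a / 2\<close> with \<open>a\<close> the length of the even edges (if \<open>a = 0\<close>, it passes
  through the lowest vertex, which is the origin).\<close>

definition bm_flip :: "nat \<Rightarrow> nat \<Rightarrow> bm_point \<Rightarrow> bm_point" where
  "bm_flip m n p = (\<lambda>(k, z). (k, of_real (bm_even_len m n k) - cnj z)) ` p"

section \<open>Horizontal cylinders\<close>

text \<open>With \<open>i = j\<close> the cut contains all vertices; this only makes the vertices explicit that are not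
  joined horizontally to another vertex of the same polygon.\<close>

definition bm_cut :: "nat \<Rightarrow> nat \<Rightarrow> bm_point set" where
  "bm_cut m n = {p \<in> bm_surface m n. \<exists>(k, z) \<in> p. \<exists>i < 2 * n. \<exists>j < 2 * n.
     Im (bm_vert m n k i) = Im (bm_vert m n k j) \<and>
     z \<in> closed_segment (bm_vert m n k i) (bm_vert m n k j)}"

definition bm_cylinders :: "nat \<Rightarrow> nat \<Rightarrow> bm_point set set" where
  "bm_cylinders m n =
     connected_components_of (subtopology (bm_topology m n) (bm_surface m n - bm_cut m n))"

text \<open>\<open>C\<close> is, by translations, the quotient of the strip \<open>0 < Im z < H\<close> by the translation by \<open>W\<close>,
  that is, a flat horizontal cylinder of circumference \<open>W\<close> and height \<open>H\<close>.\<close>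

definition bm_flat_cylinder :: "nat \<Rightarrow> nat \<Rightarrow> bm_point set \<Rightarrow> real \<Rightarrow> real \<Rightarrow> bool" where
  "bm_flat_cylinder m n C W H \<longleftrightarrow> 0 < W \<and> 0 < H \<and>
     (\<exists>\<phi>. let strip = {z. 0 < Im z \<and> Im z < H} in
        \<phi> ` strip = C \<and>
        (\<forall>z \<in> strip. \<forall>z' \<in> strip. \<phi> z = \<phi> z' \<longleftrightarrow> (\<exists>j::int. z' = z + of_real (of_int j * W))) \<and>
        (\<forall>z \<in> strip. \<exists>\<epsilon>>0. \<forall>w. norm w < \<epsilon> \<longrightarrow> bm_move m n (\<phi> z) w (\<phi> (z + w))))"

text \<open>The cutting segments \<open>bm_cut m n\<close> are precisely the tops and bottoms of the cylinders.\<close>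

definition bm_shear :: "nat \<Rightarrow> nat \<Rightarrow> real \<Rightarrow> (bm_point \<Rightarrow> bm_point) \<Rightarrow> bool" where
  "bm_shear m n M f \<longleftrightarrow>
     bm_affine_aut m n (\<lambda>w. Complex (Re w + M * Im w) (Im w)) f \<and>
     (\<forall>C \<in> bm_cylinders m n. f ` C = C) \<and>
     (\<forall>p \<in> bm_cut m n. f p = p)"

section \<open>Slanted edges\<close>

text \<open>For consecutive vertex heights, \<open>p\<close> is the left end of the lower and \<open>q\<close> the right end of the
  upper side of the trapezoid between them.\<close>

definition bm_slanted :: "nat \<Rightarrow> nat \<Rightarrow> (complex \<times> complex) set" where
  "bm_slanted m n = {(p, q). \<exists>k < m. p \<in> bm_verts m n k \<and> q \<in> bm_verts m n k \<and> Im p < Im q \<and>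
     (\<forall>v \<in> bm_verts m n k. \<not> (Im p < Im v \<and> Im v < Im q)) \<and>
     (\<forall>v \<in> bm_verts m n k. Im v = Im p \<longrightarrow> Re p \<le> Re v) \<and>
     (\<forall>v \<in> bm_verts m n k. Im v = Im q \<longrightarrow> Re v \<le> Re q)}"

definition bm_theta :: "nat \<Rightarrow> nat \<Rightarrow> real" where
  "bm_theta m n = Min ((\<lambda>(p, q). Arg (q - p)) ` bm_slanted m n)"

section \<open>Letters, cutting sequences and words\<close>

type_synonym bm_letter = "(nat \<times> nat) set"

definition bm_letters :: "nat \<Rightarrow> nat \<Rightarrow> bm_letter set" where
  "bm_letters m n = {{e, e'} | e e'. bm_glued m n e e'}"

definition bm_on_edge :: "nat \<Rightarrow> nat \<Rightarrow> bm_letter \<Rightarrow> bm_point \<Rightarrow> bool" where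
  "bm_on_edge m n l p \<longleftrightarrow> (\<exists>(k, i) \<in> l. \<exists>z \<in> bm_edge m n k i. (k, z) \<in> p)"

text \<open>\<open>t j\<close> is the time of the \<open>j\<close>-th crossing; a cutting sequence is determined up to a shift of its
  index.\<close>

definition bm_cutting_sequence ::
    "nat \<Rightarrow> nat \<Rightarrow> (real \<Rightarrow> bm_point) \<Rightarrow> (int \<Rightarrow> bm_letter) \<Rightarrow> bool" where
  "bm_cutting_sequence m n \<gamma> c \<longleftrightarrow>
     (\<exists>t :: int \<Rightarrow> real. strict_mono t \<and>
        range t = {s. \<exists>l \<in> bm_letters m n. bm_on_edge m n l (\<gamma> s)} \<and>
        (\<forall>j. c j \<in> bm_letters m n \<and> bm_on_edge m n (c j) (\<gamma> (t j))))"

definition bm_horizontal_letter :: "nat \<Rightarrow> nat \<Rightarrow> bm_letter \<Rightarrow> bool" where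
  "bm_horizontal_letter m n l \<longleftrightarrow> (\<exists>(k, i) \<in> l. Im (bm_vec m n k i) = 0)"

definition bm_gluing_letter :: "nat \<Rightarrow> nat \<Rightarrow> bm_letter \<Rightarrow> bool" where
  "bm_gluing_letter m n l \<longleftrightarrow> \<not> bm_horizontal_letter m n l"

text \<open>By the counterclockwise orientation, edge \<open>0\<close> is the bottom and edge \<open>n\<close> the top horizontal
  edge, the edges strictly between them in the cyclic order are the right ones, and those after \<open>n\<close>
  are the left ones.\<close>

definition bm_left_side :: "nat \<Rightarrow> nat \<Rightarrow> bool" where
  "bm_left_side n i \<longleftrightarrow> i = 0 \<or> n < i"

definition bm_right_side :: "nat \<Rightarrow> nat \<Rightarrow> bool" where
  "bm_right_side n i \<longleftrightarrow> 0 < i \<and> i \<le> n"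

text \<open>If \<open>h\<^sub>0 < \<dots> < h\<^sub>r\<close> are the vertex heights, a non-horizontal edge from height
  \<open>h\<^sub>i\<^sub>-\<^sub>1\<close> to \<open>h\<^sub>i\<close> has exactly the \<open>i\<close> vertex heights \<open>h\<^sub>0, \<dots>, h\<^sub>i\<^sub>-\<^sub>1\<close> below its upper end,
  and there are \<open>r + 1\<close> heights altogether.\<close>

definition bm_heights :: "nat \<Rightarrow> nat \<Rightarrow> nat \<Rightarrow> real set" where
  "bm_heights m n k = Im ` bm_verts m n k"

definition bm_level :: "nat \<Rightarrow> nat \<Rightarrow> nat \<times> nat \<Rightarrow> nat" where
  "bm_level m n = (\<lambda>(k, i).
     if i = 0 then 0
     else if i = n then card (bm_heights m n k)
     else card {h \<in> bm_heights m n k.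
            h < max (Im (bm_vert m n k i)) (Im (bm_vert m n k (i + 1)))})"

text \<open>\<open>bm_crossing m n l l' d\<close>: the two successive letters \<open>l\<close>, \<open>l'\<close> are a crossing of type \<open>(d)\<close>.
  Of two glued edges exactly one is a left-side edge, so \<open>l\<close> determines the polygon \<open>k\<close> that is
  entered.\<close>

definition bm_crossing :: "nat \<Rightarrow> nat \<Rightarrow> bm_letter \<Rightarrow> bm_letter \<Rightarrow> nat \<Rightarrow> bool" where
  "bm_crossing m n l l' d \<longleftrightarrow> (\<exists>k i i'. (k, i) \<in> l \<and> (k, i') \<in> l' \<and>
     bm_left_side n i \<and> bm_right_side n i' \<and> bm_level m n (k, i') = bm_level m n (k, i) + d)"

definition bm_word ::
    "nat \<Rightarrow> nat \<Rightarrow> nat \<Rightarrow> nat \<Rightarrow> bm_letter \<Rightarrow> bm_letter \<Rightarrow> bm_letter \<Rightarrow> bool" where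
  "bm_word m n d d' l1 l2 l3 \<longleftrightarrow> bm_crossing m n l1 l2 d \<and> bm_crossing m n l2 l3 d'"

definition bm_marked :: "nat \<Rightarrow> nat \<Rightarrow> (int \<Rightarrow> bm_letter) \<Rightarrow> int \<Rightarrow> bool" where
  "bm_marked m n c j \<longleftrightarrow>
     (bm_gluing_letter m n (c j) \<and>
        (bm_word m n 0 0 (c (j - 1)) (c j) (c (j + 1)) \<or>
         bm_word m n 1 1 (c (j - 1)) (c j) (c (j + 1)))) \<or>
     bm_horizontal_letter m n (c j)"

end

theory Submission
  imports Defs "HOL-Library.Infinite_Set"
begin

text \<open>
  Number the horizontal trapezoids of a polygon by their right edges.  The right edge \<open>i\<close> of a
  trapezoid in polygon \<open>k\<close> is glued to the left edge of the trapezoid \<open>n - i\<close> of a neighbouring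
  polygon, and conversely, so two trapezoids close up to a cylinder.  With
  \<open>L\<^sub>i\<close> the edge lengths and \<open>\<alpha> = pi / n\<close>, the vertices have the closed form
  \<open>v\<^sub>j = const - \<i> (L\<^sub>j\<^sub>+\<^sub>1 cis (j \<alpha>) + L\<^sub>j cis ((j - 1) \<alpha>)) / (2 sin \<alpha>)\<close>, from which convexity, the
  widths of the trapezoids and the modulus of the cylinders can be read off.

  In the unrolled cylinder the preimage of a gluing edge \<open>e\<close> under the flip-shear is the diagonal, from
  bottom left to top right, of the parallelogram formed by the two trapezoids adjacent to \<open>e\<close>.  A
  trajectory that is flatter than the slanted edges and crosses \<open>e\<close> enters this parallelogram through
  its left side (type \<open>0\<close>) or its bottom (type \<open>1\<close>), and leaves it through its right side (type \<open>0\<close>)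
  or its top (type \<open>1\<close>); hence it crosses the diagonal exactly for the words \<open>(00)\<close> and \<open>(11)\<close>.
  Consecutive crossings come in the right order, because within a trapezoid the slanted edge separates
  the two diagonals.
\<close>

text \<open>Since \<open>M * hgt k i = wd k i\<close>, the shear turns the top of each cylinder by
  exactly one circumference; this is how it can fix both boundaries. In the strip, the flip negates
  \<open>x\<close> and the shear adds \<open>M * t\<close>, so the line
  \<open>x = M * t - rr k i t\<close> is carried to the right edge \<open>x = rr k i t\<close>. It
  starts at \<open>- X k i\<close> and ends at \<open>wd k i - X k (Suc i)\<close>, the bottom left
  corner of one trapezoid and the top right corner of the other: hence the diagonal. The theorem
  speaks of every map with \<open>bm_shear\<close>, so no shear is constructed; its formula in the
  strip is recovered from the local derivative and the fixed cut. Letters recur in a cutting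
  sequence, so a crossing of the diagonal of letter \<open>j\<close> counts only at times between
  the crossings \<open>j - 1\<close> and \<open>j + 1\<close>. The time windows of neighbouring
  letters overlap, and only there does the order of the crossings need an argument. The angle
  \<open>0\<close> is allowed, so height cannot parametrise a trajectory. Time is used instead, and
  the marking rule becomes a sign change of an affine function of time.\<close>

lemma affine_pos_nbhd:
  fixes a b c :: real assumes "0 < c"
  shows "\<exists>e>0. \<forall>w. norm w < e \<longrightarrow> 0 < c + a * Re w + b * Im w"
proof (intro exI[of _ "c / (\<bar>a\<bar> + \<bar>b\<bar> + 1)"] conjI allI impI)
  show "0 < c / (\<bar>a\<bar> + \<bar>b\<bar> + 1)" using assms by simp
  fix w :: complex assume w: "norm w < c / (\<bar>a\<bar> + \<bar>b\<bar> + 1)"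
  have "\<bar>a * Re w + b * Im w\<bar> \<le> \<bar>a\<bar> * \<bar>Re w\<bar> + \<bar>b\<bar> * \<bar>Im w\<bar>"
    by (metis abs_mult abs_triangle_ineq)
  also have "\<dots> \<le> \<bar>a\<bar> * norm w + \<bar>b\<bar> * norm w"
    by (intro add_mono mult_left_mono abs_Re_le_cmod abs_Im_le_cmod) auto
  also have "\<dots> \<le> (\<bar>a\<bar> + \<bar>b\<bar> + 1) * norm w" by (simp add: algebra_simps)
  also have "\<dots> < c" using w by (simp add: field_simps)
  finally show "0 < c + a * Re w + b * Im w" by linarith
qed

text \<open>Cutting sequences are indexed by all integers, so the marked positions have to be
  enumerated in order by the integers. The nonnegative and the negative elements are enumerated
  separately as infinite sets of naturals; the reflection \<open>- 1 - d\<close> makes the two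
  halves meet without overlap.\<close>

lemma int_set_enumeration:
  fixes J :: "int set"
  assumes above: "\<And>B. \<exists>j\<in>J. B < j" and below: "\<And>B. \<exists>j\<in>J. j < B"
  shows "\<exists>f :: int \<Rightarrow> int. strict_mono f \<and> range f = J"
proof -
  define A where "A = {d::nat. int d \<in> J}"
  define B where "B = {d::nat. - 1 - int d \<in> J}"
  have "\<exists>d>c. d \<in> A" for c
  proof -
    obtain j where "j \<in> J" "int c < j" using above by blast
    then show ?thesis by (intro exI[of _ "nat j"]) (auto simp: A_def)
  qed
  then have A: "infinite A" by (simp add: infinite_nat_iff_unbounded)
  have "\<exists>d>c. d \<in> B" for c
  proof -
    obtain j where "j \<in> J" "j < - 1 - int c" using below by blast
    then show ?thesis by (intro exI[of _ "nat (- 1 - j)"]) (auto simp: B_def)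
  qed
  then have B: "infinite B" by (simp add: infinite_nat_iff_unbounded)
  define f where "f i = (if 0 \<le> i then int (enumerate A (nat i)) else - 1 - int (enumerate B (nat (- 1
      - i))))" for i :: int
  have "strict_mono f"
  proof (rule strict_monoI)
    fix x y :: int assume "x < y"
    then consider "0 \<le> x" "0 \<le> y" "nat x < nat y" | "x < 0" "0 \<le> y" | "x < 0" "y < 0"
        "nat (- 1 - y) < nat (- 1 - x)" by linarith
    then show "f x < f y"
    proof cases
      case 1
      then show ?thesis using enumerate_mono[OF _ A] by (simp add: f_def)
    next
      case 3
      then show ?thesis using enumerate_mono[OF _ B] by (simp add: f_def)
    qed (simp add: f_def)
  qed
  moreover have "range f = J"
  proof (intro set_eqI iffI)
    fix j assume "j \<in> range f"
    then obtain i where i: "j = f i" by blast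
    have "enumerate A (nat i) \<in> A" "enumerate B (nat (- 1 - i)) \<in> B" using A B enumerate_in_set by auto
    then show "j \<in> J" using i by (simp add: f_def A_def B_def)
  next
    fix j assume j: "j \<in> J"
    show "j \<in> range f"
    proof (cases "0 \<le> j")
      case True
      then have "nat j \<in> range (enumerate A)" using j A by (simp add: range_enumerate A_def)
      then obtain d where "nat j = enumerate A d" by blast
      then have "j = f (int d)" using True by (simp add: f_def)
      then show ?thesis by blast
    next
      case False
      then have "nat (- 1 - j) \<in> range (enumerate B)" using j B by (simp add: range_enumerate B_def)
      then obtain d where "nat (- 1 - j) = enumerate B d" by blast
      then have "j = f (- 1 - int d)" using False by (simp add: f_def)
      then show ?thesis by blast
    qed
  qed
  ultimately show ?thesis by blast
qed

text \<open>\<open>A + B * s\<close> will tell on which side of the diagonal the trajectory is at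
  time \<open>s\<close>. For an affine function, nonzero signs at the two ends of an interval decide
  whether it has a zero inside.\<close>

lemma affine_root:
  fixes A B p q :: real
  assumes "p < q" "(A + B * p) * (A + B * q) < 0"
  shows "\<exists>s. p < s \<and> s < q \<and> A + B * s = 0"
proof -
  have "B \<noteq> 0" using assms(2) by (metis add.right_neutral linorder_not_less mult_zero_left zero_le_square)
  define s where "s = - A / B"
  have s: "A = - B * s" using \<open>B \<noteq> 0\<close> by (simp add: s_def)
  have "B * B * ((p - s) * (q - s)) < 0" using assms(2) by (simp add: s algebra_simps)
  then have "(p - s) * (q - s) < 0" using \<open>B \<noteq> 0\<close> by (simp add: mult_less_0_iff zero_less_mult_iff)
  then have "p < s" "s < q" using assms(1) by (auto simp: mult_less_0_iff)
  then show ?thesis using s by (intro exI[of _ s]) simp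
qed

lemma affine_no_root:
  fixes A B p q s :: real
  assumes "p < s" "s < q" "0 < (A + B * p) * (A + B * q)"
  shows "A + B * s \<noteq> 0"
proof
  assume "A + B * s = 0"
  then have A: "A = - B * s" by simp
  have "0 < B * B * ((p - s) * (q - s))" using assms(3) by (simp add: A algebra_simps)
  moreover have "(p - s) * (q - s) < 0" using assms by (simp add: mult_less_0_iff)
  ultimately show False by (auto simp: zero_less_mult_iff mult_less_0_iff)
qed

section \<open>The polygons as intersections of half planes\<close>

locale bouw_moeller =
  fixes m n :: nat
  assumes m_ge: "2 \<le> m" and n_ge: "3 \<le> n"
begin

definition al :: real where "al = pi / real n"

definition sl :: "nat \<Rightarrow> real" where "sl j = sin (real j * pi / real m)"

text \<open>Edge \<open>i\<close> of polygon \<open>k\<close> is glued to polygon \<open>k + 1\<close> if \<open>up k i\<close> and to polygon \<open>k - 1\<close>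
  otherwise; edges between polygons \<open>k\<close> and \<open>k + 1\<close> have length \<open>sl (k + 1)\<close>.\<close>

definition up :: "nat \<Rightarrow> nat \<Rightarrow> bool" where
  "up k i \<longleftrightarrow> (if even n \<and> even k then odd i else even i)"

definition len :: "nat \<Rightarrow> nat \<Rightarrow> real" where
  "len k i = (if up k i then sl (k + 1) else sl k)"

abbreviation vert where "vert \<equiv> bm_vert m n"

lemma n_al: "real n * al = pi"
  using n_ge by (simp add: al_def)

lemma al_pos: "0 < al" and al_lt: "al < pi / 2"
  using n_ge by (auto simp: al_def divide_simps)

lemma sin_al_pos: "0 < sin al" and cos_al_pos: "0 < cos al"
  using al_pos al_lt by (auto intro!: sin_gt_zero cos_gt_zero)

lemma sin_mult_al_pos:
  assumes "0 < i" "i < n" shows "0 < sin (real i * al)"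
proof (rule sin_gt_zero)
  show "0 < real i * al" using assms al_pos by simp
  have "real i * al < real n * al" using assms al_pos by (intro mult_strict_right_mono) auto
  then show "real i * al < pi" by (simp add: n_al)
qed

lemma sin_mult_al_nonneg:
  assumes "i \<le> n" shows "0 \<le> sin (real i * al)"
proof (rule sin_ge_zero)
  show "0 \<le> real i * al" using al_pos by simp
  have "real i * al \<le> real n * al" using assms al_pos by (intro mult_right_mono) auto
  then show "real i * al \<le> pi" by (simp add: n_al)
qed

lemma sl_0 [simp]: "sl 0 = 0" and sl_m [simp]: "sl m = 0"
  using m_ge by (auto simp: sl_def)

lemma sl_nonneg: "j \<le> m \<Longrightarrow> 0 \<le> sl j"
  unfolding sl_def using m_ge by (intro sin_ge_zero) (auto simp: divide_simps)

lemma sl_pos: "0 < j \<Longrightarrow> j < m \<Longrightarrow> 0 < sl j"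
  unfolding sl_def using m_ge by (intro sin_gt_zero) (auto simp: divide_simps)

text \<open>For a glued edge of length \<open>sl (j + 1)\<close>, the adjacent edges in its two
  polygons have lengths \<open>sl j\<close> and \<open>sl (j + 2)\<close>. This identity is the
  reason why all cylinders have the same modulus, and the origin of \<open>cos (pi / m)\<close> in
  it.\<close>

lemma sl_sum: "sl j + sl (j + 2) = 2 * sl (j + 1) * cos (pi / real m)"
proof -
  have "sl j = sin (real (j + 1) * pi / real m - pi / real m)"
    by (simp add: sl_def add_divide_distrib distrib_right)
  moreover have "sl (j + 2) = sin (real (j + 1) * pi / real m + pi / real m)"
    by (simp add: sl_def add_divide_distrib distrib_right)
  ultimately show ?thesis by (simp add: sin_diff sin_add sl_def)
qed

lemma up_Suc: "up k (Suc i) \<longleftrightarrow> \<not> up k i"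
  by (auto simp: up_def)

lemma len_Suc_Suc [simp]: "len k (Suc (Suc i)) = len k i"
  by (auto simp: len_def up_def)

lemma len_parity: "even i = even j \<Longrightarrow> len k i = len k j"
  by (auto simp: len_def up_def)

lemma len_nonneg: "k < m \<Longrightarrow> 0 \<le> len k i"
  by (simp add: len_def sl_nonneg)

lemma len_pos_Suc: "k < m \<Longrightarrow> 0 < len k i \<or> 0 < len k (Suc i)"
  using sl_pos[of k] sl_pos[of "k + 1"] m_ge
  by (cases "k = 0") (auto simp: len_def up_Suc)

lemma bm_vec_eq: "bm_vec m n k i = of_real (len k i) * cis (real i * al)"
  by (auto simp: bm_vec_def sg_vec_def bm_even_len_def bm_odd_len_def len_def up_def sl_def al_def)

lemma bm_even_len_eq: "bm_even_len m n k = len k 0"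
  by (auto simp: bm_even_len_def len_def up_def sl_def)

text \<open>A discrete primitive of the edge vectors. As the lengths alternate, the terms with
  \<open>len k (Suc j)\<close> cancel in the difference of two successive values, and
  \<open>cis (x + al) - cis (x - al) = 2 * \<i> * sin al * cis x\<close> leaves edge
  \<open>j\<close>.\<close>

definition vert_formula :: "nat \<Rightarrow> real \<Rightarrow> nat \<Rightarrow> complex" where
  "vert_formula k x j = - \<i> * (of_real (len k (Suc j)) * cis x + of_real (len k j) * cis (x - al))
     / of_real (2 * sin al)"

lemma vert_0 [simp]: "vert k 0 = 0"
  by (simp add: bm_vert_def)

lemma vert_Suc: "vert k (Suc j) = vert k j + of_real (len k j) * cis (real j * al)"
  by (simp add: bm_vert_def bm_vec_eq)

lemma vert_diff: "vert k j = vert_formula k (real j * al) j - vert_formula k 0 0"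
proof (induction j)
  case (Suc j)
  have "vert_formula k (real (Suc j) * al) (Suc j) - vert_formula k (real j * al) j
      = of_real (len k j) * cis (real j * al)"
    using sin_al_pos
    by (simp add: vert_formula_def complex_eq_iff cos_add sin_add cos_diff sin_diff distrib_right
        field_simps)
  note step = this
  show ?case unfolding vert_Suc Suc.IH step[symmetric] by (simp only: diff_add_eq) simp
qed simp

lemma cis_add_2n: "cis (real (j + 2 * n) * al) = cis (real j * al)"
proof -
  have "real (j + 2 * n) * al = real j * al + 2 * pi" using n_al by (simp add: algebra_simps)
  then show ?thesis by (simp add: complex_eq_iff)
qed

lemma vert_add_2n: "vert k (j + 2 * n) = vert k j"
proof -
  have *: "cis (real (j + 2 * n) * al - al) = cis (real j * al - al)"
    using cis_add_2n[of j] by (simp flip: cis_divide)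
  have "len k (j + 2 * n) = len k j" "len k (Suc (j + 2 * n)) = len k (Suc j)"
    by (auto intro: len_parity)
  then show ?thesis using cis_add_2n[of j] * by (simp add: vert_diff vert_formula_def)
qed

lemma vert_2n [simp]: "vert k (2 * n) = 0"
  using vert_add_2n[of k 0] by simp

lemma vert_mod: "vert k (j mod (2 * n)) = vert k j"
proof -
  have "vert k (j + q * (2 * n)) = vert k j" for j q
  proof (induction q)
    case (Suc q)
    have "vert k (j + Suc q * (2 * n)) = vert k ((j + q * (2 * n)) + 2 * n)"
      by (simp add: algebra_simps)
    then show ?case using Suc vert_add_2n by metis
  qed simp
  then show ?thesis by (metis mod_div_mult_eq)
qed

lemma vert_in_verts: "vert k j \<in> bm_verts m n k"
proof -
  have "vert k (j mod (2 * n)) \<in> bm_verts m n k" unfolding bm_verts_def using n_ge by (intro imageI) auto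
  then show ?thesis by (simp add: vert_mod)
qed

text \<open>The signed distance to the line through edge \<open>i\<close>, positive on the side of the polygon.\<close>

definition dd :: "nat \<Rightarrow> nat \<Rightarrow> complex \<Rightarrow> real" where
  "dd k i z = Im ((z - vert k i) * cis (- (real i * al)))"

lemma dd_eq: "dd k i z =
    (Im z - Im (vert k i)) * cos (real i * al) - (Re z - Re (vert k i)) * sin (real i * al)"
  by (simp add: dd_def)

lemma dd_add: "dd k i (z + w) = dd k i z + Im (w * cis (- (real i * al)))"
  by (simp add: dd_def algebra_simps)

lemma dd_add_2n: "dd k (i + 2 * n) z = dd k i z"
proof -
  have "cis (- (real (i + 2 * n) * al)) = cis (- (real i * al))"
    using cis_add_2n[of i] by (simp add: cis_cnj[symmetric])
  then show ?thesis by (simp add: dd_def vert_add_2n del: of_nat_add)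
qed

lemma dd_mod: "dd k (i mod (2 * n)) z = dd k i z"
proof -
  have "dd k (j + q * (2 * n)) z = dd k j z" for j q
  proof (induction q)
    case (Suc q)
    have "dd k (j + Suc q * (2 * n)) z = dd k ((j + q * (2 * n)) + 2 * n) z"
      by (simp add: algebra_simps)
    then show ?case using Suc dd_add_2n by metis
  qed simp
  then show ?thesis by (metis mod_div_mult_eq)
qed

lemma dd_vert_self [simp]: "dd k i (vert k i) = 0"
  by (simp add: dd_def)

lemma dd_vert_Suc [simp]: "dd k i (vert k (Suc i)) = 0"
  by (simp add: dd_def vert_Suc cis_mult)

text \<open>Rotating edge \<open>i\<close> into the horizontal turns the closed form into a sum of
  cosines of multiples of \<open>al\<close>, weighted by edge lengths. Convexity of the polygon
  thereby becomes a comparison of cosines.\<close>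

lemma dd_vert: "dd k i (vert k j) * (2 * sin al) =
    len k (Suc i) + len k i * cos al
      - len k (Suc j) * cos ((real j - real i) * al) - len k j * cos ((real j - real i - 1) * al)"
proof -
  have c1: "cos ((real j - real i) * al) = cos (real j * al) * cos (real i * al) + sin (real j * al) *
      sin (real i * al)"
    by (simp add: left_diff_distrib cos_diff)
  have "(real j - real i - 1) * al = (real j * al - al) - real i * al" by (simp add: algebra_simps)
  then have c2: "cos ((real j - real i - 1) * al)
      = cos (real j * al - al) * cos (real i * al) + sin (real j * al - al) * sin (real i * al)"
    by (simp add: cos_diff)
  have c3: "cos al = cos (real i * al - al) * cos (real i * al) + sin (real i * al - al) * sin (real i
      * al)"
    using cos_diff[of "real i * al - al" "real i * al"] by simp
  have s: "cos (real i * al) * cos (real i * al) + sin (real i * al) * sin (real i * al) = 1"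
    using sin_cos_squared_add2[of "real i * al"] by (simp add: power2_eq_square)
  have e: "dd k i (vert k j) * (2 * sin al)
      = len k (Suc i) * (cos (real i * al) * cos (real i * al)) + len k (Suc i) * (sin (real i * al) *
      sin (real i * al))
     + len k i * (cos (real i * al - al) * cos (real i * al) + sin (real i * al - al) * sin (real i * al))
     - len k (Suc j) * (cos (real j * al) * cos (real i * al) + sin (real j * al) * sin (real i * al))
     - len k j * (cos (real j * al - al) * cos (real i * al) + sin (real j * al - al) * sin (real i * al))"
    unfolding dd_def vert_diff
    using sin_al_pos by (simp add: vert_formula_def field_simps)
  have "len k (Suc i) * (cos (real i * al) * cos (real i * al)) + len k (Suc i) * (sin (real i * al) *
      sin (real i * al)) = len k (Suc i) * 1"
    by (simp only: distrib_left[symmetric] s)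
  then show ?thesis unfolding e c1 c2 using c3 by simp
qed

text \<open>Reduction modulo the even number \<open>2 * n\<close> keeps the factor odd, so it never
  becomes \<open>0\<close>, and no odd multiple of \<open>al\<close> is closer to a multiple of
  \<open>2 * pi\<close> than \<open>al\<close> itself.\<close>

lemma cos_odd_al_le:
  assumes "odd (q :: int)" shows "cos (real_of_int q * al) \<le> cos al"
proof -
  define r where "r = q mod (2 * int n)"
  have r: "0 \<le> r" "r < 2 * int n" "odd r"
    using n_ge assms by (auto simp: r_def dvd_mod_iff)
  have "real_of_int q = real_of_int r + real_of_int (q div (2 * int n)) * (2 * real n)"
    unfolding r_def
    by (metis (no_types) add.commute div_mult_mod_eq of_int_add of_int_mult of_int_numeral of_int_of_nat_eq)
  then have "real_of_int q * al = real_of_int r * al + real_of_int (q div (2 * int n)) * (2 * (real n *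
      al))"
    by (simp add: algebra_simps)
  then have "real_of_int q * al = real_of_int r * al + real_of_int (q div (2 * int n)) * (2 * pi)"
    by (simp add: n_al)
  then have q: "cos (real_of_int q * al) = cos (real_of_int r * al)"
    using cos_int_2pin[of "q div (2 * int n)"] sin_int_2pin[of "q div (2 * int n)"]
    by (simp add: cos_add mult.commute mult.left_commute)
  have main: "cos (real_of_int t * al) \<le> cos al" if "1 \<le> t" "t \<le> int n" for t
  proof (rule cos_monotone_0_pi_le)
    show "0 \<le> al" using al_pos by simp
    show "al \<le> real_of_int t * al" using that al_pos by simp
    have "real_of_int t * al \<le> real n * al" using that al_pos by (intro mult_right_mono) auto
    then show "real_of_int t * al \<le> pi" by (simp add: n_al)
  qed
  show ?thesis
  proof (cases "r \<le> int n")
    case True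
    then show ?thesis using main[of r] r q by (cases "r = 0") auto
  next
    case False
    have "real_of_int (2 * int n - r) * al = 2 * (real n * al) - real_of_int r * al"
      by (simp add: algebra_simps)
    then have "cos (real_of_int (2 * int n - r) * al) = cos (2 * pi - real_of_int r * al)"
      by (simp add: n_al)
    also have "\<dots> = cos (real_of_int r * al)" by (simp add: cos_diff)
    finally show ?thesis using main[of "2 * int n - r"] False r q by auto
  qed
qed

text \<open>Of \<open>j - i\<close> and \<open>j - i - 1\<close> one is odd and one is even. The
  cosine of the odd multiple is at most \<open>cos al\<close>, the other one at most
  \<open>1\<close>, and the same parity decides which of the two lengths goes with which, so the
  bounds match the first two terms of \<open>dd_vert\<close>.\<close>

lemma dd_vert_nonneg:
  assumes "k < m" shows "0 \<le> dd k i (vert k j)"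
proof -
  have e: "(real j - real i) = real_of_int (int j - int i)"
      "(real j - real i - 1) = real_of_int (int j - int i - 1)"
    by auto
  have "0 \<le> dd k i (vert k j) * (2 * sin al)"
  proof (cases "even j = even i")
    case True
    then have "len k j = len k i" "len k (Suc j) = len k (Suc i)" by (auto intro: len_parity)
    moreover have "cos ((real j - real i - 1) * al) \<le> cos al"
      unfolding e(2) by (rule cos_odd_al_le) (use True in auto)
    then have "len k i * cos ((real j - real i - 1) * al) \<le> len k i * cos al"
      using len_nonneg[OF assms] by (rule mult_left_mono)
    moreover have "len k (Suc i) * cos ((real j - real i) * al) \<le> len k (Suc i) * 1"
      using len_nonneg[OF assms] by (rule mult_left_mono[rotated]) auto
    ultimately show ?thesis unfolding dd_vert by simp
  next
    case False
    then have "len k j = len k (Suc i)" "len k (Suc j) = len k i" by (auto intro: len_parity)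
    moreover have "cos ((real j - real i) * al) \<le> cos al"
      unfolding e(1) by (rule cos_odd_al_le) (use False in auto)
    then have "len k i * cos ((real j - real i) * al) \<le> len k i * cos al"
      using len_nonneg[OF assms] by (rule mult_left_mono)
    moreover have "len k (Suc i) * cos ((real j - real i - 1) * al) \<le> len k (Suc i) * 1"
      using len_nonneg[OF assms] by (rule mult_left_mono[rotated]) auto
    ultimately show ?thesis unfolding dd_vert by simp
  qed
  then show ?thesis using sin_al_pos by (simp add: zero_le_mult_iff)
qed

text \<open>Provides a vertex strictly inside each half plane, even if the edge itself is
  degenerate. This will exclude that two different edges lie on one line.\<close>

lemma dd_opposite_pos:
  assumes "k < m" shows "0 < dd k i (vert k (i + n))"
proof -
  have c: "cos ((real (i + n) - real i) * al) = -1" "cos ((real (i + n) - real i - 1) * al) = - cos al"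
  proof -
    show "cos ((real (i + n) - real i) * al) = -1" using n_al by simp
    have "(real (i + n) - real i - 1) * al = pi - al" using n_al by (simp add: algebra_simps)
    then show "cos ((real (i + n) - real i - 1) * al) = - cos al" by simp
  qed
  have p: "0 < len k i \<or> 0 < len k (Suc i)" "0 \<le> len k i" "0 \<le> len k (Suc i)"
    using len_pos_Suc len_nonneg assms by auto
  have "0 < dd k i (vert k (i + n)) * (2 * sin al)"
  proof (cases "even n")
    case True
    then have "len k (i + n) = len k i" "len k (Suc (i + n)) = len k (Suc i)" by (auto intro: len_parity)
    then have e: "dd k i (vert k (i + n)) * (2 * sin al) = 2 * len k (Suc i) + 2 * (len k i * cos al)"
      unfolding dd_vert c by simp
    show ?thesis unfolding e using p cos_al_pos
      by (metis add_nonneg_pos add_pos_nonneg less_eq_real_def mult_nonneg_nonneg mult_pos_pos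
          zero_less_numeral)
  next
    case False
    then have "len k (i + n) = len k (Suc i)" "len k (Suc (i + n)) = len k i" by (auto intro: len_parity)
    then have e: "dd k i (vert k (i + n)) * (2 * sin al) = (1 + cos al) * (len k (Suc i) + len k i)"
      unfolding dd_vert c by (simp add: algebra_simps)
    show ?thesis unfolding e using p cos_al_pos by (intro mult_pos_pos) auto
  qed
  then show ?thesis using sin_al_pos by (simp add: zero_less_mult_iff)
qed

lemma dd_convex: "u + v = 1 \<Longrightarrow> dd k i (u *\<^sub>R x + v *\<^sub>R y) = u * dd k i x + v * dd k i y"
proof -
  assume "u + v = 1"
  then have v: "v = 1 - u" by simp
  show ?thesis unfolding dd_eq v by (simp add: algebra_simps)
qed

lemma continuous_on_dd [continuous_intros]: "continuous_on A (dd k i)"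
  unfolding dd_eq[abs_def] by (intro continuous_intros)

lemma polygon_dd_nonneg:
  assumes "k < m" "z \<in> bm_polygon m n k" shows "0 \<le> dd k i z"
proof -
  have "convex {z. 0 \<le> dd k i z}" by (auto simp: convex_def dd_convex)
  moreover have "bm_verts m n k \<subseteq> {z. 0 \<le> dd k i z}"
    using dd_vert_nonneg[OF assms(1)] by (auto simp: bm_verts_def)
  ultimately have "bm_polygon m n k \<subseteq> {z. 0 \<le> dd k i z}"
    unfolding bm_polygon_def by (simp add: hull_minimal)
  then show ?thesis using assms by auto
qed

lemma edge_subset_polygon: "bm_edge m n k i \<subseteq> bm_polygon m n k"
  unfolding bm_edge_def bm_polygon_def
  by (intro closed_segment_subset_convex_hull hull_inc) (auto simp: vert_in_verts)

text \<open>On the line through edge \<open>i\<close>, the half planes of the two neighbouring edges cut out the edge.\<close>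

lemma edgeI:
  assumes "k < m" "\<And>j. 0 \<le> dd k j z" "dd k i z = 0"
  shows "z \<in> bm_edge m n k i"
proof -
  define u where "u = (z - vert k i) * cis (- (real i * al))"
  define t where "t = Re u"
  have "u = of_real t" using assms(3) by (simp add: complex_eq_iff u_def t_def dd_def)
  then have "z - vert k i = of_real t * cis (real i * al)"
    unfolding u_def by (metis (no_types, lifting) ab_left_minus cis_mult cis_zero mult.assoc
        mult.right_neutral)
  then have z: "z = vert k i + of_real t * cis (real i * al)" by (simp add: algebra_simps)
  have z': "z = vert k (Suc i) + of_real (t - len k i) * cis (real i * al)"
    by (simp add: z vert_Suc algebra_simps)
  have r1: "real i * al + - (real (Suc i) * al) = - al" by (simp add: algebra_simps)
  have "0 \<le> dd k (Suc i) z" by fact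
  also have "dd k (Suc i) z = Im (of_real (t - len k i) * cis (real i * al) * cis (- (real (Suc i) * al)))"
    unfolding z' dd_add by simp
  also have "\<dots> = (len k i - t) * sin al"
    by (simp only: mult.assoc cis_mult r1) (simp add: algebra_simps)
  finally have t1: "t \<le> len k i" using sin_al_pos by (simp add: zero_le_mult_iff)
  \<comment> \<open>\<open>i + (2 * n - 1)\<close> is the cyclic predecessor of \<open>i\<close>,
    written so that \<open>i = 0\<close> is no special case.\<close>
  have "0 \<le> dd k (i + (2 * n - 1)) z" by fact
  have S: "Suc (i + (2 * n - 1)) = i + 2 * n" using n_ge by simp
  have v: "vert k i = vert k (Suc (i + (2 * n - 1)))" unfolding S by (simp add: vert_add_2n)
  have r: "real i * al + - (real (i + (2 * n - 1)) * al) = al - 2 * pi"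
    using n_al n_ge by (simp add: algebra_simps of_nat_diff)
  have "0 \<le> dd k (i + (2 * n - 1)) z" by fact
  also have "\<dots> = Im (of_real t * cis (real i * al) * cis (- (real (i + (2 * n - 1)) * al)))"
    unfolding z dd_add v by simp
  also have "\<dots> = t * sin al"
    by (simp only: mult.assoc cis_mult r) (simp add: sin_diff)
  finally have t0: "0 \<le> t" using sin_al_pos by (simp add: zero_le_mult_iff)
  show ?thesis
  proof (cases "len k i = 0")
    case True
    then have "t = 0" using t0 t1 by simp
    then show ?thesis by (simp add: z bm_edge_def)
  next
    case False
    then have l: "len k i > 0" using t0 t1 by simp
    have "z = (1 - t / len k i) *\<^sub>R vert k i + (t / len k i) *\<^sub>R vert k (Suc i)"
      using l by (simp add: z vert_Suc scaleR_conv_of_real algebra_simps)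
    moreover have "0 \<le> t / len k i" "t / len k i \<le> 1" using l t0 t1 by auto
    ultimately show ?thesis unfolding bm_edge_def closed_segment_def by auto
  qed
qed

text \<open>The point is moved horizontally to the right and to the left, by \<open>t\<close> and
  \<open>s\<close>, as far as the half planes allow. At both ends some condition is tight, so
  \<open>edgeI\<close> places these ends on edges of the polygon, and the point lies between
  them.\<close>

lemma polygonI:
  assumes "k < m" "\<And>j. j < 2 * n \<Longrightarrow> 0 \<le> dd k j z"
  shows "z \<in> bm_polygon m n k"
proof -
  define t where "t = Min ((\<lambda>i. dd k i z / sin (real i * al)) ` {1..<n})"
  define s where "s = Min ((\<lambda>i. dd k (i + n) z / sin (real i * al)) ` {1..<n})"
  have ne: "(\<lambda>i. f i :: real) ` {1..<n} \<noteq> {}" for f using n_ge by auto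
  have nn: "0 \<le> dd k j z" for j using assms(2)[of "j mod (2 * n)"] n_ge by (simp add: dd_mod)
  have sn: "sin (real (i + n) * al) = - sin (real i * al)"
      "cos (real (i + n) * al) = - cos (real i * al)" for i
    using n_al by (simp_all add: distrib_right)
  have shift: "dd k i (z + of_real x) = dd k i z - x * sin (real i * al)" for i x
    by (simp add: dd_add)
  have t0: "0 \<le> t" unfolding t_def using nn ne sin_mult_al_pos
    by (subst Min_ge_iff) (auto intro!: divide_nonneg_pos)
  have s0: "0 \<le> s" unfolding s_def using nn ne sin_mult_al_pos
    by (subst Min_ge_iff) (auto intro!: divide_nonneg_pos)
  obtain i where i: "i \<in> {1..<n}" "t = dd k i z / sin (real i * al)"
    using Min_in[OF _ ne, of "\<lambda>i. dd k i z / sin (real i * al)"] unfolding t_def by auto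
  obtain i' where i': "i' \<in> {1..<n}" "s = dd k (i' + n) z / sin (real i' * al)"
    using Min_in[OF _ ne, of "\<lambda>i. dd k (i + n) z / sin (real i * al)"] unfolding s_def by auto
  have right: "0 \<le> dd k j (z + of_real t)" if "j < 2 * n" for j
  proof (cases "0 < j \<and> j < n")
    case True
    then have "t \<le> dd k j z / sin (real j * al)" unfolding t_def by (intro Min_le) auto
    then show ?thesis using sin_mult_al_pos[of j] True by (simp add: shift field_simps)
  next
    case nr: False
    have "sin (real j * al) \<le> 0"
    proof (cases "j = 0")
      case False
      with nr obtain l where l: "j = l + n" by (metis add.commute le_Suc_ex not_gr_zero not_less)
      then show ?thesis using that sin_mult_al_nonneg[of l] by (simp only: l sn) simp
    qed simp
    then have "t * sin (real j * al) \<le> 0" using t0 by (simp add: mult_nonneg_nonpos)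
    then show ?thesis using nn[of j] by (simp add: shift)
  qed
  have left: "0 \<le> dd k j (z + of_real (- s))" if "j < 2 * n" for j
  proof (cases "n < j")
    case True
    then obtain l where l: "j = l + n" by (metis add.commute le_Suc_ex less_imp_le)
    have lr: "l \<in> {1..<n}" using True that l by auto
    then have "s \<le> dd k (l + n) z / sin (real l * al)" unfolding s_def by (intro Min_le) auto
    then show ?thesis using sin_mult_al_pos[of l] lr unfolding shift unfolding l sn
        by (simp add: field_simps)
  next
    case False
    then have "0 \<le> sin (real j * al)" by (intro sin_mult_al_nonneg) simp
    then have "0 \<le> s * sin (real j * al)" using s0 by simp
    then show ?thesis using nn[of j] unfolding shift by simp
  qed
  have ext: "0 \<le> dd k j z'" if "\<And>j. j < 2 * n \<Longrightarrow> 0 \<le> dd k j z'" for j z'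
    using that[of "j mod (2 * n)"] n_ge by (simp add: dd_mod)
  have "dd k i (z + of_real t) = 0" using i sin_mult_al_pos[of i] unfolding shift by simp
  then have e1: "z + of_real t \<in> bm_edge m n k i"
    by (intro edgeI[OF assms(1) ext[OF right]])
  have "dd k (i' + n) (z + of_real (- s)) = 0" using i' sin_mult_al_pos[of i'] unfolding shift sn by simp
  then have e2: "z + of_real (- s) \<in> bm_edge m n k (i' + n)"
    by (intro edgeI[OF assms(1) ext[OF left]])
  have c: "convex (bm_polygon m n k)" by (simp add: bm_polygon_def)
  show ?thesis
  proof (cases "s + t = 0")
    case True
    then have "t = 0" using s0 t0 by simp
    then show ?thesis using e1 edge_subset_polygon by auto
  next
    case False
    then have st: "0 < s + t" using s0 t0 by simp
    define u where "u = s / (s + t)"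
    define v where "v = t / (s + t)"
    have uv: "u + v = 1" "u * t = v * s" "0 \<le> u" "0 \<le> v"
      using st s0 t0 by (auto simp: u_def v_def add_divide_distrib[symmetric])
    have "u *\<^sub>R (z + of_real t) + v *\<^sub>R (z + of_real (- s)) = of_real (u + v) * z + of_real (u * t - v * s)"
      by (simp add: scaleR_conv_of_real algebra_simps)
    then have "z = u *\<^sub>R (z + of_real t) + v *\<^sub>R (z + of_real (- s))" unfolding uv by simp
    also have "\<dots> \<in> bm_polygon m n k"
      using e1 e2 edge_subset_polygon uv by (intro convexD[OF c]) auto
    finally show ?thesis .
  qed
qed

lemma polygon_iff: "k < m \<Longrightarrow> z \<in> bm_polygon m n k \<longleftrightarrow> (\<forall>i<2*n. 0 \<le> dd k i z)"
  using polygonI polygon_dd_nonneg by blast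

lemma edge_iff: "k < m \<Longrightarrow> z \<in> bm_edge m n k i \<longleftrightarrow> z \<in> bm_polygon m n k \<and> dd k i z = 0"
proof -
  assume k: "k < m"
  have "dd k i z = 0" if e: "z \<in> bm_edge m n k i"
  proof -
    obtain u where "z = (1 - u) *\<^sub>R vert k i + u *\<^sub>R vert k (Suc i)"
      using e unfolding bm_edge_def closed_segment_def by auto
    then show ?thesis by (simp add: dd_convex)
  qed
  moreover have "z \<in> bm_edge m n k i" if "z \<in> bm_polygon m n k" "dd k i z = 0"
    using that k polygon_dd_nonneg by (intro edgeI) auto
  ultimately show ?thesis using edge_subset_polygon by blast
qed

section \<open>Relative interiors of edges, and the interior of a polygon\<close>

lemma sin_mult_al_eq_0:
  assumes "0 < l" "l < 2 * n" "sin (real l * al) = 0" shows "l = n"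
proof (rule ccontr)
  assume "l \<noteq> n"
  then consider "l < n" | "n < l" by linarith
  then show False
  proof cases
    case 1
    then show False using sin_mult_al_pos[of l] assms by simp
  next
    case 2
    then have "real l * al = real (l - n) * al + real n * al" by (simp add: algebra_simps of_nat_diff)
    then have "sin (real l * al) = - sin (real (l - n) * al)" by (simp add: n_al)
    moreover have "0 < sin (real (l - n) * al)" using 2 assms by (intro sin_mult_al_pos) auto
    ultimately show False using assms(3) by linarith
  qed
qed

text \<open>\<open>dd k j\<close> is affine and nonnegative on the edge, so a zero at an inner point
  forces zeros at both ends. The edges \<open>i\<close> and \<open>j\<close> are then parallel,
  hence opposite, which contradicts \<open>dd_opposite_pos\<close>.\<close>

lemma edge_interior_dd_pos:
  assumes "k < m" "0 < len k i" "0 < t" "t < 1" "i < 2 * n" "j < 2 * n" "j \<noteq> i"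
    and z: "z = (1 - t) *\<^sub>R vert k i + t *\<^sub>R vert k (Suc i)"
  shows "0 < dd k j z"
proof -
  have nn: "0 \<le> dd k j (vert k i)" "0 \<le> dd k j (vert k (Suc i))" using dd_vert_nonneg assms by auto
  have e: "dd k j z = (1 - t) * dd k j (vert k i) + t * dd k j (vert k (Suc i))"
    unfolding z by (rule dd_convex) simp
  have "dd k j z \<noteq> 0"
  proof
    assume "dd k j z = 0"
    then have 0: "dd k j (vert k i) = 0" "dd k j (vert k (Suc i)) = 0"
      using nn e assms by (auto simp: add_nonneg_eq_0_iff)
    have "dd k j (vert k (Suc i)) = dd k j (vert k i) + len k i * sin (real i * al - real j * al)"
      unfolding vert_Suc dd_add by (simp add: mult.assoc cis_mult)
    then have s: "sin (real i * al - real j * al) = 0" using 0 assms by simp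
    consider "j < i" | "i < j" using assms by linarith
    then have "vert k i = vert k (j + n)"
    proof cases
      case 1
      then have "real (i - j) * al = real i * al - real j * al" by (simp add: of_nat_diff algebra_simps)
      then have "i - j = n" using sin_mult_al_eq_0[of "i - j"] s 1 assms by simp
      then have "i = j + n" using 1 by simp
      then show ?thesis by simp
    next
      case 2
      then have "real (j - i) * al = - (real i * al - real j * al)" by (simp add: of_nat_diff algebra_simps)
      then have "sin (real (j - i) * al) = 0" using s by (metis sin_minus neg_equal_0_iff_equal)
      then have "j - i = n" using sin_mult_al_eq_0[of "j - i"] 2 assms by simp
      then have "j + n = i + 2 * n" using 2 by simp
      then show ?thesis by (metis vert_add_2n)
    qed
    then show False using dd_opposite_pos[OF assms(1), of j] 0 by simp
  qed
  then show ?thesis using nn e assms by (simp add: order.not_eq_order_implies_strict)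
qed

lemma edge_param:
  assumes "z \<in> bm_edge m n k i" "z \<notin> bm_verts m n k"
  obtains t where "0 < t" "t < 1" "z = (1 - t) *\<^sub>R vert k i + t *\<^sub>R vert k (Suc i)" "len k i \<noteq> 0"
proof -
  obtain t where t: "z = (1 - t) *\<^sub>R vert k i + t *\<^sub>R vert k (Suc i)" "0 \<le> t" "t \<le> 1"
    using assms unfolding bm_edge_def closed_segment_def by auto
  have "z \<noteq> vert k i" "z \<noteq> vert k (Suc i)" using assms vert_in_verts by metis+
  then have "t \<noteq> 0" "t \<noteq> 1" using t by auto
  moreover have "len k i \<noteq> 0"
  proof
    assume "len k i = 0"
    then have "z = vert k i" unfolding t vert_Suc by (simp add: scaleR_left_diff_distrib)
    then show False using \<open>z \<noteq> vert k i\<close> by simp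
  qed
  ultimately show ?thesis using t by (intro that[of t]) auto
qed

lemma edge_other_dd_pos:
  assumes "k < m" "z \<in> bm_edge m n k i" "z \<notin> bm_verts m n k" "i < 2 * n" "j < 2 * n" "j \<noteq> i"
  shows "0 < dd k j z"
proof -
  obtain t where "0 < t" "t < 1" "z = (1 - t) *\<^sub>R vert k i + t *\<^sub>R vert k (Suc i)" "len k i \<noteq> 0"
    using edge_param assms by blast
  then show ?thesis using edge_interior_dd_pos[of k i t j z] len_nonneg[of k i] assms by simp
qed

text \<open>A vertex lies on the lines of two cyclically consecutive edges, and the exempted index
  \<open>i\<close> can account for only one of them.\<close>

lemma not_vertI:
  assumes "i < 2 * n" "\<And>j. j < 2 * n \<Longrightarrow> j \<noteq> i \<Longrightarrow> 0 < dd k j z"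
  shows "z \<notin> bm_verts m n k"
proof
  assume "z \<in> bm_verts m n k"
  then obtain l where l: "l < 2 * n" "z = vert k l" by (auto simp: bm_verts_def)
  define l' where "l' = (if l = 0 then 2 * n - 1 else l - 1)"
  have l': "l' < 2 * n" "l' \<noteq> l" using l n_ge by (auto simp: l'_def)
  have "dd k l z = 0" using l by simp
  moreover have "dd k l' z = 0"
  proof (cases "l = 0")
    case True
    then have "z = vert k (Suc l')" using n_ge l by (simp add: l'_def)
    then show ?thesis by simp
  next
    case False
    then have "z = vert k (Suc l')" using l by (simp add: l'_def)
    then show ?thesis by simp
  qed
  ultimately show False using assms(2)[of l] assms(2)[of l'] l l' by (cases "l = i") auto
qed

definition inter :: "nat \<Rightarrow> complex set" where
  "inter k = {z. \<forall>i<2*n. 0 < dd k i z}"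

lemma inter_not_vert: "z \<in> inter k \<Longrightarrow> z \<notin> bm_verts m n k"
  using n_ge by (intro not_vertI[of 0]) (auto simp: inter_def)

lemma inter_polygon: "k < m \<Longrightarrow> z \<in> inter k \<Longrightarrow> z \<in> bm_polygon m n k"
  by (auto simp: inter_def polygon_iff intro: less_imp_le)

lemma inter_not_edge: "k < m \<Longrightarrow> z \<in> inter k \<Longrightarrow> i < 2 * n \<Longrightarrow> z \<notin> bm_edge m n k i"
  using edge_iff by (fastforce simp: inter_def)

lemma open_dd_pos: "finite I \<Longrightarrow> open {z. \<forall>j\<in>I. 0 < dd k j z}"
proof -
  assume "finite I"
  have "open {z. 0 < dd k j z}" for j
    by (intro open_Collect_less continuous_intros)
  then have "open (\<Inter>j\<in>I. {z. 0 < dd k j z})" using \<open>finite I\<close> by (intro open_INT) auto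
  also have "(\<Inter>j\<in>I. {z. 0 < dd k j z}) = {z. \<forall>j\<in>I. 0 < dd k j z}" by auto
  finally show ?thesis .
qed

lemma open_inter: "open (inter k)"
proof -
  have "inter k = {z. \<forall>j\<in>{..<2*n}. 0 < dd k j z}" by (auto simp: inter_def)
  then show ?thesis using open_dd_pos[of "{..<2*n}" k] by simp
qed

lemma mem_edges: "(k, i) \<in> bm_edges m n \<longleftrightarrow> k < m \<and> i < 2 * n \<and> 0 < len k i"
  using len_nonneg[of k i] by (auto simp: bm_edges_def bm_vec_eq)

lemma polygon_cases:
  assumes "k < m" "z \<in> bm_polygon m n k" "z \<notin> bm_verts m n k"
  obtains "z \<in> inter k" | i where "(k, i) \<in> bm_edges m n" "z \<in> bm_edge m n k i"
proof (cases "z \<in> inter k")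
  case False
  then obtain i where i: "i < 2 * n" "\<not> 0 < dd k i z" by (auto simp: inter_def)
  then have "dd k i z = 0" using polygon_dd_nonneg[OF assms(1,2), of i] by simp
  then have e: "z \<in> bm_edge m n k i" using assms edge_iff by simp
  then have "len k i \<noteq> 0" using edge_param assms(3) by blast
  then have "0 < len k i" using len_nonneg[OF assms(1), of i] by simp
  then show ?thesis using that(2)[of i] e i assms by (simp add: mem_edges)
qed

section \<open>Points of the surface\<close>

definition nb :: "nat \<Rightarrow> nat \<Rightarrow> nat" where "nb k i = (if up k i then k + 1 else k - 1)"

definition opp :: "nat \<Rightarrow> nat" where "opp i = (i + n) mod (2 * n)"

definition trn :: "nat \<Rightarrow> nat \<Rightarrow> complex" where
  "trn k i = vert (nb k i) (opp i + 1) - vert k i"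

lemma opp_less: "opp i < 2 * n"
  using n_ge by (simp add: opp_def)

lemma opp_cases: "i < 2 * n \<Longrightarrow> opp i = (if i < n then i + n else i - n)"
  by (auto simp: opp_def mod_if)

lemma opp_opp: "i < 2 * n \<Longrightarrow> opp (opp i) = i"
  using n_ge by (simp add: opp_cases opp_less) linarith

lemma even_opp: "even (opp i) \<longleftrightarrow> even (i + n)"
  by (simp add: opp_def dvd_mod_iff)

text \<open>Because \<open>sl 0 = sl m = 0\<close>, an edge of positive length never points beyond
  the first or the last polygon. So the neighbour exists, and the subtraction in \<open>nb\<close>
  does not truncate.\<close>

lemma nb_edge:
  assumes "(k, i) \<in> bm_edges m n"
  shows "(nb k i, opp i) \<in> bm_edges m n" "up (nb k i) (opp i) \<longleftrightarrow> \<not> up k i"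
    "nb (nb k i) (opp i) = k" "len (nb k i) (opp i) = len k i" "nb k i \<noteq> k" "odd (nb k i) = even k"
proof -
  have a: "k < m" "i < 2 * n" "0 < len k i" using assms by (auto simp: mem_edges)
  have "len k i = (if up k i then sl (k + 1) else sl k)" by (simp add: len_def)
  then have c: "if up k i then k + 1 < m else 0 < k"
    using a m_ge sl_0 sl_m by (metis Suc_eq_plus1 Suc_lessI less_irrefl not_gr_zero)
  show o: "odd (nb k i) = even k" using c by (auto simp: nb_def)
  show "nb k i \<noteq> k" using c by (auto simp: nb_def)
  show u: "up (nb k i) (opp i) \<longleftrightarrow> \<not> up k i"
    using o by (auto simp: up_def even_opp)
  show "nb (nb k i) (opp i) = k" using u c by (auto simp: nb_def)
  show l: "len (nb k i) (opp i) = len k i" using u c by (auto simp: len_def nb_def)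
  show "(nb k i, opp i) \<in> bm_edges m n" using l c a opp_less by (auto simp: mem_edges nb_def)
qed

lemma glued_iff:
  "bm_glued m n (k, i) (k', i') \<longleftrightarrow> (k, i) \<in> bm_edges m n \<and> k' = nb k i \<and> i' = opp i"
proof -
  have odd_iff: "bm_glued_odd m n (k, i) (k', i') \<longleftrightarrow> (k, i) \<in> bm_edges m n \<and> odd k \<and> k' = nb k i \<and> i'
      = opp i"
    for k i k' i'
    using nb_edge[of k i] by (auto simp: bm_glued_odd_def nb_def up_def opp_def odd_pos)
  show ?thesis unfolding bm_glued_def odd_iff
    using nb_edge[of k i] nb_edge[of k' i'] opp_opp[of i] opp_opp[of i'] by (auto simp: mem_edges)
qed

lemma cis_opp: "cis (real (opp i) * al) = - cis (real i * al)" if "i < 2 * n"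
proof (cases "i < n")
  case True
  have "real (i + n) * al = real i * al + pi" using n_al by (simp add: algebra_simps)
  then show ?thesis using True that by (simp add: opp_cases complex_eq_iff)
next
  case False
  then have "real (i - n) * al = real i * al - pi" using n_al by (simp add: algebra_simps of_nat_diff)
  then show ?thesis using False that by (simp add: opp_cases complex_eq_iff cos_diff sin_diff)
qed

lemma vert_opp:
  assumes "(k, i) \<in> bm_edges m n"
  shows "vert (nb k i) (Suc (opp i)) = vert k i + trn k i"
    "vert (nb k i) (opp i) = vert k (Suc i) + trn k i"
  using nb_edge(4)[OF assms] assms cis_opp[of i] by (auto simp: trn_def vert_Suc mem_edges)

lemma trn_opp:
  assumes "(k, i) \<in> bm_edges m n" shows "trn (nb k i) (opp i) = - trn k i"
proof -
  have "trn (nb k i) (opp i) = vert k (Suc i) - vert (nb k i) (opp i)"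
    using nb_edge[OF assms] assms by (simp add: trn_def[of "nb k i"] opp_opp mem_edges)
  then show ?thesis using vert_opp(2)[OF assms] by simp
qed

lemma edge_trn:
  assumes "(k, i) \<in> bm_edges m n" "z \<in> bm_edge m n k i"
  shows "z + trn k i \<in> bm_edge m n (nb k i) (opp i)"
proof -
  obtain t where t: "z = (1 - t) *\<^sub>R vert k i + t *\<^sub>R vert k (Suc i)" "0 \<le> t" "t \<le> 1"
    using assms unfolding bm_edge_def closed_segment_def by auto
  have "z + trn k i = (1 - (1 - t)) *\<^sub>R vert (nb k i) (opp i) + (1 - t) *\<^sub>R vert (nb k i) (Suc (opp i))"
    unfolding t vert_opp[OF assms(1)] by (simp add: scaleR_left_diff_distrib scaleR_add_right)
  then show ?thesis using t unfolding bm_edge_def closed_segment_def by (auto intro!: exI[of _ "1 - t"])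
qed

lemma edge_trn_not_vert:
  assumes "(k, i) \<in> bm_edges m n" "z \<in> bm_edge m n k i" "z \<notin> bm_verts m n k"
  shows "z + trn k i \<notin> bm_verts m n (nb k i)"
proof -
  obtain t where t: "0 < t" "t < 1" "z = (1 - t) *\<^sub>R vert k i + t *\<^sub>R vert k (Suc i)"
    using edge_param assms by blast
  have e: "z + trn k i = (1 - (1 - t)) *\<^sub>R vert (nb k i) (opp i) + (1 - t) *\<^sub>R vert (nb k i) (Suc (opp i))"
    unfolding t vert_opp[OF assms(1)] by (simp add: scaleR_left_diff_distrib scaleR_add_right)
  have "(nb k i, opp i) \<in> bm_edges m n" using nb_edge assms by auto
  then show ?thesis
    using edge_interior_dd_pos[OF _ _ _ _ _ _ _ e] t
    by (intro not_vertI[of "opp i"]) (auto simp: mem_edges)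
qed

text \<open>The two polygons lie on opposite sides of their common edge. This sign change tells
  which of them receives a small translate of a point of the edge.\<close>

lemma dd_trn:
  assumes "(k, i) \<in> bm_edges m n" shows "dd (nb k i) (opp i) (z + trn k i) = - dd k i z"
proof -
  have i: "i < 2 * n" using assms by (simp add: mem_edges)
  have c: "cis (- (real (opp i) * al)) = - cis (- (real i * al))"
    using cis_opp[OF i] by (metis cis_cnj complex_cnj_minus)
  have "dd (nb k i) (opp i) (z + trn k i) = Im ((z - vert k (Suc i)) * cis (- (real (opp i) * al)))"
    using vert_opp(2)[OF assms] by (simp add: dd_def)
  also have "\<dots> = - Im ((z - vert k (Suc i)) * cis (- (real i * al)))"
    unfolding c by (simp only: mult_minus_right uminus_complex.sel)
  also have "Im ((z - vert k (Suc i)) * cis (- (real i * al)))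
      = dd k i z - Im (of_real (len k i) * (cis (real i * al) * cis (- (real i * al))))"
    by (simp add: dd_def vert_Suc algebra_simps)
  also have "\<dots> = dd k i z" by (simp add: cis_mult)
  finally show ?thesis .
qed

section \<open>The equivalence classes of the gluing\<close>

lemma ident_iff: "((k, z), (k', z')) \<in> bm_ident m n \<longleftrightarrow>
    (\<exists>i. (k, i) \<in> bm_edges m n \<and> z \<in> bm_edge m n k i \<and> k' = nb k i \<and> z' = z + trn k i)"
  by (auto simp: bm_ident_def glued_iff trn_def)

lemma sym_ident: "sym (bm_ident m n)"
proof (rule symI, clarify)
  fix k z k' z' assume "((k, z), (k', z')) \<in> bm_ident m n"
  then obtain i where i: "(k, i) \<in> bm_edges m n" "z \<in> bm_edge m n k i" "k' = nb k i" "z' = z + trn k i"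
    by (auto simp: ident_iff)
  have "(k', opp i) \<in> bm_edges m n" "nb k' (opp i) = k" "trn k' (opp i) = - trn k i"
    using nb_edge[OF i(1)] i trn_opp by auto
  moreover have "z' \<in> bm_edge m n k' (opp i)" using edge_trn i by auto
  ultimately show "((k', z'), (k, z)) \<in> bm_ident m n" using i
      by (auto simp: ident_iff intro!: exI[of _ "opp i"])
qed

lemma equiv_rel: "equiv (bm_carrier m n) (bm_rel m n)"
proof (rule equivI)
  show "sym (bm_rel m n)" using sym_rtrancl[OF sym_ident] by (auto simp: bm_rel_def sym_def)
  show "trans (bm_rel m n)" by (auto simp: bm_rel_def intro!: transI intro: rtrancl_trans)
qed (auto simp: bm_rel_def refl_on_def)

abbreviation cl :: "nat \<Rightarrow> complex \<Rightarrow> bm_point" where "cl k z \<equiv> bm_rel m n `` {(k, z)}"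

lemma cl_self: "k < m \<Longrightarrow> z \<in> bm_polygon m n k \<Longrightarrow> (k, z) \<in> cl k z"
  by (auto simp: bm_rel_def bm_carrier_def)

lemma cl_surface: "k < m \<Longrightarrow> z \<in> bm_polygon m n k \<Longrightarrow> cl k z \<in> bm_surface m n"
  by (auto simp: bm_surface_def bm_carrier_def intro!: quotientI)

lemma surface_rep:
  assumes "p \<in> bm_surface m n" "(k, z) \<in> p"
  shows "k < m" "z \<in> bm_polygon m n k" "p = cl k z"
proof -
  have "(k, z) \<in> bm_carrier m n"
    using assms Union_quotient[OF equiv_rel] unfolding bm_surface_def by blast
  then show "k < m" "z \<in> bm_polygon m n k" by (auto simp: bm_carrier_def)
  show "p = cl k z"
  proof -
    obtain x where x: "p = bm_rel m n `` {x}" using assms(1) unfolding bm_surface_def by (rule quotientE)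
    then have "(x, (k, z)) \<in> bm_rel m n" using assms(2) by auto
    then show ?thesis using equiv_class_eq[OF equiv_rel] x by simp
  qed
qed

lemma surface_obtain:
  assumes "p \<in> bm_surface m n"
  obtains k z where "k < m" "z \<in> bm_polygon m n k" "p = cl k z" "(k, z) \<in> p"
  using assms cl_self unfolding bm_surface_def quotient_def bm_carrier_def by auto

lemma cl_eqI:
  assumes "p \<in> bm_surface m n" "q \<in> bm_surface m n" "x \<in> p" "x \<in> q" shows "p = q"
  using surface_rep(3)[OF assms(1), of "fst x" "snd x"] surface_rep(3)[OF assms(2), of "fst x"
      "snd x"] assms(3,4)
  by simp

lemma cl_inter:
  assumes "k < m" "z \<in> inter k" shows "cl k z = {(k, z)}"
proof -
  have "y = (k, z)" if "((k, z), y) \<in> (bm_ident m n)\<^sup>*" for y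
    using that
  proof (induction rule: rtrancl_induct)
    case (step y y')
    then show ?case using inter_not_edge[OF assms] by (cases y') (auto simp: ident_iff mem_edges)
  qed simp
  then show ?thesis using assms inter_polygon by (auto simp: bm_rel_def bm_carrier_def)
qed

text \<open>Away from the vertices a point lies on a single edge, and the only identification
  available to its partner leads back. So the closure of the gluing stops after one step; at
  vertices it need not, hence the restriction to regular points.\<close>

lemma cl_edge:
  assumes "(k, i) \<in> bm_edges m n" "z \<in> bm_edge m n k i" "z \<notin> bm_verts m n k"
  shows "cl k z = {(k, z), (nb k i, z + trn k i)}"
proof -
  have uniq: "j = i" if "(k, i) \<in> bm_edges m n" "z \<in> bm_edge m n k i" "z \<notin> bm_verts m n k"
      "(k, j) \<in> bm_edges m n" "z \<in> bm_edge m n k j" for k z i j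
    using that edge_other_dd_pos[of k z i j] edge_iff[of k z j] by (fastforce simp: mem_edges)
  note nbe = nb_edge[OF assms(1)] edge_trn[OF assms(1,2)] edge_trn_not_vert[OF assms]
  have "y \<in> {(k, z), (nb k i, z + trn k i)}" if "((k, z), y) \<in> (bm_ident m n)\<^sup>*" for y
    using that
  proof (induction rule: rtrancl_induct)
    case (step y y')
    obtain k' z' where y': "y' = (k', z')" by force
    show ?case
    proof (cases "y = (k, z)")
      case True
      with step y' obtain j where "(k, j) \<in> bm_edges m n" "z \<in> bm_edge m n k j" "k' = nb k j"
          "z' = z + trn k j"
        by (auto simp: ident_iff)
      then show ?thesis using uniq[OF assms] y' by blast
    next
      case False
      with step have y: "y = (nb k i, z + trn k i)" by auto
      with step y' obtain j where j: "(nb k i, j) \<in> bm_edges m n" "z + trn k i \<in> bm_edge m n (nb k i) j"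
        "k' = nb (nb k i) j" "z' = z + trn k i + trn (nb k i) j"
        by (auto simp: ident_iff)
      then have "j = opp i" using uniq[of "nb k i" "opp i" "z + trn k i" j] nbe by auto
      then show ?thesis using j nbe y' trn_opp[OF assms(1)] by simp
    qed
  qed simp
  moreover have "((k, z), (nb k i, z + trn k i)) \<in> bm_rel m n"
    using assms nbe edge_subset_polygon by (fastforce simp: bm_rel_def bm_carrier_def ident_iff mem_edges)
  moreover have "((k, z), (k, z)) \<in> bm_rel m n"
    using assms edge_subset_polygon by (fastforce simp: bm_rel_def bm_carrier_def mem_edges)
  ultimately show ?thesis by (auto simp: bm_rel_def)
qed

abbreviation regular :: "bm_point set" where "regular \<equiv> bm_surface m n - bm_singular m n"

lemma regularI:
  assumes "k < m" "z \<in> bm_polygon m n k" "z \<notin> bm_verts m n k"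
  shows "cl k z \<in> regular"
proof -
  have "z' \<notin> bm_verts m n k'" if "(k', z') \<in> cl k z" for k' z'
    using assms
  proof (cases rule: polygon_cases)
    case 1
    then show ?thesis using that cl_inter assms by auto
  next
    case (2 i)
    then show ?thesis using that cl_edge[OF 2 assms(3)] edge_trn_not_vert[OF 2 assms(3)] assms by auto
  qed
  then show ?thesis using cl_surface[OF assms(1,2)] by (auto simp: bm_singular_def)
qed

lemma regular_rep:
  assumes "p \<in> regular" "(k, z) \<in> p"
  shows "k < m" "z \<in> bm_polygon m n k" "p = cl k z" "z \<notin> bm_verts m n k"
  using assms surface_rep by (auto simp: bm_singular_def)

lemma regular_obtain:
  assumes "p \<in> regular"
  obtains k z where "k < m" "z \<in> bm_polygon m n k" "z \<notin> bm_verts m n k" "p = cl k z" "(k, z) \<in> p"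
proof -
  obtain k z where kz: "(k, z) \<in> p" using surface_obtain[of p] assms by blast
  show ?thesis using that[OF regular_rep(1,2,4,3)[OF assms kz] kz] .
qed

section \<open>Small translations of regular points\<close>

lemma moveI:
  assumes "p \<in> bm_surface m n" "q \<in> bm_surface m n" "(k, z) \<in> p" "(k, z + w) \<in> q"
  shows "bm_move m n p w q"
  using assms by (auto simp: bm_move_def)

lemma edge_nbhd:
  assumes "(k, i) \<in> bm_edges m n" "z \<in> bm_edge m n k i" "z \<notin> bm_verts m n k"
  shows "\<exists>e>0. \<forall>w. norm w < e \<longrightarrow> z + w \<notin> bm_verts m n k
     \<and> (z + w \<in> bm_polygon m n k \<longleftrightarrow> 0 \<le> dd k i (z + w))
     \<and> (z + w \<in> inter k \<longleftrightarrow> 0 < dd k i (z + w))"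
proof -
  let ?U = "{z. \<forall>j\<in>{..<2*n} - {i}. 0 < dd k j z}"
  have k: "k < m" "i < 2 * n" using assms by (auto simp: mem_edges)
  have "open ?U" by (rule open_dd_pos) auto
  moreover have "z \<in> ?U" using edge_other_dd_pos[OF k(1) assms(2,3) k(2)] by auto
  ultimately obtain e where e: "e > 0" "ball z e \<subseteq> ?U" by (rule openE)
  have *: "0 < dd k j (z + w)" if "norm w < e" "j < 2 * n" "j \<noteq> i" for w j
  proof -
    have "z + w \<in> ?U" using that e by (auto simp: dist_norm subset_iff)
    then show ?thesis using that by auto
  qed
  show ?thesis
  proof (intro exI[of _ e] conjI allI impI e(1))
    fix w :: complex assume w: "norm w < e"
    show "z + w \<notin> bm_verts m n k" using * w k by (intro not_vertI[of i]) auto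
    show "z + w \<in> bm_polygon m n k \<longleftrightarrow> 0 \<le> dd k i (z + w)"
      using *[OF w] k less_imp_le unfolding polygon_iff[OF k(1)] by metis
    show "z + w \<in> inter k \<longleftrightarrow> 0 < dd k i (z + w)"
      using *[OF w] k unfolding inter_def mem_Collect_eq by metis
  qed
qed

text \<open>This replaces charts: a small translate exists, is unique, and determines the point it
  comes from. The last property lets agreement of two maps be traced back from a nearby point in
  \<open>shear_phi_aux\<close>.\<close>

lemma regular_nbhd:
  assumes "p \<in> regular"
  shows "\<exists>e>0. \<forall>w. norm w < e \<longrightarrow> (\<exists>q\<in>regular. bm_move m n p w q \<and> (\<forall>q'. bm_move m n p w q' \<longrightarrow> q' = q)
     \<and> (\<forall>p'. bm_move m n p' w q \<longrightarrow> p' = p))"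
proof -
  obtain k z where kz: "k < m" "z \<in> bm_polygon m n k" "z \<notin> bm_verts m n k" "p = cl k z" "(k, z) \<in> p"
    using regular_obtain assms by blast
  have unmove: "\<forall>p'. bm_move m n p' w q \<longrightarrow> p' = p"
    if that: "\<And>k z. (k, z) \<in> q \<Longrightarrow> (k, z - w) \<in> p" for w q
  proof (intro allI impI)
    fix p' assume p': "bm_move m n p' w q"
    then obtain k1 z1 where "(k1, z1) \<in> p'" "(k1, z1 + w) \<in> q" by (auto simp: bm_move_def)
    then have "(k1, z1) \<in> p" using that[of k1 "z1 + w"] by simp
    then show "p' = p" using cl_eqI[of p' p] p' assms \<open>(k1, z1) \<in> p'\<close> by (auto simp: bm_move_def)
  qed
  show ?thesis using kz(1-3)
  proof (cases rule: polygon_cases)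
    case 1
    then obtain e where e: "e > 0" "ball z e \<subseteq> inter k" using openE[OF open_inter] by blast
    have p: "p = {(k, z)}" using 1 kz cl_inter by simp
    show ?thesis
    proof (intro exI[of _ e] conjI allI impI e(1))
      fix w :: complex assume "norm w < e"
      then have w: "z + w \<in> inter k" using e by (auto simp: dist_norm subset_iff)
      have q: "cl k (z + w) = {(k, z + w)}" by (rule cl_inter[OF kz(1) w])
      have r: "cl k (z + w) \<in> regular" using regularI inter_polygon inter_not_vert kz(1) w by auto
      show "\<exists>q\<in>regular. bm_move m n p w q \<and> (\<forall>q'. bm_move m n p w q' \<longrightarrow> q' = q)
          \<and> (\<forall>p'. bm_move m n p' w q \<longrightarrow> p' = p)"
      proof (intro bexI[OF _ r] conjI unmove)
        show "bm_move m n p w (cl k (z + w))" using assms r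
            by (intro moveI[where k = k and z = z]) (auto simp: p q)
        show "\<forall>q'. bm_move m n p w q' \<longrightarrow> q' = cl k (z + w)" using p surface_rep by (auto simp: bm_move_def)
        show "(k1, z1 - w) \<in> p" if "(k1, z1) \<in> cl k (z + w)" for k1 z1
          using that unfolding q p by auto
      qed
    qed
  next
    case (2 i)
    define k' z' where "k' = nb k i" and "z' = z + trn k i"
    have p: "p = {(k, z), (k', z')}" using cl_edge[OF 2 kz(3)] kz by (simp add: k'_def z'_def)
    have e': "(k', opp i) \<in> bm_edges m n" "z' \<in> bm_edge m n k' (opp i)" "z' \<notin> bm_verts m n k'"
      using nb_edge[OF 2(1)] edge_trn[OF 2] edge_trn_not_vert[OF 2 kz(3)] by (auto simp: k'_def z'_def)
    have k'm: "k' < m" using e'(1) by (simp add: mem_edges)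
    obtain e1 where e1: "e1 > 0" "\<And>w. norm w < e1 \<Longrightarrow> z + w \<notin> bm_verts m n k
       \<and> (z + w \<in> bm_polygon m n k \<longleftrightarrow> 0 \<le> dd k i (z + w)) \<and> (z + w \<in> inter k \<longleftrightarrow> 0 < dd k i (z + w))"
      using edge_nbhd[OF 2 kz(3)] by metis
    obtain e2 where e2: "e2 > 0" "\<And>w. norm w < e2 \<Longrightarrow> z' + w \<notin> bm_verts m n k'
       \<and> (z' + w \<in> bm_polygon m n k' \<longleftrightarrow> 0 \<le> dd k' (opp i) (z' + w)) \<and> (z' + w \<in> inter k' \<longleftrightarrow> 0
           < dd k' (opp i) (z' + w))"
      using edge_nbhd[OF e'] by metis
    show ?thesis
    proof (intro exI[of _ "min e1 e2"] conjI allI impI)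
      show "0 < min e1 e2" using e1 e2 by simp
      fix w :: complex assume "norm w < min e1 e2"
      then have w: "norm w < e1" "norm w < e2" by auto
      have zw: "z' + w = (z + w) + trn k i" by (simp add: z'_def)
      have D: "dd k' (opp i) (z' + w) = - dd k i (z + w)" unfolding zw k'_def by (rule dd_trn[OF 2(1)])
      \<comment> \<open>The sign decides whether the translate stays in polygon \<open>k\<close>,
        passes to the neighbour, or slides along the common edge. In the first two cases the other
        polygon does not contain its candidate, so the target is unambiguous.\<close>
      consider "0 < dd k i (z + w)" | "dd k i (z + w) < 0" | "dd k i (z + w) = 0" by linarith
      then show "\<exists>q\<in>regular. bm_move m n p w q \<and> (\<forall>q'. bm_move m n p w q' \<longrightarrow> q' = q)
          \<and> (\<forall>p'. bm_move m n p' w q \<longrightarrow> p' = p)"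
      proof cases
        case d: 1
        have zi: "z + w \<in> inter k" and np: "z' + w \<notin> bm_polygon m n k'"
          using d D e1(2)[OF w(1)] e2(2)[OF w(2)] by auto
        have q: "cl k (z + w) = {(k, z + w)}" by (rule cl_inter[OF kz(1) zi])
        have r: "cl k (z + w) \<in> regular" using regularI inter_polygon inter_not_vert kz(1) zi by auto
        show ?thesis
        proof (intro bexI[OF _ r] conjI unmove)
          show "bm_move m n p w (cl k (z + w))" using assms r
              by (intro moveI[where k = k and z = z]) (auto simp: p q)
          show "\<forall>q'. bm_move m n p w q' \<longrightarrow> q' = cl k (z + w)"
          proof (intro allI impI)
            fix q' assume a: "bm_move m n p w q'"
            then have q': "q' \<in> bm_surface m n" "(k, z + w) \<in> q' \<or> (k', z' + w) \<in> q'" using p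
                by (auto simp: bm_move_def)
            then have "(k, z + w) \<in> q'" using np surface_rep(2)[OF q'(1)] by blast
            then show "q' = cl k (z + w)" by (rule surface_rep(3)[OF q'(1)])
          qed
          show "(k1, z1 - w) \<in> p" if "(k1, z1) \<in> cl k (z + w)" for k1 z1
            using that unfolding q p by auto
        qed
      next
        case d: 2
        have zi: "z' + w \<in> inter k'" and np: "z + w \<notin> bm_polygon m n k"
          using d D e1(2)[OF w(1)] e2(2)[OF w(2)] by auto
        have q: "cl k' (z' + w) = {(k', z' + w)}" by (rule cl_inter[OF k'm zi])
        have r: "cl k' (z' + w) \<in> regular" using regularI inter_polygon inter_not_vert k'm zi by auto
        show ?thesis
        proof (intro bexI[OF _ r] conjI unmove)
          show "bm_move m n p w (cl k' (z' + w))" using assms r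
              by (intro moveI[where k = k' and z = z']) (auto simp: p q)
          show "\<forall>q'. bm_move m n p w q' \<longrightarrow> q' = cl k' (z' + w)"
          proof (intro allI impI)
            fix q' assume a: "bm_move m n p w q'"
            then have q': "q' \<in> bm_surface m n" "(k, z + w) \<in> q' \<or> (k', z' + w) \<in> q'" using p
                by (auto simp: bm_move_def)
            then have "(k', z' + w) \<in> q'" using np surface_rep(2)[OF q'(1)] by blast
            then show "q' = cl k' (z' + w)" by (rule surface_rep(3)[OF q'(1)])
          qed
          show "(k1, z1 - w) \<in> p" if "(k1, z1) \<in> cl k' (z' + w)" for k1 z1
            using that unfolding q p by auto
        qed
      next
        case d: 3
        have zp: "z + w \<in> bm_polygon m n k" "z + w \<notin> bm_verts m n k" using d D e1(2)[OF w(1)] by auto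
        have ze: "z + w \<in> bm_edge m n k i" using zp d edge_iff[OF kz(1)] by simp
        have q: "cl k (z + w) = {(k, z + w), (k', z' + w)}"
          using cl_edge[OF 2(1) ze zp(2)] by (simp add: k'_def z'_def algebra_simps)
        have r: "cl k (z + w) \<in> regular" using regularI kz(1) zp by auto
        show ?thesis
        proof (intro bexI[OF _ r] conjI unmove)
          show "bm_move m n p w (cl k (z + w))" using assms r
              by (intro moveI[where k = k and z = z]) (auto simp: p q)
          show "\<forall>q'. bm_move m n p w q' \<longrightarrow> q' = cl k (z + w)"
          proof (intro allI impI)
            fix q' assume a: "bm_move m n p w q'"
            then have q': "q' \<in> bm_surface m n" by (simp add: bm_move_def)
            obtain k1 z1 where 1: "(k1, z1) \<in> p" "(k1, z1 + w) \<in> q'" using a unfolding bm_move_def by blast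
            have "(k1, z1 + w) \<in> cl k (z + w)" using 1(1) unfolding p q by auto
            then show "q' = cl k (z + w)" using q' cl_eqI[OF q' _ 1(2)] r by (metis DiffD1)
          qed
          show "(k1, z1 - w) \<in> p" if "(k1, z1) \<in> cl k (z + w)" for k1 z1
            using that unfolding q p by auto
        qed
      qed
    qed
  qed
qed

section \<open>The mirror symmetry of the polygons and the flip\<close>

definition mirror :: "nat \<Rightarrow> complex \<Rightarrow> complex" where
  "mirror k z = of_real (len k 0) - cnj z"

lemma mirror_mirror [simp]: "mirror k (mirror k z) = z"
  by (simp add: mirror_def)

text \<open>The bottom edge is its own mirror image, so the vertices \<open>0\<close> and
  \<open>1\<close> are exchanged; hence the offset \<open>2 * n + 1\<close>. As this number is odd,
  the reversal also swaps the two lengths in \<open>vert_formula\<close>, just as complex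
  conjugation requires.\<close>

lemma mirror_vert:
  assumes "j \<le> 2 * n + 1" shows "mirror k (vert k j) = vert k (2 * n + 1 - j)"
proof -
  define j' where "j' = 2 * n + 1 - j"
  have p: "even j' \<longleftrightarrow> odd j" using assms by (auto simp: j'_def)
  then have l: "len k (Suc j') = len k j" "len k j' = len k (Suc j)" by (auto intro: len_parity)
  have x: "real j' * al = (al - real j * al) + 2 * pi"
    using assms n_al by (simp add: j'_def of_nat_diff algebra_simps)
  have c: "cis (real j' * al) = cis (al - real j * al)" "cis (real j' * al - al) = cis (- (real j * al))"
    unfolding x by (simp_all add: complex_eq_iff)
  have F: "vert_formula k (real j' * al) j' = - cnj (vert_formula k (real j * al) j)"
    unfolding vert_formula_def l c by (simp add: cis_cnj add.commute)
  have 0: "of_real (len k 0) + cnj (vert_formula k 0 0) = - vert_formula k 0 0"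
    using sin_al_pos by (simp add: vert_formula_def complex_eq_iff field_simps)
  have "mirror k (vert k j) = (of_real (len k 0) + cnj (vert_formula k 0 0)) - cnj (vert_formula k
      (real j * al) j)"
    by (simp add: mirror_def vert_diff)
  also have "\<dots> = vert k j'" unfolding 0 vert_diff F by simp
  finally show ?thesis by (simp add: j'_def)
qed

lemma dd_mirror:
  assumes "j \<le> 2 * n" shows "dd k (2 * n - j) (mirror k z) = dd k j z"
proof -
  have v: "vert k (2 * n - j) = mirror k (vert k (Suc j))" using mirror_vert[of "Suc j" k] assms by simp
  have "real (2 * n - j) * al = 2 * pi - real j * al" using assms n_al
      by (simp add: of_nat_diff algebra_simps)
  then have r: "cos (real (2 * n - j) * al) = cos (real j * al)"
      "sin (real (2 * n - j) * al) = - sin (real j * al)"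
    by (simp_all add: cos_diff sin_diff)
  have "dd k (2 * n - j) (mirror k z) =
    (Im z - Im (vert k (Suc j))) * cos (real j * al) - (Re z - Re (vert k (Suc j))) * sin (real j * al)"
    unfolding dd_eq v r by (simp add: mirror_def algebra_simps)
  also have "\<dots> = dd k j z - dd k j (vert k (Suc j))" unfolding dd_eq by (simp add: algebra_simps)
  finally show ?thesis by simp
qed

lemma dd_mirror': "j \<le> 2 * n \<Longrightarrow> dd k j (mirror k z) = dd k (2 * n - j) z"
  using dd_mirror[of "2 * n - j" k z] by simp

lemma mirror_polygon: "k < m \<Longrightarrow> z \<in> bm_polygon m n k \<Longrightarrow> mirror k z \<in> bm_polygon m n k"
  using polygon_dd_nonneg by (auto intro!: polygonI simp: dd_mirror')

lemma mirror_verts: "z \<in> bm_verts m n k \<Longrightarrow> mirror k z \<in> bm_verts m n k"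
  using mirror_vert vert_in_verts by (auto simp: bm_verts_def)

definition refl_edge :: "nat \<Rightarrow> nat" where "refl_edge i = (2 * n - i) mod (2 * n)"

lemma mirror_edge:
  assumes "k < m" "i < 2 * n" "z \<in> bm_edge m n k i" shows "mirror k z \<in> bm_edge m n k (refl_edge i)"
  using assms mirror_polygon unfolding edge_iff[OF assms(1)] by (simp add: refl_edge_def dd_mod dd_mirror)

lemma even_refl_edge: "i < 2 * n \<Longrightarrow> even (refl_edge i) = even i"
  by (auto simp: refl_edge_def dvd_mod_iff)

text \<open>The third equation says that mirroring commutes with the gluing translations, which
  makes the flip well defined on equivalence classes.\<close>

lemma refl_edge_facts:
  assumes "(k, i) \<in> bm_edges m n"
  shows "(k, refl_edge i) \<in> bm_edges m n" "nb k (refl_edge i) = nb k i"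
    "mirror (nb k i) (z + trn k i) = mirror k z + trn k (refl_edge i)"
proof -
  have i: "k < m" "i < 2 * n" "0 < len k i" using assms by (auto simp: mem_edges)
  have e: "even (refl_edge i) = even i" using even_refl_edge i by simp
  show E: "(k, refl_edge i) \<in> bm_edges m n"
    using e i n_ge len_parity[of "refl_edge i" i k] by (simp add: mem_edges) (simp add: refl_edge_def)
  show N: "nb k (refl_edge i) = nb k i" using e by (simp add: nb_def up_def)
  have v1: "vert k (refl_edge i) = mirror k (vert k (Suc i))"
    using mirror_vert[of "Suc i" k] i by (simp add: refl_edge_def vert_mod)
  have "vert (nb k i) (opp (refl_edge i)) = mirror (nb k i) (vert (nb k i) (Suc (opp i)))"
  proof -
    have "opp (refl_edge i) = (2 * n - opp i) mod (2 * n)"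
      using i n_ge by (auto simp: opp_cases refl_edge_def mod_if opp_def)
    then show ?thesis using mirror_vert[of "Suc (opp i)" "nb k i"] opp_less[of i] by (simp add: vert_mod)
  qed
  then have "vert k (Suc (refl_edge i)) + trn k (refl_edge i) = mirror (nb k i) (vert k i + trn k i)"
    using vert_opp(2)[OF E] vert_opp(1)[OF assms] N by simp
  moreover have "vert k (Suc (refl_edge i)) = mirror k (vert k i)"
  proof (cases "i = 0")
    case True
    then show ?thesis using mirror_vert[of "2 * n" k] by (simp add: refl_edge_def)
  next
    case False
    then show ?thesis using mirror_vert[of i k] i by (simp add: refl_edge_def Suc_diff_le)
  qed
  ultimately have "trn k (refl_edge i) = mirror (nb k i) (vert k i + trn k i) - mirror k (vert k i)"
    by (metis add_diff_cancel_left')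
  then show "mirror (nb k i) (z + trn k i) = mirror k z + trn k (refl_edge i)"
    by (simp add: mirror_def)
qed

lemma flip_eq: "bm_flip m n p = (\<lambda>(k, z). (k, mirror k z)) ` p"
  by (simp add: bm_flip_def mirror_def bm_even_len_eq)

lemma flip_flip: "bm_flip m n (bm_flip m n p) = p"
  by (force simp: flip_eq image_image case_prod_unfold)

lemma mirror_rel:
  assumes "((k, z), (k', z')) \<in> bm_rel m n" shows "((k, mirror k z), (k', mirror k' z')) \<in> bm_rel m n"
proof -
  have "((\<lambda>(k, z). (k, mirror k z)) x, (\<lambda>(k, z). (k, mirror k z)) y) \<in> (bm_ident m n)\<^sup>*"
    if "(x, y) \<in> (bm_ident m n)\<^sup>*" for x y
    using that
  proof (induction rule: rtrancl_induct)
    case (step y y')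
    obtain k z k' z' where y: "y = (k, z)" "y' = (k', z')" by force
    with step obtain i where i: "(k, i) \<in> bm_edges m n" "z \<in> bm_edge m n k i" "k' = nb k i"
        "z' = z + trn k i"
      by (auto simp: ident_iff)
    have "((k, mirror k z), (k', mirror k' z')) \<in> bm_ident m n"
      unfolding ident_iff using i refl_edge_facts[OF i(1)] mirror_edge
      by (intro exI[of _ "refl_edge i"]) (auto simp: mem_edges)
    then show ?case using step y by simp
  qed simp
  from this[of "(k, z)" "(k', z')"] show ?thesis using assms mirror_polygon
      by (auto simp: bm_rel_def bm_carrier_def)
qed

lemma flip_cl: "bm_flip m n (cl k z) = cl k (mirror k z)"
proof -
  have "(k', z') \<in> bm_flip m n (cl k z)" if "(k', z') \<in> cl k (mirror k z)" for k' z'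
    using mirror_rel[of k "mirror k z" k' z'] that by (force simp: flip_eq)
  then show ?thesis using mirror_rel by (fastforce simp: flip_eq)
qed

lemma flip_surface:
  assumes "p \<in> bm_surface m n" shows "bm_flip m n p \<in> bm_surface m n"
proof -
  obtain k z where kz: "k < m" "z \<in> bm_polygon m n k" "p = cl k z"
    using surface_obtain[OF assms] by blast
  then show ?thesis unfolding kz(3) flip_cl using mirror_polygon by (intro cl_surface)
qed

lemma flip_regular:
  assumes "p \<in> regular" shows "bm_flip m n p \<in> regular"
proof -
  obtain k z where kz: "k < m" "z \<in> bm_polygon m n k" "z \<notin> bm_verts m n k" "p = cl k z"
    using regular_obtain[OF assms] by blast
  then have "mirror k z \<notin> bm_verts m n k" using mirror_verts[of "mirror k z" k] by auto
  then show ?thesis unfolding kz(4) flip_cl using kz mirror_polygon by (intro regularI)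
qed

lemma flip_move: "bm_move m n p w q \<Longrightarrow> bm_move m n (bm_flip m n p) (- cnj w) (bm_flip m n q)"
proof -
  assume a: "bm_move m n p w q"
  then obtain k z where "(k, z) \<in> p" "(k, z + w) \<in> q" by (auto simp: bm_move_def)
  then have "(k, mirror k z) \<in> bm_flip m n p" "(k, mirror k z + - cnj w) \<in> bm_flip m n q"
    by (force simp: flip_eq mirror_def)+
  then show ?thesis using a flip_surface by (auto simp: bm_move_def)
qed

section \<open>Trapezoids and cylinders\<close>

text \<open>In the coordinates of \<open>cp\<close>, the axis of symmetry of the polygon is the line \<open>x = 0\<close>.\<close>

definition hc :: "nat \<Rightarrow> real" where "hc k = len k 0 / 2"

definition cp :: "nat \<Rightarrow> real \<Rightarrow> real \<Rightarrow> complex" where "cp k x y = Complex (x + hc k) y"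

definition X :: "nat \<Rightarrow> nat \<Rightarrow> real" where "X k j = Re (vert k j) - hc k"

definition Y :: "nat \<Rightarrow> nat \<Rightarrow> real" where "Y k j = Im (vert k j)"

lemma cp_add: "cp k x y + w = cp k (x + Re w) (y + Im w)"
  by (simp add: cp_def complex_eq_iff)

lemma cp_eq_iff [simp]: "cp k x y = cp k x' y' \<longleftrightarrow> x = x' \<and> y = y'"
  by (simp add: cp_def)

lemma Im_cp [simp]: "Im (cp k x y) = y" and Re_cp: "Re (cp k x y) = x + hc k"
  by (simp_all add: cp_def)

lemma cp_collapse: "cp k (Re z - hc k) (Im z) = z"
  by (simp add: cp_def complex_eq_iff)

lemma cp_convex: "(1 - u) *\<^sub>R cp k x y + u *\<^sub>R cp k x' y'
    = cp k ((1 - u) * x + u * x') ((1 - u) * y + u * y')"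
  by (simp add: cp_def complex_eq_iff algebra_simps)

lemma vert_cp: "vert k j = cp k (X k j) (Y k j)"
  by (simp add: cp_def X_def Y_def complex_eq_iff)

lemma mirror_cp [simp]: "mirror k (cp k x y) = cp k (- x) y"
  by (simp add: mirror_def cp_def hc_def complex_eq_iff)

lemma X_Suc: "X k (Suc j) = X k j + len k j * cos (real j * al)"
  and Y_Suc: "Y k (Suc j) = Y k j + len k j * sin (real j * al)"
  by (simp_all add: X_def Y_def vert_Suc)

lemma Y_0 [simp]: "Y k 0 = 0" and Y_1 [simp]: "Y k (Suc 0) = 0"
  by (simp_all add: Y_def vert_Suc)

lemma X_formula: "X k j * (2 * sin al) = len k (Suc j) * sin (real j * al) + len k j * sin (real j * al
    - al)"
  using sin_al_pos by (simp add: X_def vert_diff vert_formula_def hc_def field_simps)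

lemma X_nonneg:
  assumes "k < m" "0 < j" "j \<le> n" shows "0 \<le> X k j"
proof -
  have "real j * al - al = real (j - 1) * al" using assms by (simp add: algebra_simps of_nat_diff)
  moreover have "0 \<le> sin (real j * al)" "0 \<le> sin (real (j - 1) * al)"
    using assms sin_mult_al_nonneg[of j] sin_mult_al_nonneg[of "j - 1"] by auto
  ultimately have "0 \<le> X k j * (2 * sin al)"
    unfolding X_formula using len_nonneg[OF assms(1)] by (intro add_nonneg_nonneg mult_nonneg_nonneg) auto
  then show ?thesis using sin_al_pos by (simp add: zero_le_mult_iff)
qed

lemma Y_le_Suc: "k < m \<Longrightarrow> j \<le> n \<Longrightarrow> Y k j \<le> Y k (Suc j)"
  unfolding Y_Suc using len_nonneg sin_mult_al_nonneg by simp

lemma Y_mono: "k < m \<Longrightarrow> i \<le> j \<Longrightarrow> j \<le> Suc n \<Longrightarrow> Y k i \<le> Y k j"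
proof (induction j)
  case (Suc j)
  then show ?case using Y_le_Suc[of k j] by (cases "i = Suc j") (auto intro: order_trans)
qed simp

lemma vert_mirror_cp: "j \<le> 2 * n + 1 \<Longrightarrow> vert k (2 * n + 1 - j) = cp k (- X k j) (Y k j)"
  using mirror_vert[of j k] by (simp add: vert_cp)

text \<open>The vertices \<open>1\<close> to \<open>n\<close> form the right side of the polygon,
  with heights that never decrease, and the left side is its mirror image. From here on only the
  right side is indexed.\<close>

lemma verts_iff: "z \<in> bm_verts m n k \<longleftrightarrow> (\<exists>j. 0 < j \<and> j \<le> n \<and> (z = cp k (X k j) (Y k j) \<or> z
    = cp k (- X k j) (Y k j)))"
proof
  assume "z \<in> bm_verts m n k"
  then obtain l where l: "l < 2 * n" "z = vert k l" by (auto simp: bm_verts_def)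
  consider "0 < l" "l \<le> n" | "n < l" | "l = 0" by linarith
  then show "\<exists>j. 0 < j \<and> j \<le> n \<and> (z = cp k (X k j) (Y k j) \<or> z = cp k (- X k j) (Y k j))"
  proof cases
    case 1
    then show ?thesis using l vert_cp by blast
  next
    case 2
    then show ?thesis using l vert_mirror_cp[of "2 * n + 1 - l" k] by (intro exI[of _ "2 * n + 1 - l"]) auto
  next
    case 3
    then show ?thesis using l vert_mirror_cp[of 1 k] n_ge by (intro exI[of _ 1]) auto
  qed
next
  assume "\<exists>j. 0 < j \<and> j \<le> n \<and> (z = cp k (X k j) (Y k j) \<or> z = cp k (- X k j) (Y k j))"
  then show "z \<in> bm_verts m n k" using vert_in_verts vert_cp vert_mirror_cp
    by (metis add_increasing2 le_add1 mult_2 order_trans zero_le)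
qed

text \<open>Right gluing edges; they also stand for the trapezoids to their left.\<close>

definition redge :: "nat \<Rightarrow> nat \<Rightarrow> bool" where
  "redge k i \<longleftrightarrow> (k, i) \<in> bm_edges m n \<and> 0 < i \<and> i < n"

lemma redge_iff: "redge k i \<longleftrightarrow> k < m \<and> 0 < i \<and> i < n \<and> 0 < len k i"
  by (auto simp: redge_def mem_edges)

definition ct :: "nat \<Rightarrow> real" where "ct i = cos (real i * al) / sin (real i * al)"

text \<open>Half the width of trapezoid \<open>i\<close> at height \<open>t\<close> above its bottom.\<close>

definition rr :: "nat \<Rightarrow> nat \<Rightarrow> real \<Rightarrow> real" where "rr k i t = X k i + ct i * t"

definition hgt :: "nat \<Rightarrow> nat \<Rightarrow> real" where "hgt k i = len k i * sin (real i * al)"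

lemma hgt_pos: "redge k i \<Longrightarrow> 0 < hgt k i"
  using sin_mult_al_pos[of i] by (simp add: redge_iff hgt_def)

lemma Y_hgt: "Y k (Suc i) = Y k i + hgt k i"
  by (simp add: Y_Suc hgt_def)

lemma rr_0 [simp]: "rr k i 0 = X k i"
  by (simp add: rr_def)

lemma rr_hgt: "0 < i \<Longrightarrow> i < n \<Longrightarrow> rr k i (hgt k i) = X k (Suc i)"
  using sin_mult_al_pos[of i] by (simp add: rr_def hgt_def ct_def X_Suc)

lemma dd_right:
  assumes "0 < i" "i < n" shows "dd k i (cp k x (Y k i + t)) = sin (real i * al) * (rr k i t - x)"
  using sin_mult_al_pos[OF assms] by (simp add: dd_eq vert_cp Re_cp rr_def ct_def algebra_simps)

lemma dd_left:
  assumes "0 < i" "i < n" shows "dd k (2 * n - i) (cp k x (Y k i + t)) = sin (real i * al) * (rr k i t + x)"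
  using dd_mirror'[of "2 * n - i" k "cp k (- x) (Y k i + t)"] dd_right[OF assms, of k "- x" t] assms by simp

lemma dd_bottom: "dd k 0 (cp k x y) = y"
  by (simp add: dd_eq)

lemma dd_top: "dd k n (cp k x y) = Y k n - y"
  by (simp add: dd_eq n_al vert_cp)

lemma polygon_height: "k < m \<Longrightarrow> cp k x y \<in> bm_polygon m n k \<Longrightarrow> 0 \<le> y \<and> y \<le> Y k n"
  using polygon_dd_nonneg[of k "cp k x y" 0] polygon_dd_nonneg[of k "cp k x y" n]
      by (simp add: dd_bottom dd_top)

lemma polygon_width:
  assumes "k < m" "0 < i" "i < n" "cp k x (Y k i + t) \<in> bm_polygon m n k" shows "\<bar>x\<bar> \<le> rr k i t"
  using polygon_dd_nonneg[OF assms(1,4), of i] polygon_dd_nonneg[OF assms(1,4), of "2 * n - i"]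
    sin_mult_al_pos[OF assms(2,3)]
  by (auto simp: dd_left[OF assms(2,3)] dd_right[OF assms(2,3)] zero_le_mult_iff)

text \<open>Vertex \<open>j\<close> is the lower end of the right edge \<open>j\<close>, except for
  \<open>j = n\<close>, where it is used as the upper end of edge \<open>n - 1\<close>.\<close>

lemma polygon_width_vertex:
  assumes "k < m" "0 < j" "j \<le> n" "cp k x (Y k j) \<in> bm_polygon m n k" shows "\<bar>x\<bar> \<le> X k j"
proof (cases "j < n")
  case True
  then show ?thesis using polygon_width[of k j x 0] assms by simp
next
  case False
  then obtain i where i: "j = Suc i" "0 < i" "i < n" using assms n_ge
      by (metis Suc_lessI Suc_pred le_neq_implies_less lessI less_eq_Suc_le not_less numeral_3_eq_3
      zero_less_Suc)
  then show ?thesis using polygon_width[of k i x "hgt k i"] assms by (simp add: Y_hgt rr_hgt)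
qed

context
  fixes k i assumes ki: "redge k i"
begin

lemma redge_facts: "k < m" "0 < i" "i < n" "(k, i) \<in> bm_edges m n" "0 < sin (real i * al)"
  using ki sin_mult_al_pos by (auto simp: redge_iff mem_edges)

lemma right_edge:
  assumes "0 \<le> t" "t \<le> hgt k i" shows "cp k (rr k i t) (Y k i + t) \<in> bm_edge m n k i"
proof -
  define u where "u = t / hgt k i"
  have u: "0 \<le> u" "u \<le> 1" "t = u * hgt k i" using assms hgt_pos[OF ki] by (auto simp: u_def)
  have "ct i * hgt k i = len k i * cos (real i * al)" using redge_facts by (simp add: ct_def hgt_def)
  then have "cp k (rr k i t) (Y k i + t) = (1 - u) *\<^sub>R vert k i + u *\<^sub>R vert k (Suc i)"
    unfolding vert_cp X_Suc Y_hgt cp_convex rr_def u(3) by (simp add: algebra_simps)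
  then show ?thesis using u unfolding bm_edge_def closed_segment_def by auto
qed

lemma right_edge_iff:
  "z \<in> bm_edge m n k i \<longleftrightarrow> (\<exists>t. 0 \<le> t \<and> t \<le> hgt k i \<and> z = cp k (rr k i t) (Y k i + t))"
proof
  assume "z \<in> bm_edge m n k i"
  then obtain u where u: "0 \<le> u" "u \<le> 1" "z = (1 - u) *\<^sub>R vert k i + u *\<^sub>R vert k (Suc i)"
    unfolding bm_edge_def closed_segment_def by auto
  have "ct i * hgt k i = len k i * cos (real i * al)" using redge_facts by (simp add: ct_def hgt_def)
  then have "z = cp k (rr k i (u * hgt k i)) (Y k i + u * hgt k i)"
    unfolding u(3) vert_cp X_Suc Y_hgt cp_convex rr_def by (simp add: algebra_simps)
  moreover have "0 \<le> u * hgt k i" "u * hgt k i \<le> 1 * hgt k i"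
    using u hgt_pos[OF ki] by (auto intro!: mult_right_mono)
  ultimately show "\<exists>t. 0 \<le> t \<and> t \<le> hgt k i \<and> z = cp k (rr k i t) (Y k i + t)" by auto
qed (use right_edge in blast)

lemma no_vertex_between:
  assumes "0 < t" "t < hgt k i" shows "cp k x (Y k i + t) \<notin> bm_verts m n k"
proof
  assume "cp k x (Y k i + t) \<in> bm_verts m n k"
  then obtain j where j: "0 < j" "j \<le> n" "Y k i + t = Y k j" by (auto simp: verts_iff)
  have "Y k j \<le> Y k i \<or> Y k (Suc i) \<le> Y k j"
    using Y_mono[of k j i] Y_mono[of k "Suc i" j] j redge_facts by linarith
  then show False using j assms by (simp add: Y_hgt)
qed

lemma right_edge_other_pos:
  assumes "0 < t" "t < hgt k i" "j < 2 * n" "j \<noteq> i"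
  shows "0 < dd k j (cp k (rr k i t) (Y k i + t))"
  using redge_facts assms no_vertex_between right_edge by (intro edge_other_dd_pos[of k _ i]) auto

lemma rr_pos:
  assumes "0 < t" "t < hgt k i" shows "0 < rr k i t"
proof -
  have "0 < dd k (2 * n - i) (cp k (rr k i t) (Y k i + t))"
    using redge_facts by (intro right_edge_other_pos assms) auto
  then show ?thesis using redge_facts by (simp add: dd_left zero_less_mult_iff)
qed

lemma left_edge:
  assumes "0 \<le> t" "t \<le> hgt k i" shows "cp k (- rr k i t) (Y k i + t) \<in> bm_edge m n k (2 * n - i)"
proof -
  have "refl_edge i = 2 * n - i" using redge_facts by (simp add: refl_edge_def)
  then show ?thesis using mirror_edge[OF _ _ right_edge[OF assms]] redge_facts by simp
qed

lemma trap_polygon: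
  assumes "0 \<le> t" "t \<le> hgt k i" "\<bar>x\<bar> \<le> rr k i t" shows "cp k x (Y k i + t) \<in> bm_polygon m n k"
proof (cases "rr k i t = 0")
  case True
  then show ?thesis using assms right_edge[OF assms(1,2)] edge_subset_polygon by auto
next
  case False
  define r where "r = rr k i t"
  have r: "0 < r" using False assms by (simp add: r_def)
  have P: "cp k r (Y k i + t) \<in> bm_polygon m n k" "cp k (- r) (Y k i + t) \<in> bm_polygon m n k"
    using right_edge[OF assms(1,2)] left_edge[OF assms(1,2)] edge_subset_polygon unfolding r_def by blast+
  have c: "convex (bm_polygon m n k)" by (simp add: bm_polygon_def)
  have "((r + x) / (2 * r)) *\<^sub>R cp k r (Y k i + t) + ((r - x) / (2 * r)) *\<^sub>R cp k (- r) (Y k i + t) \<in>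
      bm_polygon m n k"
    using assms r by (intro convexD[OF c P]) (auto simp: r_def field_simps)
  also have "((r + x) / (2 * r)) *\<^sub>R cp k r (Y k i + t) + ((r - x) / (2 * r)) *\<^sub>R cp k (- r) (Y k i +
      t) = cp k x (Y k i + t)"
    using r by (simp add: complex_eq_iff Re_cp field_simps)
  finally show ?thesis .
qed

text \<open>The point is a proper convex combination of two points at its height, one on the right
  edge and one on the left. All conditions except that of edge \<open>i\<close> are strict at the
  first and weakly satisfied at the second; the condition of edge \<open>i\<close> is the bound on
  \<open>x\<close>.\<close>

lemma trap_inter:
  assumes "0 < t" "t < hgt k i" "\<bar>x\<bar> < rr k i t" shows "cp k x (Y k i + t) \<in> inter k"
  unfolding inter_def
proof (intro CollectI allI impI)
  fix j assume j: "j < 2 * n"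
  define r where "r = rr k i t"
  have r: "0 < r" using assms rr_pos by (simp add: r_def)
  show "0 < dd k j (cp k x (Y k i + t))"
  proof (cases "j = i")
    case True
    then show ?thesis using assms redge_facts by (simp add: dd_right)
  next
    case False
    have d1: "0 < dd k j (cp k r (Y k i + t))" unfolding r_def by (intro right_edge_other_pos assms j False)
    have d2: "0 \<le> dd k j (cp k (- r) (Y k i + t))"
      using trap_polygon[of t "- r"] assms redge_facts by (intro polygon_dd_nonneg) (auto simp: r_def)
    have "((r + x) / (2 * r)) *\<^sub>R cp k r (Y k i + t) + ((r - x) / (2 * r)) *\<^sub>R cp k (- r) (Y k i + t)
        = cp k x (Y k i + t)"
      using r by (simp add: complex_eq_iff Re_cp field_simps)
    moreover have "(r + x) / (2 * r) + (r - x) / (2 * r) = 1" using r by (simp add: field_simps)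
    ultimately have "dd k j (cp k x (Y k i + t))
        = (r + x) / (2 * r) * dd k j (cp k r (Y k i + t)) + (r - x) / (2 * r) * dd k j (cp k (- r) (Y k
        i + t))"
      by (metis dd_convex)
    moreover have "0 < (r + x) / (2 * r)" "0 < (r - x) / (2 * r)" using assms r by (auto simp: r_def)
    ultimately show ?thesis using d1 d2 by (metis add_pos_nonneg less_imp_le mult_nonneg_nonneg
        mult_pos_pos)
  qed
qed

end

lemma ct_opp: "0 < i \<Longrightarrow> i < n \<Longrightarrow> ct (n - i) = - ct i"
proof -
  assume "0 < i" "i < n"
  then have "real (n - i) * al = pi - real i * al" by (simp add: of_nat_diff algebra_simps n_al)
  then show ?thesis by (simp add: ct_def)
qed

text \<open>The partner of right edge \<open>i\<close> is the left edge \<open>i + n\<close>, whose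
  mirror image is the right edge \<open>n - i\<close>. So \<open>(k, i)\<close> and
  \<open>(nb k i, n - i)\<close> name the two trapezoids of one cylinder, and the correspondence is
  an involution.\<close>

lemma redge_nb:
  assumes "redge k i"
  shows "redge (nb k i) (n - i)" "nb (nb k i) (n - i) = k" "hgt (nb k i) (n - i) = hgt k i" "nb k i \<noteq> k"
proof -
  have i: "0 < i" "i < n" "k < m" "(k, i) \<in> bm_edges m n" using assms by (auto simp: redge_facts)
  have o: "opp i = i + n" using i by (simp add: opp_cases)
  have r: "refl_edge (opp i) = n - i" using i o by (simp add: refl_edge_def)
  have E: "(nb k i, opp i) \<in> bm_edges m n" using nb_edge i by auto
  show R: "redge (nb k i) (n - i)" using refl_edge_facts(1)[OF E] r i by (simp add: redge_def)
  show "nb (nb k i) (n - i) = k" using refl_edge_facts(2)[OF E] r nb_edge(3)[OF i(4)] by simp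
  show "nb k i \<noteq> k" using nb_edge i by auto
  have "real (n - i) * al = pi - real i * al" using i by (simp add: of_nat_diff algebra_simps n_al)
  moreover have "len (nb k i) (n - i) = len (nb k i) (opp i)"
    using even_refl_edge[OF opp_less[of i]] r by (intro len_parity) simp
  ultimately show "hgt (nb k i) (n - i) = hgt k i" using nb_edge(4)[OF i(4)] by (simp add: hgt_def)
qed

text \<open>The circumference, measured along the bottom; by \<open>rr_nb\<close> the widths of the
  two trapezoids have the same sum at every height.\<close>

definition wd :: "nat \<Rightarrow> nat \<Rightarrow> real" where "wd k i = 2 * X k i + 2 * X (nb k i) (n - i)"

lemma wd_nb: "redge k i \<Longrightarrow> wd (nb k i) (n - i) = wd k i"
  using redge_nb[of k i] by (auto simp: wd_def redge_def)

lemma rr_nb: "redge k i \<Longrightarrow> rr (nb k i) (n - i) t = wd k i / 2 - rr k i t"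
  by (simp add: redge_iff rr_def wd_def ct_opp field_simps)

text \<open>In the closed form the contributions of the adjacent lengths combine by
  \<open>sl_sum\<close>, those of the glued length by
  \<open>sin (x - al) + sin (x + al) = 2 * sin x * cos al\<close>. Both results contain the factor
  \<open>len k i * sin (i * al)\<close>, which is the height, so the quotient is the same for all
  cylinders.\<close>

lemma wd_hgt:
  assumes "redge k i"
  shows "wd k i = (2 * cot (pi / real n) + 2 * (cos (pi / real m) / sin (pi / real n))) * hgt k i"
proof -
  have i: "0 < i" "i < n" "k < m" "0 < len k i" "(k, i) \<in> bm_edges m n" using assms
      by (auto simp: redge_iff mem_edges)
  define k' where "k' = nb k i"
  have x: "real (n - i) * al = pi - real i * al" using i by (simp add: of_nat_diff algebra_simps n_al)
  have l: "len k' (n - i) = len k i"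
    using nb_edge(4)[OF i(5)] i len_parity[of "n - i" "opp i" k'] by (auto simp: k'_def even_opp)
  have u: "up k' (n - i) \<longleftrightarrow> \<not> up k i"
  proof -
    have "up k' (n - i) \<longleftrightarrow> up k' (opp i)" using i by (auto simp: up_def even_opp)
    then show ?thesis using nb_edge(2)[OF i(5)] by (simp add: k'_def)
  qed
  have s: "len k (Suc i) + len k' (Suc (n - i)) = 2 * len k i * cos (pi / real m)"
  proof (cases "up k i")
    case True
    then show ?thesis using u sl_sum[of k] by (simp add: len_def up_Suc k'_def nb_def)
  next
    case False
    have "k \<noteq> 0" using i False by (cases "k = 0") (auto simp: len_def)
    then obtain k0 where "k = Suc k0" by (cases k) auto
    then show ?thesis using u False sl_sum[of k0] by (simp add: len_def up_Suc k'_def nb_def)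
  qed
  have "wd k i * sin al = X k i * (2 * sin al) + X k' (n - i) * (2 * sin al)"
    by (simp add: wd_def k'_def algebra_simps)
  also have "\<dots> = (len k (Suc i) + len k' (Suc (n - i))) * sin (real i * al) + len k i * (sin (real i *
      al - al) + sin (real i * al + al))"
  proof -
    have "pi - real i * al - al = pi - (real i * al + al)" by simp
    then have "sin (pi - real i * al - al) = sin (real i * al + al)" by (metis sin_pi_minus)
    then show ?thesis unfolding X_formula x l by (simp add: algebra_simps)
  qed
  also have "\<dots> = (2 * cos al + 2 * cos (pi / real m)) * hgt k i"
    unfolding s hgt_def by (simp add: sin_add sin_diff algebra_simps)
  finally have "wd k i = (2 * cos al + 2 * cos (pi / real m)) * hgt k i / sin al"
    using sin_al_pos by (simp add: field_simps)
  then show ?thesis by (simp add: cot_def al_def[symmetric] add_divide_distrib distrib_right)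
qed

text \<open>The symmetry axes of the two trapezoids are half a circumference apart; in coordinates
  centred at these axes, the gluing is therefore a shift by \<open>wd k i / 2\<close>.\<close>

lemma trn_right:
  assumes "redge k i" shows "cp k x (Y k i + t) + trn k i
      = cp (nb k i) (x - wd k i / 2) (Y (nb k i) (n - i) + t)"
proof -
  have i: "0 < i" "i < n" using assms by (auto simp: redge_iff)
  have "trn k i = vert (nb k i) (2 * n + 1 - (n - i)) - vert k i" using i
      by (simp add: trn_def opp_cases add.commute)
  also have "\<dots> = cp (nb k i) (- X (nb k i) (n - i)) (Y (nb k i) (n - i)) - cp k (X k i) (Y k i)"
    using vert_mirror_cp[of "n - i" "nb k i"] i by (simp add: vert_cp[of k])
  finally show ?thesis by (auto simp: complex_eq_iff Re_cp wd_def field_simps)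
qed

lemma trn_left:
  assumes "redge k i" shows "cp k x (Y k i + t) + trn k (2 * n - i)
      = cp (nb k i) (x + wd k i / 2) (Y (nb k i) (n - i) + t)"
proof -
  have i: "0 < i" "i < n" "(k, i) \<in> bm_edges m n" using assms by (auto simp: redge_def)
  have r: "refl_edge i = 2 * n - i" using i by (simp add: refl_edge_def)
  have "mirror (nb k i) (cp k (- x) (Y k i + t) + trn k i)
      = mirror k (cp k (- x) (Y k i + t)) + trn k (2 * n - i)"
    using refl_edge_facts(3)[OF i(3)] r by metis
  from this[symmetric] show ?thesis unfolding trn_right[OF assms] mirror_cp by (simp add: add.commute)
qed

section \<open>Trapezoid coordinates and the covering of a cylinder\<close>

definition pt :: "nat \<Rightarrow> nat \<Rightarrow> real \<Rightarrow> real \<Rightarrow> bm_point" where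
  "pt k i x t = cl k (cp k x (Y k i + t))"

context
  fixes k i t assumes ki: "redge k i" and t: "0 < t" "t < hgt k i"
begin

lemma pt_regular: "\<bar>x\<bar> \<le> rr k i t \<Longrightarrow> pt k i x t \<in> regular"
  unfolding pt_def using ki t trap_polygon[OF ki] no_vertex_between[OF ki] redge_facts[OF ki]
      by (intro regularI) auto

lemma pt_inner: "\<bar>x\<bar> < rr k i t \<Longrightarrow> pt k i x t = {(k, cp k x (Y k i + t))}"
  unfolding pt_def using ki t trap_inter[OF ki] redge_facts[OF ki] by (intro cl_inter) auto

lemma pt_right:
  "pt k i (rr k i t) t = {(k, cp k (rr k i t) (Y k i + t)),
     (nb k i, cp (nb k i) (- rr (nb k i) (n - i) t) (Y (nb k i) (n - i) + t))}"
  unfolding pt_def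
  using cl_edge[of k i "cp k (rr k i t) (Y k i + t)"] right_edge[OF ki] no_vertex_between[OF ki t]
    redge_facts[OF ki] t trn_right[OF ki] rr_nb[OF ki] by simp

lemma pt_left:
  "pt k i (- rr k i t) t = {(k, cp k (- rr k i t) (Y k i + t)),
     (nb k i, cp (nb k i) (rr (nb k i) (n - i) t) (Y (nb k i) (n - i) + t))}"
proof -
  have r: "refl_edge i = 2 * n - i" using redge_facts[OF ki] by (simp add: refl_edge_def)
  then have "(k, 2 * n - i) \<in> bm_edges m n" "nb k (2 * n - i) = nb k i"
    using refl_edge_facts redge_facts[OF ki] by metis+
  then show ?thesis unfolding pt_def
    using cl_edge[of k "2 * n - i" "cp k (- rr k i t) (Y k i + t)"] left_edge[OF ki]
        no_vertex_between[OF ki t]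
      t trn_left[OF ki] rr_nb[OF ki] by simp
qed

lemma pt_mem: "\<bar>x\<bar> \<le> rr k i t \<Longrightarrow> (k, cp k x (Y k i + t)) \<in> pt k i x t"
  unfolding pt_def using ki t trap_polygon[OF ki] redge_facts[OF ki] by (intro cl_self) auto

end

lemma pt_glue:
  assumes "redge k i" "0 < t" "t < hgt k i"
  shows "pt k i (rr k i t) t = pt (nb k i) (n - i) (- rr (nb k i) (n - i) t) t"
    "pt k i (- rr k i t) t = pt (nb k i) (n - i) (rr (nb k i) (n - i) t) t"
proof -
  note R = redge_nb[OF assms(1)]
  have t': "t < hgt (nb k i) (n - i)" using R assms by simp
  have i: "n - (n - i) = i" using assms by (simp add: redge_iff)
  show "pt k i (rr k i t) t = pt (nb k i) (n - i) (- rr (nb k i) (n - i) t) t"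
    unfolding pt_right[OF assms] pt_left[OF R(1) assms(2) t'] R(2) i by auto
  show "pt k i (- rr k i t) t = pt (nb k i) (n - i) (rr (nb k i) (n - i) t) t"
    unfolding pt_left[OF assms] pt_right[OF R(1) assms(2) t'] R(2) i by auto
qed

text \<open>The covering of a cylinder by a strip, with the imaginary axis on the symmetry axis of
  trapezoid \<open>i\<close> of polygon \<open>k\<close>.\<close>

definition phi :: "nat \<Rightarrow> nat \<Rightarrow> complex \<Rightarrow> bm_point" where
  "phi k i z = (let t = Im z; x = Re z - of_int \<lfloor>(Re z + rr k i t) / wd k i\<rfloor> * wd k i in
     if x \<le> rr k i t then pt k i x t else pt (nb k i) (n - i) (x - wd k i / 2) t)"

context
  fixes k i t assumes ki: "redge k i" and t: "0 < t" "t < hgt k i"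
begin

lemma rr_bounds: "0 < rr k i t" "2 * rr k i t < wd k i" "0 < wd k i"
  using rr_pos[OF ki t] rr_pos[OF redge_nb(1)[OF ki] t(1)] t redge_nb(3)[OF ki] rr_nb[OF ki] by auto

lemma phi_floor:
  assumes "- rr k i t \<le> x - of_int j * wd k i" "x - of_int j * wd k i < wd k i - rr k i t"
  shows "\<lfloor>(x + rr k i t) / wd k i\<rfloor> = j"
proof (rule floor_unique)
  show "of_int j \<le> (x + rr k i t) / wd k i" using assms rr_bounds by (simp add: field_simps)
  have "x + rr k i t < (of_int j + 1) * wd k i" using assms by (simp add: algebra_simps)
  then show "(x + rr k i t) / wd k i < of_int j + 1" using rr_bounds by (simp add: field_simps)
qed

lemma phi_first:
  assumes "\<bar>x - of_int j * wd k i\<bar> \<le> rr k i t"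
  shows "phi k i (Complex x t) = pt k i (x - of_int j * wd k i) t"
proof -
  have "\<lfloor>(x + rr k i t) / wd k i\<rfloor> = j" using assms rr_bounds by (intro phi_floor) auto
  then show ?thesis using assms by (simp add: phi_def Let_def abs_le_iff)
qed

text \<open>Holds on the closed second trapezoid, although \<open>phi\<close> assigns both seams to
  the first one: the left seam in the same period, the right seam in the next.
  \<open>pt_glue\<close> reconciles the two descriptions.\<close>

lemma phi_second:
  assumes "\<bar>x - of_int j * wd k i - wd k i / 2\<bar> \<le> rr (nb k i) (n - i) t"
  shows "phi k i (Complex x t) = pt (nb k i) (n - i) (x - of_int j * wd k i - wd k i / 2) t"
proof -
  define y where "y = x - of_int j * wd k i"
  have b: "rr k i t \<le> y" "y \<le> wd k i - rr k i t" using assms by (auto simp: y_def rr_nb[OF ki] abs_le_iff)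
  show ?thesis
  proof (cases "y = wd k i - rr k i t")
    case True
    then have "x - of_int (j + 1) * wd k i = - rr k i t" by (simp add: y_def algebra_simps)
    then have "phi k i (Complex x t) = pt k i (- rr k i t) t"
        using phi_first[of x "j + 1"] rr_bounds by simp
    moreover have "x - of_int j * wd k i - wd k i / 2 = rr (nb k i) (n - i) t"
      using True rr_nb[OF ki] by (simp add: y_def)
    ultimately show ?thesis using pt_glue(2)[OF ki t] by simp
  next
    case False
    then have f: "\<lfloor>(x + rr k i t) / wd k i\<rfloor> = j" using b rr_bounds unfolding y_def by (intro phi_floor) auto
    show ?thesis
    proof (cases "y = rr k i t")
      case True
      then have "phi k i (Complex x t) = pt k i (rr k i t) t" using phi_first[of x j] rr_bounds
          by (simp add: y_def)
      moreover have "x - of_int j * wd k i - wd k i / 2 = - rr (nb k i) (n - i) t"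
        using True rr_nb[OF ki] by (simp add: y_def)
      ultimately show ?thesis using pt_glue(1)[OF ki t] by simp
    next
      case False
      then show ?thesis using b f by (simp add: phi_def Let_def y_def)
    qed
  qed
qed

lemma phi_cases:
  obtains j :: int where "- rr k i t \<le> x - of_int j * wd k i" "x - of_int j * wd k i \<le> rr k i t"
      "phi k i (Complex x t) = pt k i (x - of_int j * wd k i) t"
  | j :: int where "rr k i t < x - of_int j * wd k i" "x - of_int j * wd k i < wd k i - rr k i t"
      "phi k i (Complex x t) = pt (nb k i) (n - i) (x - of_int j * wd k i - wd k i / 2) t"
proof -
  define j where "j = \<lfloor>(x + rr k i t) / wd k i\<rfloor>"
  have "of_int j \<le> (x + rr k i t) / wd k i" "(x + rr k i t) / wd k i < of_int j + 1" by (auto simp: j_def)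
  then have b: "- rr k i t \<le> x - of_int j * wd k i" "x - of_int j * wd k i < wd k i - rr k i t"
    using rr_bounds by (auto simp: field_simps)
  show ?thesis
  proof (cases "x - of_int j * wd k i \<le> rr k i t")
    case True
    then show ?thesis using that(1)[of j] b phi_first[of x j] by simp
  next
    case False
    then show ?thesis using that(2)[of j] b phi_second[of x j] rr_nb[OF ki] by (simp add: abs_le_iff)
  qed
qed

lemma phi_regular: "phi k i (Complex x t) \<in> regular"
proof (cases rule: phi_cases[of x])
  case (1 j)
  then show ?thesis using pt_regular[OF ki t] by (simp add: abs_le_iff)
next
  case (2 j)
  then show ?thesis using pt_regular[OF redge_nb(1)[OF ki] t(1)] t redge_nb(3)[OF ki] rr_nb[OF ki]
      by (simp add: abs_le_iff)
qed

end

lemma phi_period: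
  assumes "redge k i" "0 < t" "t < hgt k i"
  shows "phi k i (Complex (x + of_int j * wd k i) t) = phi k i (Complex x t)"
proof (cases rule: phi_cases[OF assms, of x])
  case (1 l)
  then show ?thesis using phi_first[OF assms, of "x + of_int j * wd k i" "l + j"]
      by (simp add: abs_le_iff algebra_simps)
next
  case (2 l)
  have e: "x + of_int j * wd k i - of_int (l + j) * wd k i = x - of_int l * wd k i"
      by (simp add: algebra_simps)
  have "\<bar>x - of_int l * wd k i - wd k i / 2\<bar> \<le> rr (nb k i) (n - i) t"
    using 2 rr_nb[OF assms(1), of t] unfolding abs_le_iff by linarith
  then show ?thesis using phi_second[OF assms, of "x + of_int j * wd k i" "l + j"] 2 unfolding e by simp
qed

text \<open>Permits the change of base to the other trapezoid of the cylinder, which is needed when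
  the bottom of the given one shrinks to a point.\<close>

lemma phi_shift:
  assumes "redge k i" "0 < t" "t < hgt k i"
  shows "phi (nb k i) (n - i) (Complex (x - wd k i / 2) t) = phi k i (Complex x t)"
proof -
  note R = redge_nb[OF assms(1)]
  have t': "t < hgt (nb k i) (n - i)" using R assms by simp
  have i: "n - (n - i) = i" using assms by (simp add: redge_iff)
  have W: "wd (nb k i) (n - i) = wd k i" using wd_nb assms by simp
  show ?thesis
  proof (cases rule: phi_cases[OF assms, of x])
    case (1 j)
    then have "phi (nb k i) (n - i) (Complex (x - wd k i / 2) t)
        = pt (nb (nb k i) (n - i)) (n - (n - i)) (x - wd k i / 2 - of_int (j - 1) * wd (nb k i) (n - i)
        - wd (nb k i) (n - i) / 2) t"
      unfolding W R(2) i using phi_second[OF R(1) assms(2) t', of "x - wd k i / 2"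
          "j - 1", unfolded W R(2) i]
      by (simp add: algebra_simps abs_le_iff)
    then show ?thesis unfolding 1 W R(2) i by (simp add: algebra_simps)
  next
    case (2 j)
    have e: "x - wd k i / 2 - of_int j * wd k i = x - of_int j * wd k i - wd k i / 2" by simp
    have "\<bar>x - of_int j * wd k i - wd k i / 2\<bar> \<le> rr (nb k i) (n - i) t"
      using 2 rr_nb[OF assms(1), of t] unfolding abs_le_iff by linarith
    then show ?thesis using phi_first[OF R(1) assms(2) t', of "x - wd k i / 2" j] 2 unfolding W e by simp
  qed
qed

lemma phi_inj:
  assumes ki: "redge k i" and t: "0 < t" "t < hgt k i" and t': "0 < t'" "t' < hgt k i"
    and eq: "phi k i (Complex x t) = phi k i (Complex x' t')"
  shows "t' = t \<and> (\<exists>j. x' = x + of_int j * wd k i)"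
proof -
  note R = redge_nb[OF ki]
  have h: "hgt (nb k i) (n - i) = hgt k i" by (rule R)
  have no: "pt k i y s \<noteq> pt (nb k i) (n - i) y' s'"
    if "0 < s'" "s' < hgt k i" "\<bar>y\<bar> \<le> rr k i s" "0 < s" "s < hgt k i"
        "\<bar>y'\<bar> < rr (nb k i) (n - i) s'" for y s y' s'
    using pt_inner[OF R(1) that(1), of y'] that h R(4) pt_mem[OF ki that(4,5,3)] by auto
  have same: "t' = t \<and> (\<exists>j. x' = x + of_int j * wd k i)"
    if "redge k1 i1" "hgt k1 i1 = hgt k i" "\<bar>x - of_int j * wd k i - c\<bar> \<le> rr k1 i1 t"
        "\<bar>x' - of_int j' * wd k i - c\<bar> \<le> rr k1 i1 t'"
      "pt k1 i1 (x - of_int j * wd k i - c) t = pt k1 i1 (x' - of_int j' * wd k i - c) t'"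
      "nb k1 i1 \<noteq> k1" for k1 i1 j j' c
  proof -
    have mem: "(k1, cp k1 (x - of_int j * wd k i - c) (Y k1 i1 + t)) \<in> pt k1 i1 (x' - of_int j' * wd k
        i - c) t'"
      using pt_mem[OF that(1) t(1) _ that(3)] that(2,5) t by simp
    have s: "t' < hgt k1 i1" using that t' by simp
    have "\<bar>x' - of_int j' * wd k i - c\<bar> < rr k1 i1 t' \<or> x' - of_int j' * wd k i - c
        = rr k1 i1 t' \<or> x' - of_int j' * wd k i - c = - rr k1 i1 t'"
      using that by linarith
    then have "x - of_int j * wd k i - c = x' - of_int j' * wd k i - c \<and> t = t'"
      using mem pt_inner[OF that(1) t'(1) s] pt_right[OF that(1) t'(1) s] pt_left[OF that(1) t'(1) s]
          that(6) by auto
    then show ?thesis by (auto intro!: exI[of _ "j' - j"] simp: algebra_simps)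
  qed
  show ?thesis
  proof (cases rule: phi_cases[OF ki t, of x])
    case a: (1 j)
    show ?thesis
    proof (cases rule: phi_cases[OF ki t', of x'])
      case (1 j')
      then show ?thesis using same[OF ki, of j 0 j'] a eq R(4) by (simp add: abs_le_iff)
    next
      case (2 j')
      then show ?thesis using no[of t' "x - of_int j * wd k i" t "x' - of_int j' * wd k i - wd k i /
          2"] a eq t t' rr_nb[OF ki]
        by (simp add: abs_less_iff abs_le_iff)
    qed
  next
    case a: (2 j)
    show ?thesis
    proof (cases rule: phi_cases[OF ki t', of x'])
      case (1 j')
      then show ?thesis using no[of t "x' - of_int j' * wd k i" t' "x - of_int j * wd k i - wd k i /
          2"] a eq t t' rr_nb[OF ki]
        by (simp add: abs_less_iff abs_le_iff)
    next
      case (2 j')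
      then show ?thesis using same[OF R(1) h, of j "wd k i / 2" j'] a eq R(2,4) rr_nb[OF ki]
          by (simp add: abs_le_iff)
    qed
  qed
qed

lemma phi_move:
  assumes ki: "redge k i" and t: "0 < Im z" "Im z < hgt k i"
  shows "\<exists>e>0. \<forall>w. norm w < e \<longrightarrow> 0 < Im (z + w) \<and> Im (z + w) < hgt k i
      \<and> bm_move m n (phi k i z) w (phi k i (z + w))"
proof -
  note R = redge_nb[OF ki]
  define W where "W = wd k i"
  define j where "j = \<lfloor>(Re z + rr k i (Im z)) / W\<rfloor>"
  define x where "x = Re z - of_int j * W"
  define r where "r = rr k i (Im z)"
  have W0: "0 < W" "0 < r" "2 * r < W" using rr_bounds[OF ki t] by (auto simp: W_def r_def)
  have "of_int j \<le> (Re z + rr k i (Im z)) / W" "(Re z + rr k i (Im z)) / W < of_int j + 1"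
      by (auto simp: j_def)
  then have xb: "- r \<le> x" "x < W - r" using W0 by (auto simp: field_simps x_def r_def)
  have rw: "rr k i (Im (z + w)) = r + ct i * Im w" for w by (simp add: rr_def r_def algebra_simps)
  have nbhd: "\<exists>e>0. \<forall>w. norm w < e \<longrightarrow> (0 < c \<longrightarrow> 0 < c + a * Re w + b * Im w)" for a b c :: real
    using affine_pos_nbhd[of c a b] by (cases "0 < c") (auto intro!: exI[of _ 1])
  \<comment> \<open>Each of the seven radii preserves one inequality that is strict at
    \<open>z\<close>. On a seam one inequality is an equality instead, and \<open>w\<close> selects
    the trapezoid in which the translation takes place.\<close>
  obtain e1 where e1: "e1 > 0" "\<And>w. norm w < e1 \<Longrightarrow> 0 < Im z \<longrightarrow> 0 < Im z + 0 * Re w + 1 * Im w"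
      using nbhd by metis
  obtain e2 where e2: "e2 > 0" "\<And>w. norm w < e2 \<Longrightarrow> 0 < hgt k i - Im z \<longrightarrow> 0
      < hgt k i - Im z + 0 * Re w + (- 1) * Im w" using nbhd by metis
  obtain e3 where e3: "e3 > 0" "\<And>w. norm w < e3 \<Longrightarrow> 0 < x + r \<longrightarrow> 0 < x + r + 1 * Re w + ct i * Im w"
      using nbhd by metis
  obtain e4 where e4: "e4 > 0" "\<And>w. norm w < e4 \<Longrightarrow> 0 < r - x \<longrightarrow> 0
      < r - x + (- 1) * Re w + ct i * Im w" using nbhd by metis
  obtain e5 where e5: "e5 > 0" "\<And>w. norm w < e5 \<Longrightarrow> 0 < x - r \<longrightarrow> 0
      < x - r + 1 * Re w + (- ct i) * Im w" using nbhd by metis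
  obtain e6 where e6: "e6 > 0" "\<And>w. norm w < e6 \<Longrightarrow> 0 < W - r - x \<longrightarrow> 0
      < W - r - x + (- 1) * Re w + (- ct i) * Im w" using nbhd by metis
  obtain e7 where e7: "e7 > 0" "\<And>w. norm w < e7 \<Longrightarrow> 0 < x + W - r \<longrightarrow> 0
      < x + W - r + 1 * Re w + (- ct i) * Im w" using nbhd by metis
  define e where "e = Min {e1, e2, e3, e4, e5, e6, e7}"
  have e: "0 < e" using e1(1) e2(1) e3(1) e4(1) e5(1) e6(1) e7(1) by (simp add: e_def)
  show ?thesis
  proof (intro exI[of _ e] conjI allI impI e)
    fix w :: complex assume "norm w < e"
    then have w: "norm w < e1" "norm w < e2" "norm w < e3" "norm w < e4" "norm w < e5" "norm w < e6"
        "norm w < e7"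
      by (simp_all add: e_def)
    note F = e1(2)[OF w(1)] e2(2)[OF w(2)] e3(2)[OF w(3)] e4(2)[OF w(4)] e5(2)[OF w(5)] e6(2)[OF w(6)]
        e7(2)[OF w(7)]
    show t1: "0 < Im (z + w)" "Im (z + w) < hgt k i" using F(1,2) t by auto
    have zz: "z = Complex (Re z) (Im z)" "z + w = Complex (Re z + Re w) (Im (z + w))"
        by (simp_all add: complex_eq_iff)
    have regs: "phi k i z \<in> bm_surface m n" "phi k i (z + w) \<in> bm_surface m n"
      using phi_regular[OF ki t, of "Re z"] phi_regular[OF ki t1, of "Re z + Re w"] zz by auto
    have A: "bm_move m n (phi k i z) w (phi k i (z + w))"
      if "\<bar>x\<bar> \<le> r" "\<bar>x + Re w\<bar> \<le> rr k i (Im (z + w))"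
    proof (rule moveI[OF regs])
      show "(k, cp k x (Y k i + Im z)) \<in> phi k i z"
        using phi_first[OF ki t, of "Re z" j] pt_mem[OF ki t, of x] that zz by (simp add: x_def W_def r_def)
      have e: "Re z + Re w - of_int j * wd k i = x + Re w" by (simp add: x_def W_def)
      have "phi k i (z + w) = pt k i (x + Re w) (Im (z + w))"
        using phi_first[OF ki t1, of "Re z + Re w" j, unfolded e] that(2) zz(2) by simp
      then show "(k, cp k x (Y k i + Im z) + w) \<in> phi k i (z + w)"
        using pt_mem[OF ki t1, of "x + Re w"] that by (simp add: cp_add add.assoc)
    qed
    \<comment> \<open>Used with \<open>l = 0\<close> and \<open>l = 1\<close>: the left seam
      \<open>x = - r\<close> of the first trapezoid is, one period further, the right end of the
      second.\<close>
    have B: "bm_move m n (phi k i z) w (phi k i (z + w))"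
      if "\<bar>x + of_int l * W - W / 2\<bar> \<le> W / 2 - r"
          "\<bar>x + of_int l * W + Re w - W / 2\<bar> \<le> W / 2 - rr k i (Im (z + w))" for l :: int
    proof (rule moveI[OF regs])
      let ?x = "x + of_int l * W - W / 2"
      have t2: "Im z < hgt (nb k i) (n - i)" "Im (z + w) < hgt (nb k i) (n - i)" using R t t1 by auto
      have e: "Re z - of_int (j - l) * wd k i - wd k i / 2 = ?x"
          "Re z + Re w - of_int (j - l) * wd k i - wd k i / 2 = ?x + Re w"
        by (simp_all add: x_def W_def algebra_simps)
      have c: "\<bar>?x\<bar> \<le> rr (nb k i) (n - i) (Im z)" "\<bar>?x + Re w\<bar> \<le> rr (nb k i) (n - i) (Im (z + w))"
        using that unfolding rr_nb[OF ki] W_def r_def by (simp_all add: algebra_simps)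
      show "(nb k i, cp (nb k i) ?x (Y (nb k i) (n - i) + Im z)) \<in> phi k i z"
        using phi_second[OF ki t, of "Re z" "j - l"] pt_mem[OF R(1) t(1) t2(1) c(1)] zz(1) e(1) c(1) by simp
      have "phi k i (z + w) = pt (nb k i) (n - i) (?x + Re w) (Im (z + w))"
        using phi_second[OF ki t1, of "Re z + Re w" "j - l", unfolded e(2)] c zz(2) by simp
      then show "(nb k i, cp (nb k i) ?x (Y (nb k i) (n - i) + Im z) + w) \<in> phi k i (z + w)"
        using pt_mem[OF R(1) t1(1) t2(2) c(2)] by (simp add: cp_add add.assoc)
    qed
    note rw' = rw[of w]
    show "bm_move m n (phi k i z) w (phi k i (z + w))"
    proof (cases "x \<le> r")
      case True
      consider "\<bar>x + Re w\<bar> \<le> rr k i (Im (z + w))" | "x + Re w > rr k i (Im (z + w))" | "x + Re w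
          < - rr k i (Im (z + w))" by linarith
      then show ?thesis
      proof cases
        case 1
        then show ?thesis using A True xb by (simp add: abs_le_iff)
      next
        case 2
        then have "x = r" using True F(4) unfolding rw' by linarith
        then show ?thesis using B[of 0] 2 F(6) W0 xb unfolding rw' by (simp add: abs_le_iff)
      next
        case 3
        then have "x = - r" using xb F(3) unfolding rw' by linarith
        then show ?thesis using B[of 1] 3 F(7) W0 xb unfolding rw' by (simp add: abs_le_iff)
      qed
    next
      case False
      then show ?thesis using B[of 0] F(5,6) xb unfolding rw' by (simp add: abs_le_iff)
    qed
  qed
qed

section \<open>The horizontal cylinder decomposition\<close>

lemma trapezoid_exists:
  assumes "k < m" "cp k x y \<in> bm_polygon m n k" "\<And>j. 0 < j \<Longrightarrow> j \<le> n \<Longrightarrow> y \<noteq> Y k j"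
  obtains i t where "redge k i" "0 < t" "t < hgt k i" "y = Y k i + t" "\<bar>x\<bar> \<le> rr k i t"
proof -
  have y: "0 \<le> y" "y \<le> Y k n" using polygon_height assms by auto
  have y0: "0 < y" "y < Y k n" using y assms(3)[of 1] assms(3)[of n] n_ge by force+
  \<comment> \<open>The largest such index skips degenerate edges: the height must increase strictly
    along edge \<open>i\<close>, so its length is positive.\<close>
  define i where "i = Max {j. 0 < j \<and> j \<le> n \<and> Y k j < y}"
  have fin: "finite {j. 0 < j \<and> j \<le> n \<and> Y k j < y}" by (rule finite_subset[of _ "{..n}"]) auto
  have "1 \<in> {j. 0 < j \<and> j \<le> n \<and> Y k j < y}" using y0 n_ge by simp
  then have i: "0 < i" "i \<le> n" "Y k i < y" using Max_in[OF fin] unfolding i_def by blast+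
  have "i \<noteq> n" using i y0 by auto
  then have i': "i < n" using i by simp
  have "\<not> Y k (Suc i) < y"
  proof
    assume "Y k (Suc i) < y"
    then have "Suc i \<le> i" using i' Max_ge[OF fin, of "Suc i"] by (simp add: i_def)
    then show False by simp
  qed
  then have s: "y < Y k (Suc i)" using assms(3)[of "Suc i"] i' by force
  then have "0 < hgt k i" using i by (simp add: Y_hgt)
  then have "0 < len k i" using sin_mult_al_pos[OF i(1) i'] len_nonneg[OF assms(1), of i]
    by (auto simp: hgt_def zero_less_mult_iff)
  then have r: "redge k i" using i i' assms(1) by (simp add: redge_iff)
  show ?thesis
  proof (rule that[OF r, of "y - Y k i"])
    show "\<bar>x\<bar> \<le> rr k i (y - Y k i)" using polygon_width[of k i x "y - Y k i"] assms i i' by simp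
  qed (use i s in \<open>auto simp: Y_hgt\<close>)
qed

text \<open>A vertex and its mirror image bound the horizontal section of the polygon at their
  height. So the cut consists of entire sections, and only the height of a representative
  matters.\<close>

lemma cut_iff:
  "p \<in> bm_cut m n \<longleftrightarrow> p \<in> bm_surface m n \<and> (\<exists>k x j. (k, cp k x (Y k j)) \<in> p \<and> 0 < j \<and> j \<le> n)"
proof
  assume p: "p \<in> bm_cut m n"
  then obtain k z i j where z: "p \<in> bm_surface m n" "(k, z) \<in> p" "i < 2 * n" "j < 2 * n"
      "Im (vert k i) = Im (vert k j)"
    "z \<in> closed_segment (vert k i) (vert k j)"
    by (auto simp: bm_cut_def)
  then obtain u where "z = (1 - u) *\<^sub>R vert k i + u *\<^sub>R vert k j" by (auto simp: closed_segment_def)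
  then have "Im z = (1 - u) * Im (vert k i) + u * Im (vert k j)" by simp
  then have "Im z = Im (vert k i)" using z(5) by (simp add: algebra_simps)
  moreover obtain l where "0 < l" "l \<le> n" "Im (vert k i) = Y k l" using vert_in_verts[of k i]
      by (auto simp: verts_iff)
  ultimately have "(k, cp k (Re z - hc k) (Y k l)) \<in> p" using z(2) cp_collapse[of k z] by metis
  then show "p \<in> bm_surface m n \<and> (\<exists>k x j. (k, cp k x (Y k j)) \<in> p \<and> 0 < j \<and> j \<le> n)"
    using z \<open>0 < l\<close> \<open>l \<le> n\<close> by blast
next
  assume "p \<in> bm_surface m n \<and> (\<exists>k x j. (k, cp k x (Y k j)) \<in> p \<and> 0 < j \<and> j \<le> n)"
  then obtain k x j where p: "p \<in> bm_surface m n" "(k, cp k x (Y k j)) \<in> p" "0 < j" "j \<le> n" by blast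
  have P: "k < m" "cp k x (Y k j) \<in> bm_polygon m n k" using surface_rep p by auto
  have x: "\<bar>x\<bar> \<le> X k j" using polygon_width_vertex P p by auto
  define l where "l = (2 * n + 1 - j) mod (2 * n)"
  have l: "l < 2 * n" "vert k l = cp k (- X k j) (Y k j)"
    using n_ge vert_mirror_cp[of j k] p(4) by (auto simp: l_def vert_mod)
  have "cp k x (Y k j) \<in> closed_segment (vert k l) (vert k j)"
  proof (cases "X k j = 0")
    case True
    then show ?thesis using x l by (simp add: vert_cp[of k j])
  next
    case False
    define u where "u = (x + X k j) / (2 * X k j)"
    have u: "0 \<le> u" "u \<le> 1" "2 * u * X k j = x + X k j" using x False by (auto simp: u_def field_simps)
    have "cp k x (Y k j) = (1 - u) *\<^sub>R vert k l + u *\<^sub>R vert k j"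
      unfolding l(2) vert_cp[of k j] cp_convex using u(3) by (simp add: algebra_simps)
    then show ?thesis using u unfolding closed_segment_def by blast
  qed
  moreover have "Im (vert k l) = Im (vert k j)" using l by (simp add: vert_cp[of k j])
  moreover have "j < 2 * n" using p n_ge by simp
  ultimately show "p \<in> bm_cut m n" unfolding bm_cut_def using p(1,2) l(1) by blast
qed

lemma Y_strict_between:
  assumes "redge k i" "0 < t" "t < hgt k i" "0 < j" "j \<le> n" shows "Y k i + t \<noteq> Y k j"
proof -
  have "Y k j \<le> Y k i \<or> Y k (Suc i) \<le> Y k j"
    using Y_mono[of k j i] Y_mono[of k "Suc i" j] assms redge_facts[OF assms(1)] by linarith
  then show ?thesis using assms(2,3) unfolding Y_hgt by linarith
qed

lemma trapezoid_unique:
  assumes "redge k i" "0 < t" "t < hgt k i" "redge k i'" "0 < t'" "t' < hgt k i'" "Y k i + t = Y k i' + t'"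
  shows "i = i' \<and> t = t'"
proof (rule ccontr)
  assume "\<not> ?thesis"
  then have "i \<noteq> i'" using assms(7) by auto
  then have "i < i' \<or> i' < i" by linarith
  then have "Y k (Suc i) \<le> Y k i' \<or> Y k (Suc i') \<le> Y k i"
    using Y_mono[of k "Suc i" i'] Y_mono[of k "Suc i'" i] redge_facts[OF assms(1)] redge_facts[OF
        assms(4)] by auto
  then show False using assms by (simp add: Y_hgt)
qed

lemma pt_cases:
  assumes "redge k i" "0 < t" "t < hgt k i" "\<bar>x\<bar> \<le> rr k i t" "(k1, z1) \<in> pt k i x t"
  shows "k1 = k \<and> z1 = cp k x (Y k i + t) \<or> k1 = nb k i \<and> Im z1 = Y (nb k i) (n - i) + t"
proof -
  have "\<bar>x\<bar> < rr k i t \<or> x = rr k i t \<or> x = - rr k i t" using assms by linarith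
  then show ?thesis using assms pt_inner[OF assms(1-3)] pt_right[OF assms(1-3)] pt_left[OF assms(1-3)]
      by auto
qed

lemma pt_not_cut:
  assumes "redge k i" "0 < t" "t < hgt k i" "\<bar>x\<bar> \<le> rr k i t" shows "pt k i x t \<notin> bm_cut m n"
proof
  assume "pt k i x t \<in> bm_cut m n"
  then obtain k1 x1 j where j: "(k1, cp k1 x1 (Y k1 j)) \<in> pt k i x t" "0 < j" "j \<le> n"
      by (auto simp: cut_iff)
  have "t < hgt (nb k i) (n - i)" using redge_nb assms by simp
  then show False using pt_cases[OF assms j(1)] Y_strict_between[OF assms(1-3) j(2,3)]
    Y_strict_between[OF redge_nb(1)[OF assms(1)] assms(2) _ j(2,3)] by auto
qed

lemma not_cut_pt:
  assumes "p \<in> bm_surface m n" "p \<notin> bm_cut m n"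
  obtains k i x t where "redge k i" "0 < t" "t < hgt k i" "\<bar>x\<bar> \<le> rr k i t" "p = pt k i x t"
proof -
  obtain k z where z: "k < m" "z \<in> bm_polygon m n k" "p = cl k z" "(k, z) \<in> p"
      using surface_obtain assms by blast
  define x where "x = Re z - hc k"
  have zc: "z = cp k x (Im z)" by (simp add: x_def cp_collapse)
  have h: "Im z \<noteq> Y k j" if "0 < j" "j \<le> n" for j
    using assms z(4) zc that unfolding cut_iff by metis
  obtain i t where it: "redge k i" "0 < t" "t < hgt k i" "Im z = Y k i + t" "\<bar>x\<bar> \<le> rr k i t"
    using trapezoid_exists[OF z(1) _ h, of x] z(2) zc by metis
  then have "p = pt k i x t" using z zc by (simp add: pt_def)
  then show ?thesis using that it by blast
qed

section \<open>The cylinders as components of the complement of the cut\<close>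

definition Cyl :: "nat \<Rightarrow> nat \<Rightarrow> bm_point set" where
  "Cyl k i = phi k i ` {z. 0 < Im z \<and> Im z < hgt k i}"

text \<open>Membership read off from one representative: only its polygon and height enter. The
  preimage of a cylinder in a polygon is therefore cut out by open horizontal strips, which gives
  openness in the quotient topology.\<close>

definition inCyl :: "nat \<Rightarrow> nat \<Rightarrow> nat \<Rightarrow> real \<Rightarrow> bool" where
  "inCyl k i k1 y \<longleftrightarrow> k1 = k \<and> Y k i < y \<and> y < Y k i + hgt k i
    \<or> k1 = nb k i \<and> Y (nb k i) (n - i) < y \<and> y < Y (nb k i) (n - i) + hgt k i"

lemma pt_in_Cyl:
  assumes "redge k i" "0 < t" "t < hgt k i"
  shows "\<bar>x\<bar> \<le> rr k i t \<Longrightarrow> pt k i x t \<in> Cyl k i"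
    "\<bar>x\<bar> \<le> rr (nb k i) (n - i) t \<Longrightarrow> pt (nb k i) (n - i) x t \<in> Cyl k i"
proof -
  show "pt k i x t \<in> Cyl k i" if "\<bar>x\<bar> \<le> rr k i t"
    using phi_first[OF assms, of x 0] that assms unfolding Cyl_def
        by (intro image_eqI[of _ _ "Complex x t"]) auto
  show "pt (nb k i) (n - i) x t \<in> Cyl k i" if "\<bar>x\<bar> \<le> rr (nb k i) (n - i) t"
    using phi_second[OF assms, of "x + wd k i / 2" 0] that assms unfolding Cyl_def
    by (intro image_eqI[of _ _ "Complex (x + wd k i / 2) t"]) auto
qed

lemma Cyl_E:
  assumes "redge k i" "p \<in> Cyl k i"
  obtains x t where "0 < t" "t < hgt k i" "\<bar>x\<bar> \<le> rr k i t" "p = pt k i x t"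
  | x t where "0 < t" "t < hgt k i" "\<bar>x\<bar> \<le> rr (nb k i) (n - i) t" "p = pt (nb k i) (n - i) x t"
proof -
  obtain z where "0 < Im z" "Im z < hgt k i" "p = phi k i z"
    using assms(2) unfolding Cyl_def by auto
  then obtain x t where z: "0 < t" "t < hgt k i" "p = phi k i (Complex x t)"
    by (metis complex.collapse)
  show ?thesis
  proof (cases rule: phi_cases[OF assms(1) z(1,2), of x])
    case (1 j)
    then have "\<bar>x - of_int j * wd k i\<bar> \<le> rr k i t" by (simp add: abs_le_iff)
    then show ?thesis using that(1)[OF z(1,2)] z(3) 1(3) by simp
  next
    case (2 j)
    have "\<bar>x - of_int j * wd k i - wd k i / 2\<bar> \<le> rr (nb k i) (n - i) t"
      using 2 rr_nb[OF assms(1), of t] unfolding abs_le_iff by linarith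
    then show ?thesis using that(2)[OF z(1,2)] z(3) 2 by simp
  qed
qed

lemma Cyl_iff:
  assumes "redge k i" "p \<in> bm_surface m n" "(k1, z1) \<in> p"
  shows "p \<in> Cyl k i \<longleftrightarrow> inCyl k i k1 (Im z1)"
proof
  note R = redge_nb[OF assms(1)]
  assume p: "p \<in> Cyl k i"
  show "inCyl k i k1 (Im z1)"
  proof (cases rule: Cyl_E[OF assms(1) p])
    case (1 x t)
    then show ?thesis using pt_cases[OF assms(1) 1(1-3), of k1 z1] assms(3) by (auto simp: inCyl_def)
  next
    case (2 x t)
    have "n - (n - i) = i" using assms by (simp add: redge_iff)
    then show ?thesis using pt_cases[OF R(1) 2(1) _ 2(3), of k1 z1] 2 assms(3) R by (auto simp: inCyl_def)
  qed
next
  assume c: "inCyl k i k1 (Im z1)"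
  note R = redge_nb[OF assms(1)]
  have P: "k1 < m" "z1 \<in> bm_polygon m n k1" "p = cl k1 z1" using surface_rep assms by auto
  have z: "z1 = cp k1 (Re z1 - hc k1) (Im z1)" by (simp add: cp_collapse)
  from c consider "k1 = k" "Y k i < Im z1" "Im z1 < Y k i + hgt k i"
    | "k1 = nb k i" "Y (nb k i) (n - i) < Im z1" "Im z1 < Y (nb k i) (n - i) + hgt k i"
        by (auto simp: inCyl_def)
  then show "p \<in> Cyl k i"
  proof cases
    case 1
    have z': "z1 = cp k1 (Re z1 - hc k1) (Y k1 i + (Im z1 - Y k1 i))" using z by simp
    then have "\<bar>Re z1 - hc k\<bar> \<le> rr k i (Im z1 - Y k i)"
      using polygon_width[of k1 i "Re z1 - hc k1" "Im z1 - Y k i"] P assms(1) 1 by (auto simp: redge_iff)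
    moreover have "p = pt k i (Re z1 - hc k) (Im z1 - Y k i)" using P(3) z 1(1) by (simp add: pt_def)
    ultimately show ?thesis using pt_in_Cyl(1)[OF assms(1), of "Im z1 - Y k i"] 1 by simp
  next
    case 2
    have z': "z1 = cp k1 (Re z1 - hc k1) (Y k1 (n - i) + (Im z1 - Y k1 (n - i)))" using z by simp
    then have "\<bar>Re z1 - hc k1\<bar> \<le> rr (nb k i) (n - i) (Im z1 - Y (nb k i) (n - i))"
      using polygon_width[of k1 "n - i" "Re z1 - hc k1" "Im z1 - Y (nb k i) (n - i)"] P assms(1) 2
          by (auto simp: redge_iff)
    moreover have "p = pt (nb k i) (n - i) (Re z1 - hc k1) (Im z1 - Y (nb k i) (n - i))"
        using P(3) z 2(1) by (simp add: pt_def)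
    ultimately show ?thesis using pt_in_Cyl(2)[OF assms(1), of "Im z1 - Y (nb k i) (n - i)"] 2 by simp
  qed
qed

lemma Cyl_regular: "redge k i \<Longrightarrow> Cyl k i \<subseteq> regular"
proof -
  assume r: "redge k i"
  have "phi k i z \<in> regular" if "0 < Im z" "Im z < hgt k i" for z
    using phi_regular[OF r that, of "Re z"] by simp
  then show ?thesis unfolding Cyl_def by blast
qed

text \<open>A cylinder has two names, one for each of its trapezoids. Given a common point, both
  cylinders are renamed after the trapezoid that contains one fixed representative, and
  \<open>trapezoid_unique\<close> identifies the names.\<close>

lemma Cyl_disjoint:
  assumes "redge k i" "redge k1 i1" "p \<in> Cyl k i" "p \<in> Cyl k1 i1" shows "Cyl k i = Cyl k1 i1"
proof -
  have nn: "Cyl k i = Cyl (nb k i) (n - i)" if "redge k i" for k i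
  proof -
    have "n - (n - i) = i" using that by (simp add: redge_iff)
    then have "inCyl k i = inCyl (nb k i) (n - i)" using redge_nb[OF that]
        by (auto simp: inCyl_def fun_eq_iff)
    moreover have "\<exists>k z. (k, z) \<in> p" if "p \<in> bm_surface m n" for p using surface_obtain[OF that] by blast
    ultimately show ?thesis
      using Cyl_iff[OF that] Cyl_iff[OF redge_nb(1)[OF that]] Cyl_regular[OF that] Cyl_regular[OF
          redge_nb(1)[OF that]]
      by (smt (verit) DiffD1 subsetD set_eq_iff)
  qed
  have p: "p \<in> bm_surface m n" using assms Cyl_regular by blast
  then obtain k2 z2 where z: "(k2, z2) \<in> p" using surface_obtain by blast
  have *: "\<exists>i2 t. redge k2 i2 \<and> 0 < t \<and> t < hgt k2 i2 \<and> Im z2 = Y k2 i2 + t \<and> Cyl k i = Cyl k2 i2"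
    if r: "redge k i" "p \<in> Cyl k i" for k i
  proof -
    have "inCyl k i k2 (Im z2)" using Cyl_iff[OF r(1) p z] r by simp
    then consider "k2 = k" "Y k i < Im z2" "Im z2 < Y k i + hgt k i"
    | "k2 = nb k i" "Y (nb k i) (n - i) < Im z2" "Im z2 < Y (nb k i) (n - i) + hgt k i"
        by (auto simp: inCyl_def)
    then show ?thesis
    proof cases
      case 1
      then show ?thesis using r by (intro exI[of _ i] exI[of _ "Im z2 - Y k i"]) auto
    next
      case 2
      then show ?thesis using redge_nb[OF r(1)] nn[OF r(1)]
        by (intro exI[of _ "n - i"] exI[of _ "Im z2 - Y (nb k i) (n - i)"]) auto
    qed
  qed
  obtain a s b t where "redge k2 a" "0 < s" "s < hgt k2 a" "Im z2 = Y k2 a + s" "Cyl k i = Cyl k2 a"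
    "redge k2 b" "0 < t" "t < hgt k2 b" "Im z2 = Y k2 b + t" "Cyl k1 i1 = Cyl k2 b"
    using *[OF assms(1,3)] *[OF assms(2,4)] by blast
  then show ?thesis using trapezoid_unique[of k2 a s b t] by auto
qed

lemma Union_Cyl: "bm_surface m n - bm_cut m n = (\<Union>(k, i)\<in>{(k, i). redge k i}. Cyl k i)"
proof (intro set_eqI iffI)
  fix p assume "p \<in> bm_surface m n - bm_cut m n"
  then have p: "p \<in> bm_surface m n" "p \<notin> bm_cut m n" by auto
  obtain k i x t where "redge k i" "0 < t" "t < hgt k i" "\<bar>x\<bar> \<le> rr k i t" "p = pt k i x t"
    by (rule not_cut_pt[OF p])
  then have "redge k i" "p \<in> Cyl k i" using pt_in_Cyl(1) by simp_all
  then show "p \<in> (\<Union>(k, i)\<in>{(k, i). redge k i}. Cyl k i)" by blast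
next
  fix p assume "p \<in> (\<Union>(k, i)\<in>{(k, i). redge k i}. Cyl k i)"
  then obtain k i where r: "redge k i" "p \<in> Cyl k i" by blast
  have "p \<notin> bm_cut m n"
  proof (cases rule: Cyl_E[OF r])
    case (1 x t)
    then show ?thesis using pt_not_cut[OF r(1) 1(1-3)] by simp
  next
    case (2 x t)
    then show ?thesis using pt_not_cut[OF redge_nb(1)[OF r(1)] 2(1) _ 2(3)] redge_nb(3)[OF r(1)] by simp
  qed
  then show "p \<in> bm_surface m n - bm_cut m n" using r Cyl_regular by blast
qed

lemma topspace_bm [simp]: "topspace (bm_topology m n) = bm_surface m n"
proof -
  have "{x \<in> bm_carrier m n. bm_rel m n `` {x} \<in> bm_surface m n} = Sigma {..<m} (bm_polygon m n)"
    using cl_surface by (auto simp: bm_carrier_def)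
  then have "openin (bm_topology m n) (bm_surface m n)"
    by (simp add: openin_bm_topology openin_sum_topology comp_def)
  then show ?thesis
    by (metis openin_bm_topology openin_subset openin_topspace subset_antisym)
qed

lemma openin_Cyl:
  assumes "redge k i" shows "openin (bm_topology m n) (Cyl k i)"
proof -
  have *: "openin (top_of_set (bm_polygon m n k1)) {z. (k1, z) \<in> {x \<in> bm_carrier m n. bm_rel m n `` {x}
      \<in> Cyl k i}}" for k1
  proof -
    have e: "{z. (k1, z) \<in> {x \<in> bm_carrier m n. bm_rel m n `` {x} \<in> Cyl k i}} =
      (if k1 < m then bm_polygon m n k1 \<inter> {z. inCyl k i k1 (Im z)} else {})"
      using Cyl_iff[OF assms cl_surface cl_self] by (auto simp: bm_carrier_def)
    have s: "{z. inCyl k i k1 (Im z)} = (if k1 = k then {z. Y k i < Im z} \<inter> {z. Im z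
        < Y k i + hgt k i} else {})
      \<union> (if k1 = nb k i then {z. Y (nb k i) (n - i) < Im z} \<inter> {z. Im z
          < Y (nb k i) (n - i) + hgt k i} else {})"
      by (auto simp: inCyl_def)
    have "open {z. inCyl k i k1 (Im z)}"
      unfolding s by (auto intro!: open_Un open_Int open_halfspace_Im_gt open_halfspace_Im_lt)
    then show ?thesis unfolding e by auto
  qed
  have "Cyl k i \<subseteq> bm_surface m n" using Cyl_regular[OF assms] by blast
  moreover have "{x \<in> bm_carrier m n. bm_rel m n `` {x} \<in> Cyl k i} \<subseteq> Sigma {..<m} (topspace \<circ> (\<lambda>k.
      top_of_set (bm_polygon m n k)))"
    by (auto simp: bm_carrier_def)
  ultimately show ?thesis
    unfolding openin_bm_topology openin_sum_topology using * by blast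
qed

lemma finite_regular:
  assumes "p \<in> regular" shows "finite p"
proof -
  obtain k z where kz: "k < m" "z \<in> bm_polygon m n k" "z \<notin> bm_verts m n k" "p = cl k z"
    using regular_obtain[OF assms] by blast
  show ?thesis using kz(1-3)
  proof (cases rule: polygon_cases)
    case 1
    then show ?thesis using cl_inter kz by simp
  next
    case (2 i)
    then show ?thesis using cl_edge[OF 2 kz(3)] kz by simp
  qed
qed

text \<open>Each representative has its own admissible radius. A regular point has finitely many
  representatives, so the minimum of the radii works for all moves.\<close>

lemma open_move:
  assumes "openin (bm_topology m n) U" "p \<in> U" "p \<in> regular"
  shows "\<exists>e>0. \<forall>w q. norm w < e \<longrightarrow> bm_move m n p w q \<longrightarrow> q \<in> U"
proof -
  have "\<exists>e>0. \<forall>w. norm w < e \<longrightarrow> z + w \<in> bm_polygon m n k \<longrightarrow> cl k (z + w) \<in> U" if "(k, z) \<in> p" for k z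
  proof -
    have P: "k < m" "z \<in> bm_polygon m n k" "p = cl k z" using surface_rep assms(3) that by blast+
    have "openin (top_of_set (bm_polygon m n k)) {z. (k, z) \<in> {x \<in> bm_carrier m n. bm_rel m n `` {x} \<in> U}}"
      using assms(1) P unfolding openin_bm_topology openin_sum_topology by auto
    then obtain T where T: "open T" "{z. (k, z) \<in> {x \<in> bm_carrier m n. bm_rel m n `` {x} \<in> U}}
        = bm_polygon m n k \<inter> T"
      by (auto simp: openin_open)
    have "z \<in> T" using T(2) P assms(2) by (auto simp: bm_carrier_def)
    then obtain e where e: "0 < e" "ball z e \<subseteq> T" using openE[OF T(1)] by blast
    show ?thesis
    proof (intro exI[of _ e] conjI allI impI e(1))
      fix w :: complex assume "norm w < e" "z + w \<in> bm_polygon m n k"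
      then have "z + w \<in> bm_polygon m n k \<inter> T" using e(2) by (auto simp: dist_norm subset_iff)
      then show "cl k (z + w) \<in> U" using T(2) by blast
    qed
  qed
  then have "\<forall>x\<in>p. \<exists>e>0. \<forall>w. norm w < e \<longrightarrow> snd x + w \<in> bm_polygon m n (fst x) \<longrightarrow> cl (fst x) (snd x + w) \<in> U"
    by auto
  then obtain f where f: "\<And>x. x \<in> p \<Longrightarrow> 0 < f x"
    "\<And>x w. x \<in> p \<Longrightarrow> norm w < f x \<Longrightarrow> snd x + w \<in> bm_polygon m n (fst x) \<Longrightarrow> cl (fst x) (snd x + w) \<in> U"
    by metis
  have fin: "finite (insert 1 (f ` p))" using finite_regular[OF assms(3)] by simp
  define e where "e = Min (insert 1 (f ` p))"
  have e: "0 < e" using fin f by (simp add: e_def)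
  show ?thesis
  proof (intro exI[of _ e] conjI allI impI e)
    fix w q assume w: "norm w < e" and "bm_move m n p w q"
    then obtain k z where kz: "(k, z) \<in> p" "(k, z + w) \<in> q" "q \<in> bm_surface m n" by (auto simp: bm_move_def)
    have "e \<le> f (k, z)" unfolding e_def using kz fin by (intro Min_le) auto
    then show "q \<in> U" using f(2)[OF kz(1), of w] w surface_rep[OF kz(3,2)] by simp
  qed
qed

lemma connectedin_Cyl:
  assumes "redge k i" shows "connectedin (bm_topology m n) (Cyl k i)"
proof -
  let ?S = "{z. 0 < Im z \<and> Im z < hgt k i}"
  have S: "?S = {z. 0 < Im z} \<inter> {z. Im z < hgt k i}" by auto
  have oS: "open ?S" unfolding S by (intro open_Int open_halfspace_Im_gt open_halfspace_Im_lt)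
  have cS: "connected ?S" unfolding S
    by (intro convex_connected convex_Int convex_halfspace_Im_gt convex_halfspace_Im_lt)
  have "continuous_map (top_of_set ?S) (bm_topology m n) (phi k i)"
    unfolding continuous_map
  proof (intro conjI allI impI)
    show "phi k i ` topspace (top_of_set ?S) \<subseteq> topspace (bm_topology m n)"
      using Cyl_regular[OF assms] by (auto simp: Cyl_def)
    fix U assume U: "openin (bm_topology m n) U"
    have "open {z \<in> ?S. phi k i z \<in> U}"
      unfolding open_contains_ball
    proof
      fix z assume z: "z \<in> {z \<in> ?S. phi k i z \<in> U}"
      then have "phi k i z \<in> regular" using Cyl_regular[OF assms] by (auto simp: Cyl_def)
      then obtain e where e: "e > 0" "\<And>w q. norm w < e \<Longrightarrow> bm_move m n (phi k i z) w q \<Longrightarrow> q \<in> U"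
        using open_move[OF U, of "phi k i z"] z by blast
      obtain d where d: "d > 0" "\<And>w. norm w < d \<Longrightarrow> 0 < Im (z + w) \<and> Im (z + w) < hgt k i
          \<and> bm_move m n (phi k i z) w (phi k i (z + w))"
        using phi_move[OF assms, of z] z by blast
      have "ball z (min e d) \<subseteq> {z \<in> ?S. phi k i z \<in> U}"
      proof
        fix y assume "y \<in> ball z (min e d)"
        then have w: "norm (y - z) < e" "norm (y - z) < d" by (auto simp: dist_norm norm_minus_commute)
        show "y \<in> {z \<in> ?S. phi k i z \<in> U}" using d(2)[OF w(2)] e(2)[OF w(1)] by simp
      qed
      then show "\<exists>e>0. ball z e \<subseteq> {z \<in> ?S. phi k i z \<in> U}" using e(1) d(1)
          by (intro exI[of _ "min e d"]) auto
    qed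
    then have "openin (top_of_set ?S) {z \<in> ?S. phi k i z \<in> U}"
      by (intro open_openin_trans oS) auto
    then show "openin (top_of_set ?S) {z \<in> topspace (top_of_set ?S). phi k i z \<in> U}" by simp
  qed
  then show ?thesis unfolding Cyl_def
    by (rule connectedin_continuous_map_image) (use cS in \<open>auto simp: connectedin_subtopology\<close>)
qed

text \<open>The sets \<open>Cyl k i\<close> are open, connected, pairwise equal or disjoint, and
  cover the complement of the cut. A component contains the one that it meets; if it were larger,
  the union \<open>D\<close> of the others would disconnect it.\<close>

lemma cylinders_eq:
  assumes "C \<in> bm_cylinders m n"
  obtains k i where "redge k i" "C = Cyl k i"
proof -
  let ?U = "bm_surface m n - bm_cut m n"
  let ?T = "subtopology (bm_topology m n) ?U"
  have C: "C \<in> connected_components_of ?T" using assms by (simp add: bm_cylinders_def)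
  have CU: "C \<subseteq> ?U" using connected_components_of_subset[OF C] by auto
  obtain p where p: "p \<in> C" using nonempty_connected_components_of[OF C] by blast
  then obtain k i where r: "redge k i" "p \<in> Cyl k i" using CU Union_Cyl by blast
  have sub: "Cyl k i \<subseteq> ?U" if "redge k i" for k i using Union_Cyl that by blast
  have op: "openin ?T (Cyl k i)" if "redge k i" for k i
    using openin_Cyl[OF that] sub[OF that] by (auto simp: openin_subtopology)
  have "connectedin ?T (Cyl k i)" using connectedin_Cyl[OF r(1)] sub[OF r(1)]
      by (simp add: connectedin_subtopology)
  then have "Cyl k i \<subseteq> C" using C p r(2) by (intro connected_components_of_maximal[OF C]) (auto simp:
      disjnt_iff)
  moreover have "C \<subseteq> Cyl k i"
  proof (rule ccontr)
    assume nsub: "\<not> C \<subseteq> Cyl k i"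
    define D where "D = \<Union>{A. \<exists>k1 i1. redge k1 i1 \<and> A = Cyl k1 i1 \<and> A \<noteq> Cyl k i}"
    have "openin ?T D" unfolding D_def using op by (intro openin_Union) auto
    moreover have "C \<subseteq> Cyl k i \<union> D"
    proof
      fix q assume "q \<in> C"
      then obtain k1 i1 where "redge k1 i1" "q \<in> Cyl k1 i1" using CU Union_Cyl by blast
      then show "q \<in> Cyl k i \<union> D" unfolding D_def by blast
    qed
    moreover have "Cyl k i \<inter> D = {}" using Cyl_disjoint[OF r(1)] unfolding D_def by blast
    moreover have "Cyl k i \<inter> C \<noteq> {}" using p r(2) by blast
    moreover have "D \<inter> C \<noteq> {}" using nsub calculation(2) by blast
    ultimately show False
      using connectedin_connected_components_of[OF C] op[OF r(1)] unfolding connectedin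
      by (metis (lifting) inf_bot_left)
  qed
  ultimately show ?thesis using that r by blast
qed

lemma flat_cylinder:
  assumes ki: "redge k i" shows "bm_flat_cylinder m n (Cyl k i) (wd k i) (hgt k i)"
proof -
  have h: "0 < hgt k i" using hgt_pos ki by simp
  have w: "0 < wd k i" using rr_bounds(3)[OF ki, of "hgt k i / 2"] h by simp
  show ?thesis unfolding bm_flat_cylinder_def Let_def
  proof (intro conjI h w exI[of _ "phi k i"] ballI)
    show "phi k i ` {z. 0 < Im z \<and> Im z < hgt k i} = Cyl k i" by (simp add: Cyl_def)
    fix z assume z: "z \<in> {z. 0 < Im z \<and> Im z < hgt k i}"
    then have z1: "0 < Im z" "Im z < hgt k i" by auto
    show "\<exists>e>0. \<forall>w. norm w < e \<longrightarrow> bm_move m n (phi k i z) w (phi k i (z + w))"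
      using phi_move[OF ki z1] by blast
    fix z' assume z': "z' \<in> {z. 0 < Im z \<and> Im z < hgt k i}"
    then have z2: "0 < Im z'" "Im z' < hgt k i" by auto
    show "phi k i z = phi k i z' \<longleftrightarrow> (\<exists>j::int. z' = z + of_real (of_int j * wd k i))"
    proof
      assume "phi k i z = phi k i z'"
      then have "Im z' = Im z \<and> (\<exists>j::int. Re z' = Re z + of_int j * wd k i)"
        using phi_inj[OF ki z1 z2, of "Re z" "Re z'"] by simp
      then show "\<exists>j::int. z' = z + of_real (of_int j * wd k i)" by (auto simp: complex_eq_iff)
    next
      assume "\<exists>j::int. z' = z + of_real (of_int j * wd k i)"
      then obtain j :: int where j: "z' = z + of_real (of_int j * wd k i)" by blast
      then have "z' = Complex (Re z + of_int j * wd k i) (Im z)" by (simp add: complex_eq_iff)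
      then show "phi k i z = phi k i z'" using phi_period[OF ki z1, of "Re z" j] by simp
    qed
  qed
qed

section \<open>The flip and the shear in cylinder coordinates\<close>

lemma flip_pt: "bm_flip m n (pt k i x t) = pt k i (- x) t"
  by (simp add: pt_def flip_cl)

lemma flip_phi:
  assumes "redge k i" "0 < Im z" "Im z < hgt k i"
  shows "bm_flip m n (phi k i z) = phi k i (- cnj z)"
proof -
  define x t where "x = Re z" and "t = Im z"
  have t: "0 < t" "t < hgt k i" using assms by (auto simp: t_def)
  have z: "z = Complex x t" "- cnj z = Complex (- x) t" by (simp_all add: complex_eq_iff x_def t_def)
  show ?thesis
  proof (cases rule: phi_cases[OF assms(1) t, of x])
    case (1 j)
    have e: "- x - of_int (- j) * wd k i = - (x - of_int j * wd k i)" by simp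
    have "\<bar>- x - of_int (- j) * wd k i\<bar> \<le> rr k i t" unfolding e using 1 by (simp add: abs_le_iff)
    then have "phi k i (Complex (- x) t) = pt k i (- (x - of_int j * wd k i)) t"
      using phi_first[OF assms(1) t, of "- x" "- j"] unfolding e by simp
    then show ?thesis using 1 z flip_pt by simp
  next
    case (2 j)
    \<comment> \<open>The axis of the second trapezoid is at \<open>wd k i / 2\<close>; its
      reflection \<open>- wd k i / 2\<close> belongs to the preceding period, hence the index
      \<open>- j - 1\<close>.\<close>
    have e: "- x - of_int (- j - 1) * wd k i - wd k i / 2 = - (x - of_int j * wd k i - wd k i / 2)"
      by (simp add: algebra_simps)
    have "\<bar>- x - of_int (- j - 1) * wd k i - wd k i / 2\<bar> \<le> rr (nb k i) (n - i) t"
      unfolding e abs_minus_cancel using 2 rr_nb[OF assms(1), of t] unfolding abs_le_iff by linarith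
    then have "phi k i (Complex (- x) t) = pt (nb k i) (n - i) (- (x - of_int j * wd k i - wd k i / 2)) t"
      using phi_second[OF assms(1) t, of "- x" "- j - 1"] unfolding e by simp
    then show ?thesis using 2 z flip_pt by simp
  qed
qed

text \<open>The midpoint of a bottom that is not a single vertex is a regular point on the cut.
  Shears fix it, and the strip coordinates continue down to it, so it is an anchor for determining a
  shear.\<close>

lemma phi_bottom:
  assumes "redge k i" "0 < X k i"
  shows "cl k (cp k 0 (Y k i)) \<in> regular" "cl k (cp k 0 (Y k i)) \<in> bm_cut m n"
    "\<exists>e>0. \<forall>w. norm w < e \<longrightarrow> 0 < Im w \<longrightarrow> Im w < hgt k i \<and> bm_move m n (cl k (cp k 0 (Y k i))) w (phi k i w)"
proof -
  note K = redge_facts[OF assms(1)]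
  have h: "0 < hgt k i" using hgt_pos assms by simp
  have P: "cp k 0 (Y k i) \<in> bm_polygon m n k"
    using trap_polygon[OF assms(1), of 0 0] assms(2) h by simp
  have nv: "cp k 0 (Y k i) \<notin> bm_verts m n k"
  proof
    assume "cp k 0 (Y k i) \<in> bm_verts m n k"
    then obtain j where j: "0 < j" "j \<le> n" "X k j = 0" "Y k i = Y k j" by (auto simp: verts_iff)
    have "vert k i \<in> bm_polygon m n k" unfolding bm_polygon_def by (intro hull_inc vert_in_verts)
    then have "\<bar>X k i\<bar> \<le> X k j" using polygon_width_vertex[OF K(1) j(1,2), of "X k i"] j(4)
        by (simp add: vert_cp)
    then show False using j assms by simp
  qed
  show reg: "cl k (cp k 0 (Y k i)) \<in> regular" using regularI K P nv by blast
  have self: "(k, cp k 0 (Y k i)) \<in> cl k (cp k 0 (Y k i))" using cl_self K P by blast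
  show "cl k (cp k 0 (Y k i)) \<in> bm_cut m n" unfolding cut_iff
    using reg self K by (metis DiffD1 less_imp_le)
  obtain e1 where e1: "e1 > 0" "\<And>w. norm w < e1 \<Longrightarrow> 0 < X k i + (- 1) * Re w + ct i * Im w"
    using affine_pos_nbhd[OF assms(2), of "- 1" "ct i"] by blast
  obtain e2 where e2: "e2 > 0" "\<And>w. norm w < e2 \<Longrightarrow> 0 < X k i + 1 * Re w + ct i * Im w"
    using affine_pos_nbhd[OF assms(2), of "1" "ct i"] by blast
  obtain e3 where e3: "e3 > 0" "\<And>w. norm w < e3 \<Longrightarrow> 0 < hgt k i + 0 * Re w + (- 1) * Im w"
    using affine_pos_nbhd[OF h, of 0 "- 1"] by blast
  show "\<exists>e>0. \<forall>w. norm w < e \<longrightarrow> 0 < Im w \<longrightarrow> Im w < hgt k i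
      \<and> bm_move m n (cl k (cp k 0 (Y k i))) w (phi k i w)"
  proof (intro exI[of _ "min e1 (min e2 e3)"] allI impI conjI)
    show "0 < min e1 (min e2 e3)" using e1 e2 e3 by simp
    fix w :: complex assume "norm w < min e1 (min e2 e3)" and w0: "0 < Im w"
    then have w: "norm w < e1" "norm w < e2" "norm w < e3" by auto
    show h': "Im w < hgt k i" using e3(2)[OF w(3)] by simp
    have a: "\<bar>Re w\<bar> \<le> rr k i (Im w)" using e1(2)[OF w(1)] e2(2)[OF w(2)] by (simp add: rr_def abs_le_iff)
    then have f: "phi k i w = pt k i (Re w) (Im w)" using phi_first[OF assms(1) w0 h', of "Re w" 0] by simp
    show "bm_move m n (cl k (cp k 0 (Y k i))) w (phi k i w)"
    proof (rule moveI[OF _ _ self])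
      show "(k, cp k 0 (Y k i) + w) \<in> phi k i w"
        unfolding f using pt_mem[OF assms(1) w0 h' a] by (simp add: cp_add)
      show "phi k i w \<in> bm_surface m n" using phi_regular[OF assms(1) w0 h', of "Re w"] by simp
    qed (use reg in blast)
  qed
qed

section \<open>The shear in strip coordinates\<close>

definition sh :: "real \<Rightarrow> complex \<Rightarrow> complex" where "sh M w = Complex (Re w + M * Im w) (Im w)"

lemma sh_add: "sh M (z + w) = sh M z + sh M w"
  by (simp add: sh_def complex_eq_iff algebra_simps)

lemma Im_sh [simp]: "Im (sh M w) = Im w"
  by (simp add: sh_def)

lemma norm_sh: "norm (sh M w) \<le> (1 + \<bar>M\<bar>) * norm w"
proof -
  have "sh M w = w + of_real (M * Im w)" by (simp add: sh_def complex_eq_iff)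
  then have "norm (sh M w) \<le> norm w + norm (of_real (M * Im w) :: complex)" by (metis norm_triangle_ineq)
  also have "norm (of_real (M * Im w) :: complex) = \<bar>M\<bar> * \<bar>Im w\<bar>" by (simp only: norm_of_real abs_mult)
  also have "\<dots> \<le> \<bar>M\<bar> * norm w" by (intro mult_left_mono abs_Im_le_cmod) auto
  finally show ?thesis by (simp add: algebra_simps)
qed

context
  fixes M f assumes shear: "bm_shear m n M f"
begin

lemma shear_facts:
  "f ` bm_surface m n = bm_surface m n" "inj_on f (bm_surface m n)" "f ` bm_singular m n = bm_singular m n"
  "\<And>p. p \<in> bm_cut m n \<Longrightarrow> f p = p"
  "\<And>p. p \<in> regular \<Longrightarrow> \<exists>e>0. \<forall>w q. norm w < e \<longrightarrow> bm_move m n p w q \<longrightarrow> bm_move m n (f p) (sh M w) (f q)"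
proof -
  have h: "homeomorphic_map (bm_topology m n) (bm_topology m n) f"
    using shear by (simp add: bm_shear_def bm_affine_aut_def)
  show "f ` bm_surface m n = bm_surface m n" "inj_on f (bm_surface m n)"
    using homeomorphic_imp_surjective_map[OF h] homeomorphic_imp_injective_map[OF h] by simp_all
  show "f ` bm_singular m n = bm_singular m n" "\<And>p. p \<in> bm_cut m n \<Longrightarrow> f p = p"
    using shear by (auto simp: bm_shear_def bm_affine_aut_def)
  show "\<exists>e>0. \<forall>w q. norm w < e \<longrightarrow> bm_move m n p w q \<longrightarrow> bm_move m n (f p) (sh M w) (f q)"
      if "p \<in> regular" for p
  proof -
    have "\<forall>p\<in>regular. \<exists>e>0. \<forall>w q. norm w < e \<and> bm_move m n p w q \<longrightarrow>
        bm_move m n (f p) (Complex (Re w + M * Im w) (Im w)) (f q)"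
      using shear unfolding bm_shear_def bm_affine_aut_def by (elim conjE)
    from bspec[OF this that] show ?thesis by (simp only: sh_def imp_conjL)
  qed
qed

lemma shear_regular: "p \<in> regular \<Longrightarrow> f p \<in> regular"
proof -
  assume p: "p \<in> regular"
  have "f p \<notin> bm_singular m n"
  proof
    assume "f p \<in> bm_singular m n"
    then obtain q where q: "q \<in> bm_singular m n" "f p = f q" using shear_facts(3) by (metis imageE)
    then have "q \<in> bm_surface m n" by (simp add: bm_singular_def)
    then have "p = q" using inj_onD[OF shear_facts(2) q(2)] p by blast
    then show False using p q by blast
  qed
  then show ?thesis using p shear_facts(1) by blast
qed

text \<open>Both sides are locally affine with the same derivative, so they agree on the whole strip once
  they agree at one point; such a point is found next to the fixed bottom of the cylinder.\<close>

lemma shear_phi_aux: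
  assumes "redge k i" "0 < X k i" "0 < Im z" "Im z < hgt k i"
  shows "f (phi k i z) = phi k i (sh M z)"
proof -
  let ?S = "{z. 0 < Im z \<and> Im z < hgt k i}"
  have S: "?S = {z. 0 < Im z} \<inter> {z. Im z < hgt k i}" by auto
  have oS: "open ?S" unfolding S by (intro open_Int open_halfspace_Im_gt open_halfspace_Im_lt)
  have cS: "connected ?S" unfolding S
    by (intro convex_connected convex_Int convex_halfspace_Im_gt convex_halfspace_Im_lt)
  have shb: "norm (sh M w) < e" if "norm w < e / (1 + \<bar>M\<bar>)" for w e
  proof -
    have "(1 + \<bar>M\<bar>) * norm w < e" using that by (simp add: field_simps)
    then show ?thesis using norm_sh[of M w] by linarith
  qed
  have sp: "0 < e / (1 + \<bar>M\<bar>)" if "0 < e" for e :: real using that by simp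
  have reg: "phi k i z \<in> regular" if "z \<in> ?S" for z
      using phi_regular[OF assms(1), of "Im z" "Re z"] that by simp
  obtain a where a: "a \<in> ?S" "f (phi k i a) = phi k i (sh M a)"
  proof -
    define p where "p = cl k (cp k 0 (Y k i))"
    note B = phi_bottom[OF assms(1,2), folded p_def]
    obtain e1 where e1: "e1 > 0" "\<And>w. norm w < e1 \<Longrightarrow> 0 < Im w \<Longrightarrow> Im w < hgt k i \<and> bm_move m n p w (phi k i w)"
      using B(3) by blast
    obtain e2 where e2: "e2 > 0" "\<And>w q. norm w < e2 \<Longrightarrow> bm_move m n p w q \<Longrightarrow> bm_move m n p (sh M w) (f q)"
      using shear_facts(5)[OF B(1)] shear_facts(4)[OF B(2)] by metis
    obtain e3 where e3: "e3 > 0" "\<And>w. norm w < e3 \<Longrightarrow> (\<exists>q\<in>regular. bm_move m n p w q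
        \<and> (\<forall>q'. bm_move m n p w q' \<longrightarrow> q' = q))"
      using regular_nbhd[OF B(1)] by meson
    define d where "d = Min {e1, e2, e1 / (1 + \<bar>M\<bar>), e3 / (1 + \<bar>M\<bar>)}"
    have "0 < d" using e1(1) e2(1) sp[OF e1(1)] sp[OF e3(1)] by (simp add: d_def)
    moreover have "d \<le> e1" "d \<le> e2" "d \<le> e1 / (1 + \<bar>M\<bar>)" "d \<le> e3 / (1 + \<bar>M\<bar>)"
      unfolding d_def by (rule Min_le; simp)+
    ultimately have d: "0 < d" "d \<le> e1" "d \<le> e2" "d \<le> e1 / (1 + \<bar>M\<bar>)" "d \<le> e3 / (1 + \<bar>M\<bar>)" by auto
    \<comment> \<open>A point straight above the fixed point \<open>p\<close>. Its image and the
      candidate are both translates of \<open>p\<close> by \<open>sh M w\<close>, hence equal. Radii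
      that must also bound \<open>sh M w\<close> are divided by \<open>1 + \<bar>M\<bar>\<close>,
      following \<open>norm_sh\<close>.\<close>
    define w where "w = Complex 0 (d / 2)"
    have nw: "norm w = d / 2" using d(1) by (simp add: w_def cmod_def)
    have w: "norm w < e1" "norm w < e2" "norm (sh M w) < e1" "norm (sh M w) < e3" "0 < Im w"
      using d nw by (auto intro!: shb simp: w_def)
    have "bm_move m n p w (phi k i w)" "Im w < hgt k i" using e1(2)[OF w(1,5)] by auto
    then have "bm_move m n p (sh M w) (f (phi k i w))" using e2(2) w by blast
    moreover have "bm_move m n p (sh M w) (phi k i (sh M w))" using e1(2)[OF w(3)] w by simp
    ultimately have "f (phi k i w) = phi k i (sh M w)" using e3(2)[OF w(4)] by metis
    then show ?thesis using that[of w] w \<open>Im w < hgt k i\<close> by simp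
  qed
  have "f (phi k i z) = phi k i (sh M z)"
  proof (rule connected_induction_simple[where P = "\<lambda>z. f (phi k i z)
      = phi k i (sh M z)", OF cS a(1) _ a(2)])
    show "z \<in> ?S" using assms by simp
    fix b assume b: "b \<in> ?S"
    then have sb: "sh M b \<in> ?S" by simp
    have b': "0 < Im b" "Im b < hgt k i" "0 < Im (sh M b)" "Im (sh M b) < hgt k i" using b by auto
    note R = reg[OF b] shear_regular[OF reg[OF b]] reg[OF sb]
    obtain e1 where e1: "e1 > 0" "\<And>w. norm w < e1 \<Longrightarrow> 0 < Im (b + w) \<and> Im (b + w) < hgt k i
        \<and> bm_move m n (phi k i b) w (phi k i (b + w))"
      using phi_move[OF assms(1) b'(1,2)] by blast
    obtain e2 where e2: "e2 > 0" "\<And>w q. norm w < e2 \<Longrightarrow> bm_move m n (phi k i b) w q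
        \<Longrightarrow> bm_move m n (f (phi k i b)) (sh M w) (f q)"
      using shear_facts(5)[OF R(1)] by metis
    obtain e3 where e3: "e3 > 0" "\<And>w. norm w < e3 \<Longrightarrow> bm_move m n (phi k i (sh M b)) w (phi k i (sh M b + w))"
      using phi_move[OF assms(1) b'(3,4)] by blast
    obtain e4 where e4: "e4 > 0" "\<And>w. norm w < e4 \<Longrightarrow> (\<exists>q\<in>regular. bm_move m n (phi k i (sh M b)) w q
        \<and> (\<forall>q'. bm_move m n (phi k i (sh M b)) w q' \<longrightarrow> q' = q) \<and> (\<forall>p'. bm_move m n p' w q \<longrightarrow> p'
        = phi k i (sh M b)))"
      using regular_nbhd[OF R(3)] by meson
    define d where "d = Min {e1, e2, e3 / (1 + \<bar>M\<bar>), e4 / (1 + \<bar>M\<bar>)}"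
    have "0 < d" using e1(1) e2(1) sp[OF e3(1)] sp[OF e4(1)] by (simp add: d_def)
    moreover have "d \<le> e1" "d \<le> e2" "d \<le> e3 / (1 + \<bar>M\<bar>)" "d \<le> e4 / (1 + \<bar>M\<bar>)"
      unfolding d_def by (rule Min_le; simp)+
    ultimately have d: "0 < d" "d \<le> e1" "d \<le> e2" "d \<le> e3 / (1 + \<bar>M\<bar>)" "d \<le> e4 / (1 + \<bar>M\<bar>)" by auto
    \<comment> \<open>Uniqueness of translates in both directions makes agreement at
      \<open>b + w\<close> equivalent to agreement at \<open>b\<close>, without knowing either; this
      is local constancy of agreement.\<close>
    have iff: "f (phi k i (b + w)) = phi k i (sh M (b + w)) \<longleftrightarrow> f (phi k i b) = phi k i (sh M b)"
        if "norm w < d" for w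
    proof -
      have w: "norm w < e1" "norm w < e2" "norm (sh M w) < e3" "norm (sh M w) < e4"
        using d that by (auto intro!: shb)
      have m1: "bm_move m n (f (phi k i b)) (sh M w) (f (phi k i (b + w)))"
          using e1(2)[OF w(1)] e2(2)[OF w(2)] by blast
      have m2: "bm_move m n (phi k i (sh M b)) (sh M w) (phi k i (sh M (b + w)))"
          using e3(2)[OF w(3)] by (simp add: sh_add)
      obtain q where q: "\<And>q'. bm_move m n (phi k i (sh M b)) (sh M w) q' \<Longrightarrow> q' = q"
        "\<And>p'. bm_move m n p' (sh M w) q \<Longrightarrow> p' = phi k i (sh M b)" using e4(2)[OF w(4)] by blast
      show ?thesis using m1 m2 q by metis
    qed
    show "\<exists>T. openin (top_of_set ?S) T \<and> b \<in> T \<and> (\<forall>x\<in>T. \<forall>y\<in>T. f (phi k i x) = phi k i (sh M x)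
        \<longrightarrow> f (phi k i y) = phi k i (sh M y))"
    proof (intro exI[of _ "ball b d \<inter> ?S"] conjI ballI impI)
      show "openin (top_of_set ?S) (ball b d \<inter> ?S)" by (simp add: openin_open Int_commute) (metis open_ball)
      show "b \<in> ball b d \<inter> ?S" using b d by simp
      fix x y assume x: "x \<in> ball b d \<inter> ?S" and y: "y \<in> ball b d \<inter> ?S" and e: "f (phi k i x)
          = phi k i (sh M x)"
      have "norm (x - b) < d" "norm (y - b) < d" using x y by (auto simp: dist_norm norm_minus_commute)
      then show "f (phi k i y) = phi k i (sh M y)" using iff[of "x - b"] iff[of "y - b"] e by simp
    qed
  qed
  then show ?thesis .
qed

text \<open>If the bottom of this trapezoid is a point, that of its partner is not, because the two
  widths add up to the positive circumference. So one of the two bases always has an anchor.\<close>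

lemma shear_phi:
  assumes "redge k i" "0 < Im z" "Im z < hgt k i"
  shows "f (phi k i z) = phi k i (sh M z)"
proof (cases "0 < X k i")
  case True
  then show ?thesis using shear_phi_aux assms by blast
next
  case False
  note R = redge_nb[OF assms(1)]
  have "0 < wd k i" using rr_bounds[OF assms] by simp
  then have X': "0 < X (nb k i) (n - i)" using False by (simp add: wd_def)
  have h: "Im z < hgt (nb k i) (n - i)" using R assms by simp
  have sft: "phi (nb k i) (n - i) (y - of_real (wd k i / 2)) = phi k i y"
      if "0 < Im y" "Im y < hgt k i" for y
  proof -
    have "y - of_real (wd k i / 2) = Complex (Re y - wd k i / 2) (Im y)" by (simp add: complex_eq_iff)
    then show ?thesis using phi_shift[OF assms(1) that, of "Re y"] by simp
  qed
  have "f (phi k i z) = f (phi (nb k i) (n - i) (z - of_real (wd k i / 2)))"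
      using sft[OF assms(2,3)] by simp
  also have "\<dots> = phi (nb k i) (n - i) (sh M (z - of_real (wd k i / 2)))"
    using assms h by (intro shear_phi_aux R(1) X') auto
  also have "sh M (z - of_real (wd k i / 2)) = sh M z - of_real (wd k i / 2)"
      by (simp add: sh_def complex_eq_iff)
  also have "phi (nb k i) (n - i) \<dots> = phi k i (sh M z)" using sft[of "sh M z"] assms by simp
  finally show ?thesis .
qed

end

section \<open>Letters, points on edges, and the preimages of edges under the flip-shear\<close>

lemma letters_iff: "l \<in> bm_letters m n \<longleftrightarrow> (\<exists>k i. (k, i) \<in> bm_edges m n \<and> l = {(k, i), (nb k i, opp i)})"
  by (auto simp: bm_letters_def glued_iff)

lemma letter_eqI:
  assumes "l \<in> bm_letters m n" "l' \<in> bm_letters m n" "e \<in> l" "e \<in> l'" shows "l = l'"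
proof -
  have *: "l = {e, (nb (fst e) (snd e), opp (snd e))}" if le: "l \<in> bm_letters m n" "e \<in> l" for l
  proof -
    obtain k i where ki: "(k, i) \<in> bm_edges m n" "l = {(k, i), (nb k i, opp i)}" using le(1)
        unfolding letters_iff by blast
    then have "opp (opp i) = i" "nb (nb k i) (opp i) = k" using nb_edge opp_opp by (auto simp: mem_edges)
    then show ?thesis using ki le(2) by auto
  qed
  show ?thesis using *[OF assms(1,3)] *[OF assms(2,4)] by simp
qed

lemma letter_edges: "l \<in> bm_letters m n \<Longrightarrow> (k, i) \<in> l \<Longrightarrow> (k, i) \<in> bm_edges m n \<and> l
    = {(k, i), (nb k i, opp i)}"
proof -
  assume l: "l \<in> bm_letters m n" "(k, i) \<in> l"
  then have e: "(k, i) \<in> bm_edges m n" using nb_edge by (auto simp: letters_iff)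
  then have "{(k, i), (nb k i, opp i)} \<in> bm_letters m n" by (auto simp: letters_iff)
  then show ?thesis using letter_eqI[OF l(1) _ l(2)] e by auto
qed

lemma on_edge_rep:
  assumes "p \<in> regular" "l \<in> bm_letters m n" "bm_on_edge m n l p" "(k, z) \<in> p"
  obtains i where "(k, i) \<in> l" "z \<in> bm_edge m n k i"
proof -
  obtain k1 i1 z1 where 1: "(k1, i1) \<in> l" "z1 \<in> bm_edge m n k1 i1" "(k1, z1) \<in> p"
    using assms(3) by (auto simp: bm_on_edge_def)
  have e: "(k1, i1) \<in> bm_edges m n" "l = {(k1, i1), (nb k1 i1, opp i1)}"
      using letter_edges[OF assms(2) 1(1)] by auto
  have "p = cl k1 z1" "z1 \<notin> bm_verts m n k1" using regular_rep[OF assms(1) 1(3)] by auto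
  then have "p = {(k1, z1), (nb k1 i1, z1 + trn k1 i1)}" using cl_edge[OF e(1) 1(2)] by simp
  then consider "k = k1" "z = z1" | "k = nb k1 i1" "z = z1 + trn k1 i1" using assms(4) by auto
  then show ?thesis
  proof cases
    case 1: 1
    then show ?thesis using that[of i1] \<open>(k1, i1) \<in> l\<close> \<open>z1 \<in> bm_edge m n k1 i1\<close> by simp
  next
    case 2
    then show ?thesis using that[of "opp i1"] e edge_trn[OF e(1)] \<open>z1 \<in> bm_edge m n k1 i1\<close> by simp
  qed
qed

lemma edge_unique:
  assumes "(k, i) \<in> bm_edges m n" "(k, j) \<in> bm_edges m n" "z \<in> bm_edge m n k i" "z \<in> bm_edge m n k j"
      "z \<notin> bm_verts m n k"
  shows "i = j"
proof (rule ccontr)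
  assume "i \<noteq> j"
  then have "0 < dd k j z" using edge_other_dd_pos[of k z i j] assms by (auto simp: mem_edges)
  then show False using edge_iff[of k z j] assms by (auto simp: mem_edges)
qed

lemma on_edge_unique:
  assumes "p \<in> regular" "l \<in> bm_letters m n" "bm_on_edge m n l p" "l' \<in> bm_letters m n"
      "bm_on_edge m n l' p"
  shows "l = l'"
proof -
  obtain k z where kz: "(k, z) \<in> p" "z \<notin> bm_verts m n k" using regular_obtain[OF assms(1)] by blast
  obtain i where i: "(k, i) \<in> l" "z \<in> bm_edge m n k i" by (rule on_edge_rep[OF assms(1-3) kz(1)])
  obtain j where j: "(k, j) \<in> l'" "z \<in> bm_edge m n k j" by (rule on_edge_rep[OF assms(1,4,5) kz(1)])
  have "i = j" using edge_unique[of k i j z] i j kz(2) letter_edges assms by blast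
  then show ?thesis using letter_eqI assms i j by blast
qed

lemma on_edgeI:
  assumes "(k, i) \<in> l" "z \<in> bm_edge m n k i" "(k, z) \<in> p" shows "bm_on_edge m n l p"
  using assms by (auto simp: bm_on_edge_def)

lemma vec_Im: "(k, i) \<in> bm_edges m n \<Longrightarrow> Im (bm_vec m n k i) = 0 \<longleftrightarrow> i = 0 \<or> i = n"
  using sin_mult_al_eq_0[of i] by (cases "i = 0") (auto simp: bm_vec_eq mem_edges n_al)

lemma gluing_letter_iff:
  assumes "l \<in> bm_letters m n"
  shows "bm_gluing_letter m n l \<longleftrightarrow> (\<exists>k i. redge k i \<and> l = {(k, i), (nb k i, opp i)})"
proof -
  obtain k i where ki: "(k, i) \<in> bm_edges m n" "l = {(k, i), (nb k i, opp i)}" using assms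
      by (auto simp: letters_iff)
  have i2: "i < 2 * n" using ki by (simp add: mem_edges)
  have ki': "(nb k i, opp i) \<in> bm_edges m n" using nb_edge ki by blast
  have ho: "opp i = 0 \<or> opp i = n \<longleftrightarrow> i = 0 \<or> i = n" using i2 by (auto simp: opp_cases)
  have "bm_horizontal_letter m n l \<longleftrightarrow> i = 0 \<or> i = n"
    unfolding bm_horizontal_letter_def ki(2) using vec_Im[OF ki(1)] vec_Im[OF ki'] ho by auto
  then have g: "bm_gluing_letter m n l \<longleftrightarrow> i \<noteq> 0 \<and> i \<noteq> n" by (simp add: bm_gluing_letter_def)
  show ?thesis
  proof
    assume "bm_gluing_letter m n l"
    then have "i \<noteq> 0" "i \<noteq> n" using g by auto
    then consider "0 < i" "i < n" | "n < i" by linarith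
    then show "\<exists>k i. redge k i \<and> l = {(k, i), (nb k i, opp i)}"
    proof cases
      case 1
      then show ?thesis using ki by (auto simp: redge_def)
    next
      case 2
      have "redge (nb k i) (opp i)" using ki' 2 i2 by (auto simp: redge_def opp_cases)
      moreover have "l = {(nb k i, opp i), (nb (nb k i) (opp i), opp (opp i))}"
        using letter_edges[OF assms, of "nb k i" "opp i"] ki(2) by blast
      ultimately show ?thesis by blast
    qed
  next
    assume "\<exists>k i. redge k i \<and> l = {(k, i), (nb k i, opp i)}"
    then obtain k1 i1 where r: "redge k1 i1" "(k1, i1) \<in> l" by blast
    have "k1 = k \<and> i1 = i \<or> i1 = opp i" using r ki(2) by auto
    then show "bm_gluing_letter m n l" using g r(1) ho by (auto simp: redge_def)
  qed
qed

lemma horizontal_letter_iff: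
  assumes "l \<in> bm_letters m n" "(k, i) \<in> l"
  shows "bm_horizontal_letter m n l \<longleftrightarrow> i = 0 \<or> i = n"
proof -
  have ki: "(k, i) \<in> bm_edges m n" "l = {(k, i), (nb k i, opp i)}" using letter_edges[OF assms] by auto
  have i2: "i < 2 * n" using ki by (simp add: mem_edges)
  have ki': "(nb k i, opp i) \<in> bm_edges m n" using nb_edge ki by blast
  have ho: "opp i = 0 \<or> opp i = n \<longleftrightarrow> i = 0 \<or> i = n" using i2 by (auto simp: opp_cases)
  show ?thesis
    unfolding bm_horizontal_letter_def ki(2) using vec_Im[OF ki(1)] vec_Im[OF ki'] ho by auto
qed

lemma on_gluing_edge_iff:
  assumes "redge k i" "p \<in> regular"
  shows "bm_on_edge m n {(k, i), (nb k i, opp i)} p \<longleftrightarrow> (\<exists>t. 0 < t \<and> t < hgt k i \<and> p = pt k i (rr k i t) t)"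
proof
  have l: "{(k, i), (nb k i, opp i)} \<in> bm_letters m n" using assms by (auto simp: letters_iff redge_def)
  assume o: "bm_on_edge m n {(k, i), (nb k i, opp i)} p"
  obtain k1 i1 z1 where 1: "(k1, i1) \<in> {(k, i), (nb k i, opp i)}" "z1 \<in> bm_edge m n k1 i1" "(k1, z1) \<in> p"
    using o unfolding bm_on_edge_def by blast
  have e: "(k1, i1) \<in> bm_edges m n" "{(k, i), (nb k i, opp i)} = {(k1, i1), (nb k1 i1, opp i1)}"
      using letter_edges[OF l 1(1)] by auto
  have z1: "p = cl k1 z1" "z1 \<notin> bm_verts m n k1" using regular_rep[OF assms(2) 1(3)] by auto
  have p2: "p = {(k1, z1), (nb k1 i1, z1 + trn k1 i1)}" using cl_edge[OF e(1) 1(2)] z1 by simp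
  have "\<exists>z. (k, z) \<in> p \<and> z \<in> bm_edge m n k i"
  proof (cases "(k1, i1) = (k, i)")
    case True
    then show ?thesis using 1 by auto
  next
    case False
    then have "nb k1 i1 = k" "opp i1 = i" using e(2) by (auto simp: doubleton_eq_iff)
    then show ?thesis using p2 edge_trn[OF e(1) 1(2)] by auto
  qed
  then obtain z where z: "(k, z) \<in> p" "z \<in> bm_edge m n k i" by blast
  then obtain t where t: "0 \<le> t" "t \<le> hgt k i" "z = cp k (rr k i t) (Y k i + t)"
      using right_edge_iff[OF assms(1)] by blast
  have nv: "z \<notin> bm_verts m n k" "p = cl k z" using regular_rep[OF assms(2) z(1)] by auto
  have "t \<noteq> 0" using nv t vert_cp[of k i] vert_in_verts[of k i] by auto
  moreover have "t \<noteq> hgt k i" using nv t vert_cp[of k "Suc i"] vert_in_verts[of k "Suc i"] rr_hgt[of i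
      k] redge_facts[OF assms(1)]
    by (auto simp: Y_hgt)
  ultimately show "\<exists>t. 0 < t \<and> t < hgt k i \<and> p = pt k i (rr k i t) t" using t nv(2)
      by (intro exI[of _ t]) (auto simp: pt_def)
next
  assume "\<exists>t. 0 < t \<and> t < hgt k i \<and> p = pt k i (rr k i t) t"
  then obtain t where t: "0 < t" "t < hgt k i" "p = pt k i (rr k i t) t" by blast
  have "(k, cp k (rr k i t) (Y k i + t)) \<in> p" using pt_right[OF assms(1) t(1,2)] t(3) by simp
  then show "bm_on_edge m n {(k, i), (nb k i, opp i)} p"
    using right_edge[OF assms(1), of t] t by (intro on_edgeI[of k i]) auto
qed

lemma horizontal_edge_cut:
  assumes "l \<in> bm_letters m n" "bm_horizontal_letter m n l" "bm_on_edge m n l p" "p \<in> bm_surface m n"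
  shows "p \<in> bm_cut m n"
proof -
  obtain k i z where k: "(k, i) \<in> l" "z \<in> bm_edge m n k i" "(k, z) \<in> p" using assms(3)
      by (auto simp: bm_on_edge_def)
  have i: "i = 0 \<or> i = n" using horizontal_letter_iff[OF assms(1) k(1)] assms(2) by simp
  have "Im (vert k i) = Im (vert k (i + 1))" using i by (auto simp: vert_Suc n_al)
  moreover have "i < 2 * n" "i + 1 < 2 * n" using i n_ge by auto
  ultimately show ?thesis unfolding bm_cut_def using assms(4) k(2,3) unfolding bm_edge_def by blast
qed

lemma flip_horizontal:
  assumes "l \<in> bm_letters m n" "bm_horizontal_letter m n l" "bm_on_edge m n l p" "p \<in> bm_surface m n"
  shows "bm_on_edge m n l (bm_flip m n p)"
proof -
  obtain k i z where k: "(k, i) \<in> l" "z \<in> bm_edge m n k i" "(k, z) \<in> p" using assms(3)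
      by (auto simp: bm_on_edge_def)
  have i: "i = 0 \<or> i = n" using horizontal_letter_iff[OF assms(1) k(1)] assms(2) by simp
  then have r: "refl_edge i = i" using n_ge by (auto simp: refl_edge_def)
  have km: "k < m" "i < 2 * n" using letter_edges[OF assms(1) k(1)] by (auto simp: mem_edges)
  have "mirror k z \<in> bm_edge m n k i" using mirror_edge[OF km k(2)] r by simp
  moreover have "(k, mirror k z) \<in> bm_flip m n p" using k(3) by (force simp: flip_eq)
  ultimately show ?thesis using k(1) by (intro on_edgeI)
qed

text \<open>Horizontal edges are invariant under the flip and lie in the cut, which the shear fixes
  pointwise. Conversely, if the image of a point lies in the cut, it is itself fixed, and
  injectivity identifies it with the point.\<close>

lemma derived_horizontal:
  assumes "bm_shear m n M f" "l \<in> bm_letters m n" "bm_horizontal_letter m n l" "p \<in> bm_surface m n"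
  shows "bm_on_edge m n l (f (bm_flip m n p)) \<longleftrightarrow> bm_on_edge m n l p"
proof
  note F = shear_facts[OF assms(1)]
  have q: "bm_flip m n p \<in> bm_surface m n" using flip_surface assms by simp
  have fq: "f (bm_flip m n p) \<in> bm_surface m n" using F(1) q by blast
  {
    assume o: "bm_on_edge m n l (f (bm_flip m n p))"
    then have "f (bm_flip m n p) \<in> bm_cut m n" using horizontal_edge_cut assms fq by blast
    then have "f (f (bm_flip m n p)) = f (bm_flip m n p)" using F(4) by blast
    then have "f (bm_flip m n p) = bm_flip m n p" using inj_onD[OF F(2)] fq q by blast
    then have "bm_on_edge m n l (bm_flip m n p)" using o by simp
    then show "bm_on_edge m n l p" using flip_horizontal[OF assms(2,3) _ q] by (simp add: flip_flip)
  }
  assume "bm_on_edge m n l p"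
  then have o: "bm_on_edge m n l (bm_flip m n p)" using flip_horizontal assms by blast
  then have "bm_flip m n p \<in> bm_cut m n" using horizontal_edge_cut assms q by blast
  then show "bm_on_edge m n l (f (bm_flip m n p))" using F(4) o by simp
qed

text \<open>In the strip the flip is \<open>x \<mapsto> - x\<close> and the shear
  \<open>x \<mapsto> x + M * t\<close>, so the right edge \<open>x = rr k i t\<close> is reached
  exactly from \<open>x = M * t - rr k i t\<close>. The converse uses that both maps are
  injective.\<close>

lemma derived_gluing:
  assumes "bm_shear m n M f" "redge k i" "p \<in> regular"
  shows "bm_on_edge m n {(k, i), (nb k i, opp i)} (f (bm_flip m n p)) \<longleftrightarrow>
    (\<exists>t. 0 < t \<and> t < hgt k i \<and> p = phi k i (Complex (M * t - rr k i t) t))"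
proof -
  note F = shear_facts[OF assms(1)]
  have r: "f (bm_flip m n p) \<in> regular" using shear_regular[OF assms(1)] flip_regular assms(3) by blast
  have e: "f (bm_flip m n (phi k i (Complex (M * t - rr k i t) t))) = pt k i (rr k i t) t"
      if t: "0 < t" "t < hgt k i" for t
  proof -
    have "- cnj (Complex (M * t - rr k i t) t) = Complex (rr k i t - M * t) t" by (simp add: complex_eq_iff)
    then have "bm_flip m n (phi k i (Complex (M * t - rr k i t) t))
        = phi k i (Complex (rr k i t - M * t) t)"
      using flip_phi[OF assms(2), of "Complex (M * t - rr k i t) t"] t by simp
    moreover have "f (phi k i (Complex (rr k i t - M * t) t)) = phi k i (Complex (rr k i t) t)"
      using shear_phi[OF assms(1,2), of "Complex (rr k i t - M * t) t"] t by (simp add: sh_def)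
    ultimately show ?thesis using phi_first[OF assms(2) t, of "rr k i t" 0] rr_pos[OF assms(2) t] by simp
  qed
  have "p = phi k i (Complex (M * t - rr k i t) t) \<longleftrightarrow> f (bm_flip m n p) = pt k i (rr k i t) t"
      if t: "0 < t" "t < hgt k i" for t
  proof
    let ?q = "phi k i (Complex (M * t - rr k i t) t)"
    assume "f (bm_flip m n p) = pt k i (rr k i t) t"
    then have "f (bm_flip m n p) = f (bm_flip m n ?q)" using e[OF t] by simp
    moreover have "?q \<in> bm_surface m n" using phi_regular[OF assms(2) t] by blast
    ultimately have "bm_flip m n p = bm_flip m n ?q"
      using inj_onD[OF F(2)] flip_surface assms(3) by blast
    then show "p = ?q" by (metis flip_flip)
  qed (use e[OF t] in simp)
  then show ?thesis unfolding on_gluing_edge_iff[OF assms(2) r] by blast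
qed

section \<open>Trajectories\<close>

definition onany :: "bm_point \<Rightarrow> bool" where
  "onany p \<longleftrightarrow> (\<exists>l\<in>bm_letters m n. bm_on_edge m n l p)"

text \<open>Straight paths with an arbitrary velocity: the derived trajectory need not be
  parametrised by arc length, so \<open>bm_trajectory\<close> would not cover it.\<close>

definition lin :: "complex \<Rightarrow> (real \<Rightarrow> bm_point) \<Rightarrow> bool" where
  "lin v \<delta> \<longleftrightarrow> (\<forall>t. \<delta> t \<in> regular \<and>
     (\<exists>e>0. \<forall>s. \<bar>s\<bar> < e \<longrightarrow> bm_move m n (\<delta> t) (of_real s * v) (\<delta> (t + s))))"

lemma not_onany:
  assumes "p \<in> regular" "\<not> onany p"
  obtains k z where "k < m" "z \<in> inter k" "p = {(k, z)}"
proof -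
  obtain k z where kz: "k < m" "z \<in> bm_polygon m n k" "z \<notin> bm_verts m n k" "p = cl k z" "(k, z) \<in> p"
    using regular_obtain[OF assms(1)] by blast
  show ?thesis using kz(1-3)
  proof (cases rule: polygon_cases)
    case 1
    then show ?thesis using that kz cl_inter by blast
  next
    case (2 i)
    have "bm_on_edge m n {(k, i), (nb k i, opp i)} p" using on_edgeI[of k i] 2(2) kz(5) by blast
    moreover have "{(k, i), (nb k i, opp i)} \<in> bm_letters m n" using 2(1) by (auto simp: letters_iff)
    ultimately show ?thesis using assms(2) by (auto simp: onany_def)
  qed
qed

lemma inter_not_onany:
  assumes "k < m" "z \<in> inter k" shows "\<not> onany {(k, z)}"
proof
  assume "onany {(k, z)}"
  then obtain l i where "l \<in> bm_letters m n" "(k, i) \<in> l" "z \<in> bm_edge m n k i"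
    by (auto simp: onany_def bm_on_edge_def)
  then show False using letter_edges[of l k i] inter_not_edge[OF assms, of i] by (auto simp: mem_edges)
qed

lemma rep_unique:
  assumes "p \<in> regular" "(k, z) \<in> p" "(k, z') \<in> p" shows "z = z'"
proof -
  note R = regular_rep[OF assms(1,2)]
  show ?thesis using R(1,2,4)
  proof (cases rule: polygon_cases)
    case 1
    then show ?thesis using cl_inter R assms by auto
  next
    case (2 i)
    then show ?thesis using cl_edge[OF 2 R(4)] R(3) nb_edge(5)[OF 2(1)] assms(3) by auto
  qed
qed

lemma inter_line_nbhd:
  assumes "z \<in> inter k" shows "\<exists>e>0. \<forall>s::real. \<bar>s\<bar> < e \<longrightarrow> z + of_real s * v \<in> inter k"
proof -
  obtain e where e: "0 < e" "ball z e \<subseteq> inter k" using openE[OF open_inter assms] by blast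
  show ?thesis
  proof (intro exI[of _ "e / (norm v + 1)"] conjI allI impI)
    show "0 < e / (norm v + 1)" using e by (simp add: add_nonneg_pos)
    fix s :: real assume "\<bar>s\<bar> < e / (norm v + 1)"
    then have "\<bar>s\<bar> * (norm v + 1) < e" by (simp add: pos_less_divide_eq add_nonneg_pos)
    moreover have "\<bar>s\<bar> * norm v \<le> \<bar>s\<bar> * (norm v + 1)" by (intro mult_left_mono) auto
    ultimately have "norm (of_real s * v) < e" by (simp add: norm_mult)
    then have "z + of_real s * v \<in> ball z e" by (simp add: dist_norm)
    then show "z + of_real s * v \<in> inter k" using e(2) by blast
  qed
qed

lemma lin_local:
  assumes "lin v \<delta>" "\<not> onany (\<delta> t)"
  shows "\<exists>e>0. \<exists>k<m. \<exists>z. \<forall>s. \<bar>s\<bar> < e \<longrightarrow> z + of_real s * v \<in> inter k \<and> \<delta> (t + s) = {(k, z + of_real s * v)}"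
proof -
  have r: "\<delta> t \<in> regular" using assms by (simp add: lin_def)
  obtain k z where kz: "k < m" "z \<in> inter k" "\<delta> t = {(k, z)}" by (rule not_onany[OF r assms(2)])
  obtain e1 where e1: "e1 > 0" "\<And>s. \<bar>s\<bar> < e1 \<Longrightarrow> bm_move m n (\<delta> t) (of_real s * v) (\<delta> (t + s))"
    using assms by (auto simp: lin_def)
  obtain e2 where e2: "e2 > 0" "\<And>s::real. \<bar>s\<bar> < e2 \<Longrightarrow> z + of_real s * v \<in> inter k"
    using inter_line_nbhd[OF kz(2)] by blast
  have "z + of_real s * v \<in> inter k \<and> \<delta> (t + s) = {(k, z + of_real s * v)}" if "\<bar>s\<bar> < min e1 e2" for s
  proof -
    have i: "z + of_real s * v \<in> inter k" using e2 that by simp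
    have "bm_move m n (\<delta> t) (of_real s * v) (\<delta> (t + s))" using e1 that by simp
    then have "(k, z + of_real s * v) \<in> \<delta> (t + s)" "\<delta> (t + s) \<in> bm_surface m n" using kz
        by (auto simp: bm_move_def)
    then show ?thesis using surface_rep(3) cl_inter[OF kz(1) i] i by metis
  qed
  then show ?thesis using e1(1) e2(1) kz(1) by (intro exI[of _ "min e1 e2"]) auto
qed

lemma lin_not_onany_nbhd:
  assumes "lin v \<delta>" "\<not> onany (\<delta> t)"
  shows "\<exists>e>0. \<forall>s. \<bar>s - t\<bar> < e \<longrightarrow> \<not> onany (\<delta> s)"
proof -
  obtain e k z where e: "e > 0" "k < m" "\<And>s. \<bar>s\<bar> < e \<Longrightarrow> z + of_real s * v \<in> inter k \<and> \<delta> (t + s)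
      = {(k, z + of_real s * v)}"
    using lin_local[OF assms] by blast
  have "\<not> onany (\<delta> s)" if "\<bar>s - t\<bar> < e" for s
    using e(3)[OF that] inter_not_onany[OF e(2)] by simp
  then show ?thesis using e(1) by blast
qed

text \<open>Off the edges a point has a single representative. Whether the path lies on a given line
  in a given polygon is therefore locally constant in time, hence constant on a connected
  set.\<close>

lemma lin_segment:
  assumes "lin v \<delta>" "connected I" "s0 \<in> I" "\<And>s. s \<in> I \<Longrightarrow> \<not> onany (\<delta> s)"
  obtains k z where "k < m" "\<And>s. s \<in> I \<Longrightarrow> z + of_real (s - s0) * v \<in> inter k"
    "\<And>s. s \<in> I \<Longrightarrow> \<delta> s = {(k, z + of_real (s - s0) * v)}"
proof -
  obtain e k z where e: "e > 0" "k < m" "\<And>s. \<bar>s\<bar> < e \<Longrightarrow> z + of_real s * v \<in> inter k \<and> \<delta> (s0 + s)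
      = {(k, z + of_real s * v)}"
    using lin_local[OF assms(1) assms(4)[OF assms(3)]] by blast
  define P where "P s \<longleftrightarrow> z + of_real (s - s0) * v \<in> inter k \<and> \<delta> s = {(k, z + of_real (s - s0) * v)}" for s
  have "P s0" using e(3)[of 0] e(1) by (simp add: P_def)
  have "P s" if "s \<in> I" for s
  proof (rule connected_induction_simple[where P = P, OF assms(2,3) that \<open>P s0\<close>])
    fix a assume a: "a \<in> I"
    obtain e1 k1 z1 where e1: "e1 > 0" "\<And>s. \<bar>s\<bar> < e1 \<Longrightarrow> z1 + of_real s * v \<in> inter k1 \<and> \<delta> (a + s)
        = {(k1, z1 + of_real s * v)}"
      using lin_local[OF assms(1) assms(4)[OF a]] by blast
    have iff: "P s \<longleftrightarrow> k1 = k \<and> z1 + of_real (s0 - a) * v = z" if "\<bar>s - a\<bar> < e1" for s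
    proof -
      have "z1 + of_real (s - a) * v \<in> inter k1" "\<delta> s = {(k1, z1 + of_real (s - a) * v)}"
          using e1(2)[OF that] by auto
      moreover have "z1 + of_real (s - a) * v = z + of_real (s - s0) * v \<longleftrightarrow> z1 + of_real (s0 - a) * v = z"
        by (auto simp: algebra_simps)
      ultimately show ?thesis by (auto simp: P_def)
    qed
    show "\<exists>T. openin (top_of_set I) T \<and> a \<in> T \<and> (\<forall>x\<in>T. \<forall>y\<in>T. P x \<longrightarrow> P y)"
    proof (intro exI[of _ "I \<inter> ball a e1"] conjI ballI impI)
      show "openin (top_of_set I) (I \<inter> ball a e1)" by (intro openin_open_Int open_ball)
      show "a \<in> I \<inter> ball a e1" using a e1(1) by simp
      fix x y assume "x \<in> I \<inter> ball a e1" "y \<in> I \<inter> ball a e1" "P x"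
      then show "P y" using iff[of x] iff[of y] by (auto simp: dist_real_def abs_minus_commute)
    qed
  qed
  then show ?thesis using that[OF e(2)] unfolding P_def by blast
qed

text \<open>At an end point the class may have a second representative. A short step back into the
  interval shows that one of them, in the same polygon, continues the line.\<close>

lemma lin_closed_segment:
  assumes "lin v \<delta>" "a < b" "\<And>s. a < s \<Longrightarrow> s < b \<Longrightarrow> \<not> onany (\<delta> s)"
  obtains k z where "k < m" "\<And>s. a < s \<Longrightarrow> s < b \<Longrightarrow> z + of_real s * v \<in> inter k"
    "\<And>s. a < s \<Longrightarrow> s < b \<Longrightarrow> \<delta> s = {(k, z + of_real s * v)}"
    "\<And>s. a \<le> s \<Longrightarrow> s \<le> b \<Longrightarrow> (k, z + of_real s * v) \<in> \<delta> s"
proof -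
  define s0 where "s0 = (a + b) / 2"
  have s0: "s0 \<in> {a<..<b}" using assms(2) by (simp add: s0_def)
  obtain k z0 where kz: "k < m" "\<And>s. s \<in> {a<..<b} \<Longrightarrow> z0 + of_real (s - s0) * v \<in> inter k"
    "\<And>s. s \<in> {a<..<b} \<Longrightarrow> \<delta> s = {(k, z0 + of_real (s - s0) * v)}"
    using lin_segment[OF assms(1) _ s0] assms(3) by (metis connected_Ioo greaterThanLessThan_iff)
  define z where "z = z0 - of_real s0 * v"
  have z: "z0 + of_real (s - s0) * v = z + of_real s * v" for s by (simp add: z_def algebra_simps)
  note kz' = kz(2,3)[unfolded z]
  have ends: "(k, z + of_real s * v) \<in> \<delta> s" if s: "s = a \<or> s = b" for s
  proof -
    obtain e where e: "e > 0" "\<And>h. \<bar>h\<bar> < e \<Longrightarrow> bm_move m n (\<delta> s) (of_real h * v) (\<delta> (s + h))"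
      using assms(1) by (auto simp: lin_def)
    define d where "d = min (e / 2) ((b - a) / 2)"
    have d: "0 < d" "d < e" "d < b - a" using e(1) assms(2) by (auto simp: d_def min_def field_simps)
    define h where "h = (if s = a then d else - d)"
    have h: "\<bar>h\<bar> < e" "s + h \<in> {a<..<b}" using s d assms(2) by (auto simp: h_def)
    obtain k1 z1 where 1: "(k1, z1) \<in> \<delta> s" "(k1, z1 + of_real h * v) \<in> \<delta> (s + h)"
        using e(2)[OF h(1)] by (auto simp: bm_move_def)
    then have "k1 = k" "z1 + of_real h * v = z + of_real (s + h) * v" using kz'(2)[OF h(2)] by auto
    then have "k1 = k" "z1 = z + of_real s * v" by (auto simp: algebra_simps)
    then show ?thesis using 1 by simp
  qed
  have closed: "(k, z + of_real s * v) \<in> \<delta> s" if "a \<le> s" "s \<le> b" for s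
  proof (cases "s = a \<or> s = b")
    case False
    then show ?thesis using kz'(2)[of s] that by simp
  qed (use ends in blast)
  show ?thesis using that[OF kz(1), of z] kz' closed by simp
qed

lemma bounded_polygon: "bounded (bm_polygon m n k)"
  unfolding bm_polygon_def bm_verts_def by (intro compact_imp_bounded compact_convex_hull
      finite_imp_compact) auto

text \<open>Without further crossings the path would follow a line inside one bounded polygon
  forever.\<close>

lemma lin_unbounded:
  assumes "lin v \<delta>" "v \<noteq> 0"
  shows "\<exists>s>B. onany (\<delta> s)" "\<exists>s<B. onany (\<delta> s)"
proof -
  have main: False if I: "connected I" "s0 \<in> I" "\<And>s. s \<in> I \<Longrightarrow> \<not> onany (\<delta> s)"
      "\<And>C. \<exists>s\<in>I. C < \<bar>s - s0\<bar>" for I s0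
  proof -
    obtain k z where kz: "k < m" "\<And>s. s \<in> I \<Longrightarrow> z + of_real (s - s0) * v \<in> inter k"
      using lin_segment[OF assms(1) I(1-3)] by metis
    obtain C where C: "\<And>x. x \<in> bm_polygon m n k \<Longrightarrow> norm x \<le> C" using bounded_polygon[of k]
        unfolding bounded_iff by blast
    obtain s where s: "s \<in> I" "(C + norm z) / norm v < \<bar>s - s0\<bar>" using I(4) by blast
    have "norm (z + of_real (s - s0) * v) \<le> C" using C kz s inter_polygon by blast
    moreover have "norm (of_real (s - s0) * v) \<le> norm (z + of_real (s - s0) * v) + norm z"
      by (metis add.commute add_diff_cancel_left' norm_triangle_ineq4)
    ultimately have "\<bar>s - s0\<bar> * norm v \<le> C + norm z" by (simp add: norm_mult del: of_real_diff)
    then show False using s(2) assms(2) by (simp add: field_simps)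
  qed
  show "\<exists>s>B. onany (\<delta> s)"
  proof (rule ccontr)
    assume "\<not> ?thesis"
    moreover have "\<exists>s\<in>{B<..}. C < \<bar>s - (B + 1)\<bar>" for C
      by (intro bexI[of _ "B + 2 + \<bar>C\<bar>"]) auto
    ultimately show False using main[of "{B<..}" "B + 1"] by (auto simp: connected_Ioi)
  qed
  show "\<exists>s<B. onany (\<delta> s)"
  proof (rule ccontr)
    assume "\<not> ?thesis"
    moreover have "\<exists>s\<in>{..<B}. C < \<bar>s - (B - 1)\<bar>" for C
      by (intro bexI[of _ "B - 2 - \<bar>C\<bar>"]) auto
    ultimately show False using main[of "{..<B}" "B - 1"] by (auto simp: connected_Iio)
  qed
qed

section \<open>Slanted edges and the bound on the angle\<close>

lemma finite_verts: "finite (bm_verts m n k)"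
  by (simp add: bm_verts_def)

text \<open>The form in which the angle hypothesis is used: the cross product of the direction with
  the slanted edge, whose components are \<open>X k i + X k (Suc i)\<close> and
  \<open>hgt k i\<close>, is positive, since the difference of the arguments lies strictly between
  \<open>0\<close> and \<open>pi\<close>.\<close>

lemma theta_slanted:
  assumes "0 \<le> \<theta>" "\<theta> < bm_theta m n"
  shows "\<And>k i. redge k i \<Longrightarrow> sin \<theta> * (X k i + X k (Suc i)) < cos \<theta> * hgt k i" "0 \<le> sin \<theta>" "0 < cos \<theta>"
proof -
  let ?S = "bm_slanted m n"
  have "?S \<subseteq> (\<Union>k<m. bm_verts m n k \<times> bm_verts m n k)" by (auto simp: bm_slanted_def)
  moreover have "finite (\<Union>k<m. bm_verts m n k \<times> bm_verts m n k)" using finite_verts by auto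
  ultimately have fin: "finite ?S" by (rule finite_subset)
  have in_S: "(cp k (- X k i) (Y k i), cp k (X k (Suc i)) (Y k (Suc i))) \<in> ?S" if r: "redge k i" for k i
  proof -
    note K = redge_facts[OF r]
    have h: "0 < hgt k i" using hgt_pos r by simp
    have vp: "v \<in> bm_polygon m n k" if "v \<in> bm_verts m n k" for v
      unfolding bm_polygon_def using that by (intro hull_inc)
    have w: "\<bar>Re v - hc k\<bar> \<le> X k j" if "v \<in> bm_verts m n k" "0 < j" "j \<le> n" "Im v = Y k j" for v j
      using polygon_width_vertex[OF K(1) that(2,3), of "Re v - hc k"] vp[OF that(1)] that(4)
          cp_collapse[of k v] by simp
    have 1: "cp k (- X k i) (Y k i) \<in> bm_verts m n k"
      unfolding verts_iff using K by (intro exI[of _ i]) auto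
    have v1: "cp k (X k (Suc i)) (Y k (Suc i)) \<in> bm_verts m n k"
      unfolding verts_iff using K by (intro exI[of _ "Suc i"]) auto
    have 2: "\<not> (Y k i < Im v \<and> Im v < Y k (Suc i))" if vv: "v \<in> bm_verts m n k" for v
    proof -
      obtain j where j: "0 < j" "j \<le> n" "Im v = Y k j" using vv by (auto simp: verts_iff)
      then show ?thesis using Y_strict_between[OF r, of "Im v - Y k i" j] by (auto simp: Y_hgt)
    qed
    have 3: "- X k i + hc k \<le> Re v" if "v \<in> bm_verts m n k" "Im v = Y k i" for v
      using w[OF that(1) _ _ that(2)] K by (simp add: abs_le_iff)
    have 4: "Re v \<le> X k (Suc i) + hc k" if "v \<in> bm_verts m n k" "Im v = Y k (Suc i)" for v
      using w[OF that(1) _ _ that(2)] K by (simp add: abs_le_iff)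
    have 5: "Y k i < Y k (Suc i)" using h by (simp add: Y_hgt)
    show ?thesis unfolding bm_slanted_def mem_Collect_eq case_prod_conv Im_cp Re_cp
      by (rule exI[of _ k]) (use K(1) 1 v1 2 3 4 5 in blast)
  qed
  have slope: "\<theta> < Arg (cp k (X k (Suc i)) (Y k (Suc i)) - cp k (- X k i) (Y k i))" if "redge k i" for k i
  proof -
    have "Arg (cp k (X k (Suc i)) (Y k (Suc i)) - cp k (- X k i) (Y k i)) \<in> (\<lambda>(p, q). Arg (q - p)) ` ?S"
      using in_S[OF that] by (intro image_eqI[of _ _ "(cp k (- X k i) (Y k i), cp k (X k (Suc i)) (Y k
          (Suc i)))"]) auto
    then have "bm_theta m n \<le> Arg (cp k (X k (Suc i)) (Y k (Suc i)) - cp k (- X k i) (Y k i))"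
      unfolding bm_theta_def using fin by (intro Min_le) auto
    then show ?thesis using assms by linarith
  qed
  have main: "sin \<theta> * (X k i + X k (Suc i)) < cos \<theta> * hgt k i" "\<theta> < pi" if r: "redge k i" for k i
  proof -
    define w where "w = cp k (X k (Suc i)) (Y k (Suc i)) - cp k (- X k i) (Y k i)"
    have w: "Re w = X k i + X k (Suc i)" "Im w = hgt k i" by (simp_all add: w_def Re_cp Y_hgt)
    have w0: "w \<noteq> 0" using w(2) hgt_pos[OF r] by auto
    have a: "\<theta> < Arg w" "Arg w \<le> pi" using slope[OF r] Arg_le_pi[of w] by (auto simp: w_def)
    show "\<theta> < pi" using a by simp
    have "Arg w \<noteq> pi" using Arg_eq_pi[of w] w hgt_pos[OF r] by auto
    then have "0 < sin (Arg w - \<theta>)" using a assms(1) by (intro sin_gt_zero) auto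
    then have "0 < norm w * sin (Arg w - \<theta>)" using w0 by simp
    also have "norm w * sin (Arg w - \<theta>) = (norm w * sin (Arg w)) * cos \<theta> - (norm w * cos (Arg w)) * sin \<theta>"
      by (simp add: sin_diff algebra_simps)
    also have "\<dots> = Im w * cos \<theta> - Re w * sin \<theta>"
      using w0 by (simp add: cos_Arg sin_Arg)
    finally show "sin \<theta> * (X k i + X k (Suc i)) < cos \<theta> * hgt k i" unfolding w by (simp add: algebra_simps)
  qed
  then show "\<And>k i. redge k i \<Longrightarrow> sin \<theta> * (X k i + X k (Suc i)) < cos \<theta> * hgt k i" by blast
  \<comment> \<open>The signs of sine and cosine need one actual trapezoid; of the edges
    \<open>1\<close> and \<open>2\<close> of polygon \<open>0\<close>, one is not
    degenerate.\<close>
  obtain i where i: "redge 0 i"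
  proof -
    have "0 < len 0 1 \<or> 0 < len 0 (Suc 1)" using len_pos_Suc[of 0 1] m_ge by auto
    then show ?thesis using that[of 1] that[of 2] m_ge n_ge by (auto simp: redge_iff numeral_2_eq_2)
  qed
  show s: "0 \<le> sin \<theta>" using main(2)[OF i] assms(1) by (intro sin_ge_zero) auto
  have "0 \<le> X 0 i" "0 \<le> X 0 (Suc i)" using i by (auto intro!: X_nonneg simp: redge_iff)
  then have "0 < cos \<theta> * hgt 0 i" using main(1)[OF i] s by (smt (verit) mult_nonneg_nonneg)
  then show "0 < cos \<theta>" using hgt_pos[OF i] by (simp add: zero_less_mult_iff)
qed

end

text \<open>Fixes the crossing times, which \<open>bm_cutting_sequence\<close> merely asserts to
  exist, so that positions in the word can be compared with times.\<close>

locale bm_path = bouw_moeller +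
  fixes \<theta> :: real and \<gamma> :: "real \<Rightarrow> bm_point" and c :: "int \<Rightarrow> bm_letter" and t :: "int \<Rightarrow> real"
  assumes th: "0 \<le> \<theta>" "\<theta> < bm_theta m n"
    and traj: "bm_trajectory m n \<theta> \<gamma>"
    and mono_t: "strict_mono t"
    and range_t: "range t = {s. \<exists>l\<in>bm_letters m n. bm_on_edge m n l (\<gamma> s)}"
    and c_letter: "\<And>j. c j \<in> bm_letters m n"
    and c_edge: "\<And>j. bm_on_edge m n (c j) (\<gamma> (t j))"
begin

lemma lin_gamma: "lin (cis \<theta>) \<gamma>"
  using traj by (simp add: bm_trajectory_def lin_def)

lemma reg [simp]: "\<gamma> s \<in> regular"
  using lin_gamma by (simp add: lin_def)

lemma onany_iff: "onany (\<gamma> s) \<longleftrightarrow> s \<in> range t"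
  unfolding range_t onany_def by simp

lemma t_less: "t i < t j \<longleftrightarrow> i < j" and t_le: "t i \<le> t j \<longleftrightarrow> i \<le> j"
  using mono_t by (auto simp: strict_mono_less strict_mono_less_eq)

lemma not_onany_between: "t j < s \<Longrightarrow> s < t (j + 1) \<Longrightarrow> \<not> onany (\<gamma> s)"
  unfolding onany_iff using t_less by (metis add1_zle_eq imageE not_less)

text \<open>Crossings cannot accumulate: a finite supremum of the increasing times would not be a
  crossing time, and then a whole neighbourhood of it would be free of crossings.\<close>

lemma t_above: "\<exists>j. B < t j"
proof (rule ccontr)
  assume "\<not> ?thesis"
  then have b: "bdd_above (range t)" by (force simp: bdd_above_def not_less)
  define T where "T = Sup (range t)"
  have "t j < T" for j using t_less[of j "j + 1"] cSup_upper[OF _ b, of "t (j + 1)"] by (simp add: T_def)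
  then have "\<not> onany (\<gamma> T)" unfolding onany_iff by (metis imageE less_irrefl)
  then obtain e where e: "e > 0" "\<And>s. \<bar>s - T\<bar> < e \<Longrightarrow> \<not> onany (\<gamma> s)"
      using lin_not_onany_nbhd[OF lin_gamma] by blast
  obtain j where "T - e < t j" using less_cSup_iff[OF _ b, of "T - e"] e(1) by (auto simp: T_def)
  then show False using e(2)[of "t j"] \<open>t j < T\<close> onany_iff by auto
qed

lemma t_below: "\<exists>j. t j < B"
proof (rule ccontr)
  assume "\<not> ?thesis"
  then have b: "bdd_below (range t)" by (force simp: bdd_below_def not_less)
  define T where "T = Inf (range t)"
  have "T < t j" for j using t_less[of "j - 1" j] cInf_lower[OF _ b, of "t (j - 1)"] by (simp add: T_def)
  then have "\<not> onany (\<gamma> T)" unfolding onany_iff by (metis imageE less_irrefl)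
  then obtain e where e: "e > 0" "\<And>s. \<bar>s - T\<bar> < e \<Longrightarrow> \<not> onany (\<gamma> s)"
      using lin_not_onany_nbhd[OF lin_gamma] by blast
  obtain j where "t j < T + e" using cInf_less_iff[OF _ b, of "T + e"] e(1) by (auto simp: T_def)
  then show False using e(2)[of "t j"] \<open>T < t j\<close> onany_iff by auto
qed

lemma t_between:
  obtains j where "t j \<le> s" "s < t (j + 1)"
proof -
  obtain j0 where j0: "t j0 < s" using t_below by blast
  obtain j1 where j1: "s < t j1" using t_above by blast
  define A where "A = {j. j0 \<le> j \<and> j \<le> j1 \<and> t j \<le> s}"
  have fin: "finite A" unfolding A_def by (rule finite_subset[of _ "{j0..j1}"]) auto
  have "j0 < j1" using j0 j1 t_less[of j0 j1] by linarith
  then have "j0 \<in> A" using j0 by (simp add: A_def)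
  then have m: "Max A \<in> A" using fin Max_in by blast
  have "s < t (Max A + 1)"
  proof (rule ccontr)
    assume "\<not> s < t (Max A + 1)"
    moreover have "Max A < j1" using m j1 t_less[of "Max A" j1] by (auto simp: A_def)
    ultimately have "Max A + 1 \<in> A" using m by (auto simp: A_def)
    then show False using Max_ge[OF fin] by fastforce
  qed
  then show ?thesis using that[of "Max A"] m by (simp add: A_def)
qed

text \<open>Between the crossings \<open>j\<close> and \<open>j + 1\<close> the trajectory runs through polygon \<open>k\<close>, from the left edge
  of trapezoid \<open>a\<close> to the right edge of trapezoid \<open>b\<close>; here \<open>a = 0\<close> stands for the bottom edge and
  \<open>b = n\<close> for the top edge.\<close>

definition step :: "int \<Rightarrow> nat \<Rightarrow> nat \<Rightarrow> nat \<Rightarrow> real \<Rightarrow> real \<Rightarrow> bool" where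
  "step j k a b u v \<longleftrightarrow> k < m \<and> a < n \<and> 0 < b \<and> b \<le> n \<and>
     (k, (2 * n - a) mod (2 * n)) \<in> c j \<and> (k, b) \<in> c (j + 1) \<and>
     (\<forall>s. t j \<le> s \<longrightarrow> s \<le> t (j + 1) \<longrightarrow> (k, cp k (u + s * cos \<theta>) (v + s * sin \<theta>)) \<in> \<gamma> s) \<and>
     (\<forall>s. t j < s \<longrightarrow> s < t (j + 1) \<longrightarrow> \<gamma> s = {(k, cp k (u + s * cos \<theta>) (v + s * sin \<theta>))}) \<and>
     (a = 0 \<longrightarrow> v + t j * sin \<theta> = 0) \<and>
     (0 < a \<longrightarrow> redge k a \<and> (\<exists>r. 0 < r \<and> r < hgt k a \<and> v + t j * sin \<theta> = Y k a + r \<and> u + t j * cos \<theta>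
         = - rr k a r)) \<and>
     (b < n \<longrightarrow> redge k b \<and> (\<exists>r. 0 < r \<and> r < hgt k b \<and> v + t (j + 1) * sin \<theta> = Y k b + r
         \<and> u + t (j + 1) * cos \<theta> = rr k b r)) \<and>
     (b = n \<longrightarrow> v + t (j + 1) * sin \<theta> = Y k n)"

lemmas slanted = theta_slanted(1)[OF th] and sin_th = theta_slanted(2)[OF th] and cos_th
    = theta_slanted(3)[OF th]

lemma dd_line: "dd k i (z + of_real s * cis \<theta>) = dd k i z + s * sin (\<theta> - real i * al)"
  unfolding dd_add by (simp add: mult.assoc cis_mult)

text \<open>The right edge and the slanted edge of a trapezoid have the same height, and the right
  edge has the smaller signed horizontal extent. So a direction below the slanted edge is also below
  the right edge.\<close>

lemma redge_direction:
  assumes "redge k i" shows "sin (\<theta> - real i * al) < 0"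
proof -
  note K = redge_facts[OF assms]
  have "0 \<le> X k i" using X_nonneg K by simp
  then have "sin \<theta> * (X k (Suc i) - X k i) \<le> sin \<theta> * (X k i + X k (Suc i))" using sin_th
      by (intro mult_left_mono) auto
  then have "sin \<theta> * (len k i * cos (real i * al)) < cos \<theta> * (len k i * sin (real i * al))"
    using slanted[OF assms] by (simp add: X_Suc hgt_def)
  then have "len k i * (sin \<theta> * cos (real i * al) - cos \<theta> * sin (real i * al)) < 0"
      by (simp add: algebra_simps)
  then show ?thesis using assms by (simp add: sin_diff mult_less_0_iff redge_iff)
qed

text \<open>As the direction is below that of all right edges, an edge is crossed inwards exactly if it is
  a left-side edge.\<close>

lemma edge_direction:
  assumes "(k, i) \<in> bm_edges m n"
  shows "0 < sin (\<theta> - real i * al) \<Longrightarrow> i = 0 \<or> n < i" "sin (\<theta> - real i * al) < 0 \<Longrightarrow> 0 < i \<and> i \<le> n"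
proof -
  have i2: "i < 2 * n" using assms by (simp add: mem_edges)
  have L: "0 < sin (\<theta> - real i * al)" if "n < i"
  proof -
    have "redge (nb k i) (opp i)" using nb_edge(1)[OF assms] that i2 by (auto simp: redge_def opp_cases)
    then have "sin (\<theta> - real (opp i) * al) < 0" by (rule redge_direction)
    moreover have "\<theta> - real (opp i) * al = \<theta> - real i * al + pi" using that i2 n_al
        by (simp add: opp_cases of_nat_diff algebra_simps)
    ultimately show ?thesis by simp
  qed
  have R: "sin (\<theta> - real i * al) < 0" if "0 < i" "i < n"
    using redge_direction[of k i] assms that by (simp add: redge_def)
  have N: "sin (\<theta> - real n * al) \<le> 0" using sin_th by (simp add: n_al sin_diff)
  have Z: "0 \<le> sin (\<theta> - real 0 * al)" using sin_th by simp
  show "0 < sin (\<theta> - real i * al) \<Longrightarrow> i = 0 \<or> n < i" using R N by (cases "i = n"; cases "i < n") force+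
  show "sin (\<theta> - real i * al) < 0 \<Longrightarrow> 0 < i \<and> i \<le> n" using L Z by (cases "i = 0"; cases "n < i") force+
qed

lemma step_exists: "\<exists>k a b u v. step j k a b u v"
proof -
  have tt: "t j < t (j + 1)" by (simp add: t_less)
  obtain k z where kz: "k < m" "\<And>s. t j < s \<Longrightarrow> s < t (j + 1) \<Longrightarrow> z + of_real s * cis \<theta> \<in> inter k"
    "\<And>s. t j < s \<Longrightarrow> s < t (j + 1) \<Longrightarrow> \<gamma> s = {(k, z + of_real s * cis \<theta>)}"
    "\<And>s. t j \<le> s \<Longrightarrow> s \<le> t (j + 1) \<Longrightarrow> (k, z + of_real s * cis \<theta>) \<in> \<gamma> s"
    by (rule lin_closed_segment[OF lin_gamma tt not_onany_between], assumption, assumption, rule that)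
        blast+
  define u v where "u = Re z - hc k" and "v = Im z"
  have pos: "z + of_real s * cis \<theta> = cp k (u + s * cos \<theta>) (v + s * sin \<theta>)" for s
    by (simp add: complex_eq_iff u_def v_def Re_cp)
  define s1 where "s1 = (t j + t (j + 1)) / 2"
  have s1: "t j < s1" "s1 < t (j + 1)" using tt by (simp_all add: s1_def)
  obtain i where i: "(k, i) \<in> c j" "z + of_real (t j) * cis \<theta> \<in> bm_edge m n k i"
    using on_edge_rep[OF reg c_letter c_edge, of k _ j] kz(4)[of "t j"] tt by (metis less_imp_le order_refl)
  obtain i' where i': "(k, i') \<in> c (j + 1)" "z + of_real (t (j + 1)) * cis \<theta> \<in> bm_edge m n k i'"
    using on_edge_rep[OF reg c_letter c_edge, of k _ "j + 1"] kz(4)[of "t (j + 1)"] tt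
        by (metis less_imp_le order_refl)
  have ie: "(k, i) \<in> bm_edges m n" "(k, i') \<in> bm_edges m n" using letter_edges[OF c_letter] i i' by blast+
  then have i2: "i < 2 * n" "i' < 2 * n" by (auto simp: mem_edges)
  have nv: "z + of_real s * cis \<theta> \<notin> bm_verts m n k" if "t j \<le> s" "s \<le> t (j + 1)" for s
    using regular_rep(4)[OF reg kz(4)[OF that]] .
  have inner: "0 < dd k i (z + of_real s1 * cis \<theta>)" "0 < dd k i' (z + of_real s1 * cis \<theta>)"
    using kz(2)[OF s1] i2 by (auto simp: inter_def)
  have "dd k i (z + of_real (t j) * cis \<theta>) = 0" "dd k i' (z + of_real (t (j + 1)) * cis \<theta>) = 0"
    using i i' edge_iff kz(1) by auto
  then have "dd k i (z + of_real s1 * cis \<theta>) = (s1 - t j) * sin (\<theta> - real i * al)"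
     "dd k i' (z + of_real s1 * cis \<theta>) = (s1 - t (j + 1)) * sin (\<theta> - real i' * al)"
    unfolding dd_line by (simp_all add: algebra_simps)
  \<comment> \<open>Along the step the distance to the entry edge rises from \<open>0\<close> and
    the distance to the exit edge falls to \<open>0\<close>; \<open>edge_direction\<close> converts
    these signs into sides.\<close>
  then have "0 < sin (\<theta> - real i * al)" "sin (\<theta> - real i' * al) < 0"
    using inner s1 by (auto simp: zero_less_mult_iff)
  then have side: "i = 0 \<or> n < i" "0 < i'" "i' \<le> n" using edge_direction ie by blast+
  define a where "a = (if i = 0 then 0 else 2 * n - i)"
  have a: "a < n" "(2 * n - a) mod (2 * n) = i" using side i2 n_ge by (auto simp: a_def)
  have A0: "v + t j * sin \<theta> = 0" if "a = 0"
  proof -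
    have "i = 0" using that i2 by (auto simp: a_def split: if_splits)
    then have "dd k 0 (cp k (u + t j * cos \<theta>) (v + t j * sin \<theta>)) = 0" using i edge_iff kz(1) pos by simp
    then show ?thesis by (simp add: dd_bottom)
  qed
  have right: "\<exists>r. 0 < r \<and> r < hgt k b \<and> z' = cp k (rr k b r) (Y k b + r)"
    if zb: "redge k b" "z' \<in> bm_edge m n k b" "z' \<notin> bm_verts m n k" for b z'
  proof -
    obtain r where r: "0 \<le> r" "r \<le> hgt k b" "z' = cp k (rr k b r) (Y k b + r)"
      using right_edge_iff[OF zb(1)] zb(2) by blast
    have "r \<noteq> 0" using zb(3) r vert_cp[of k b] vert_in_verts[of k b] by auto
    moreover have "r \<noteq> hgt k b" using zb(3) r vert_cp[of k "Suc b"] vert_in_verts[of k "Suc b"]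
        rr_hgt[of b k] redge_facts[OF zb(1)] by (auto simp: Y_hgt)
    ultimately show ?thesis using r by (intro exI[of _ r]) auto
  qed
  have A1: "redge k a \<and> (\<exists>r. 0 < r \<and> r < hgt k a \<and> v + t j * sin \<theta> = Y k a + r \<and> u + t j * cos \<theta>
      = - rr k a r)" if "0 < a"
  proof -
    have ni: "n < i" "a = 2 * n - i" using that side by (auto simp: a_def split: if_splits)
    then have re: "refl_edge i = a" using i2 by (simp add: refl_edge_def)
    have r: "redge k a" using refl_edge_facts(1)[OF ie(1)] re a that by (simp add: redge_def)
    let ?z = "cp k (u + t j * cos \<theta>) (v + t j * sin \<theta>)"
    have zi: "?z \<in> bm_edge m n k i" "?z \<notin> bm_verts m n k" using i(2) nv[of "t j"] tt pos by auto
    have "mirror k ?z \<in> bm_edge m n k a" using mirror_edge[OF kz(1) i2(1) zi(1)] re by simp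
    moreover have "mirror k ?z \<notin> bm_verts m n k" using mirror_verts[of "mirror k ?z" k] zi(2)
        by (metis mirror_mirror)
    ultimately obtain r where "0 < r" "r < hgt k a" "mirror k ?z = cp k (rr k a r) (Y k a + r)"
        using right[OF r] by blast
    then show ?thesis using \<open>redge k a\<close> by (auto intro!: exI[of _ r])
  qed
  have B1: "redge k i' \<and> (\<exists>r. 0 < r \<and> r < hgt k i' \<and> v + t (j + 1) * sin \<theta> = Y k i' + r
      \<and> u + t (j + 1) * cos \<theta> = rr k i' r)" if "i' < n"
  proof -
    have r: "redge k i'" using ie side that by (simp add: redge_def)
    have "z + of_real (t (j + 1)) * cis \<theta> \<notin> bm_verts m n k" using nv[of "t (j + 1)"] tt by simp
    then show ?thesis using right[OF r i'(2)] r unfolding pos by auto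
  qed
  have B0: "v + t (j + 1) * sin \<theta> = Y k n" if "i' = n"
  proof -
    have "dd k n (cp k (u + t (j + 1) * cos \<theta>) (v + t (j + 1) * sin \<theta>)) = 0"
        using i' edge_iff kz(1) pos that by simp
    then show ?thesis by (simp add: dd_top)
  qed
  have "step j k a i' u v"
    unfolding step_def a(2) using kz(1,3,4) a(1) side i(1) i'(1) A0 A1 B0 B1 unfolding pos by blast
  then show ?thesis by blast
qed

section \<open>Levels of edges\<close>

lemma heights_eq: "bm_heights m n k = Y k ` {0<..n}"
proof (intro set_eqI iffI)
  fix h assume "h \<in> bm_heights m n k"
  then obtain z where z: "z \<in> bm_verts m n k" "h = Im z" by (auto simp: bm_heights_def)
  then show "h \<in> Y k ` {0<..n}" by (auto simp: verts_iff)
next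
  fix h assume "h \<in> Y k ` {0<..n}"
  then obtain j where "h = Im (vert k j)" by (auto simp: Y_def)
  then show "h \<in> bm_heights m n k" using vert_in_verts[of k j] by (auto simp: bm_heights_def)
qed

text \<open>One formula for all entries: for the bottom edge, \<open>a = 0\<close>, no vertex lies
  below \<open>Y k 1 = 0\<close>, which gives level \<open>0\<close>.\<close>

lemma level_entry:
  assumes "k < m" "a < n"
  shows "bm_level m n (k, (2 * n - a) mod (2 * n)) = card {h \<in> bm_heights m n k. h < Y k (Suc a)}"
proof (cases "a = 0")
  case True
  have "\<not> h < Y k (Suc 0)" if "h \<in> bm_heights m n k" for h
    using that Y_mono[OF assms(1), of "Suc 0"] by (auto simp: heights_eq not_less simp del: Y_1)
  then have e: "{h \<in> bm_heights m n k. h < Y k (Suc 0)} = {}" by blast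
  show ?thesis unfolding True e by (simp add: bm_level_def)
next
  case False
  have i: "(2 * n - a) mod (2 * n) = 2 * n - a" "2 * n - a \<noteq> 0" "2 * n - a \<noteq> n"
      using False assms n_ge by auto
  have v1: "Im (vert k (2 * n - a)) = Y k (Suc a)" using vert_mirror_cp[of "Suc a" k] assms by simp
  have v2: "Im (vert k (2 * n - a + 1)) = Y k a" using vert_mirror_cp[of a k] assms
      by (simp add: Suc_diff_le)
  have "max (Im (vert k (2 * n - a))) (Im (vert k (2 * n - a + 1))) = Y k (Suc a)"
    unfolding v1 v2 using Y_le_Suc[of k a] assms by simp
  then show ?thesis unfolding i(1) by (simp only: bm_level_def case_prod_conv i if_False)
qed

lemma level_exit:
  assumes "k < m" "0 < b" "b < n"
  shows "bm_level m n (k, b) = card {h \<in> bm_heights m n k. h < Y k (Suc b)}"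
  using assms Y_le_Suc[of k b] by (simp add: bm_level_def Y_def[symmetric] max_def)

lemma level_top: "bm_level m n (k, n) = card (bm_heights m n k)"
  using n_ge by (simp add: bm_level_def)

lemma letter_side_unique:
  assumes "l \<in> bm_letters m n" "(k, i) \<in> l" "(k', i') \<in> l"
    "bm_left_side n i \<and> bm_left_side n i' \<or> bm_right_side n i \<and> bm_right_side n i'"
  shows "k = k'" "i = i'"
proof -
  have e: "(k, i) \<in> bm_edges m n" "l = {(k, i), (nb k i, opp i)}" using letter_edges[OF assms(1,2)] by auto
  have i: "i < 2 * n" using e by (simp add: mem_edges)
  have "i' \<noteq> opp i" using assms(4) i n_ge by (auto simp: opp_cases bm_left_side_def bm_right_side_def
      split: if_splits)
  then have "(k', i') = (k, i)" using e(2) assms(3) by auto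
  then show "k = k'" "i = i'" by auto
qed

end

section \<open>The derived trajectory\<close>

locale bm_derived = bm_path +
  fixes M :: real and f :: "bm_point \<Rightarrow> bm_point"
  assumes M_eq: "M = 2 * cot (pi / real n) + 2 * (cos (pi / real m) / sin (pi / real n))"
    and shear: "bm_shear m n M f"
begin

lemma wd_M: "redge k i \<Longrightarrow> wd k i = M * hgt k i"
  unfolding M_eq by (rule wd_hgt)

lemma wd_pos: "redge k i \<Longrightarrow> 0 < wd k i"
  using rr_bounds(3)[of k i "hgt k i / 2"] hgt_pos[of k i] by simp

lemma M_pos: "redge k i \<Longrightarrow> 0 < M"
  using wd_M[of k i] wd_pos[of k i] hgt_pos[of k i] by (simp add: zero_less_mult_iff)

section \<open>Heights along a step and the type of its crossing\<close>

lemma step_rep: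
  assumes "step j k a b u v" "t j \<le> s" "s \<le> t (j + 1)"
  shows "k < m" "(k, cp k (u + s * cos \<theta>) (v + s * sin \<theta>)) \<in> \<gamma> s"
    "cp k (u + s * cos \<theta>) (v + s * sin \<theta>) \<in> bm_polygon m n k"
    "cp k (u + s * cos \<theta>) (v + s * sin \<theta>) \<notin> bm_verts m n k"
    "\<gamma> s = cl k (cp k (u + s * cos \<theta>) (v + s * sin \<theta>))"
proof -
  show 1: "(k, cp k (u + s * cos \<theta>) (v + s * sin \<theta>)) \<in> \<gamma> s" using assms unfolding step_def by blast
  show "k < m" "cp k (u + s * cos \<theta>) (v + s * sin \<theta>) \<in> bm_polygon m n k"
    "cp k (u + s * cos \<theta>) (v + s * sin \<theta>) \<notin> bm_verts m n k"
    "\<gamma> s = cl k (cp k (u + s * cos \<theta>) (v + s * sin \<theta>))"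
    using regular_rep[OF reg 1] by auto
qed

text \<open>For a horizontal trajectory all the heights coincide, and \<open>s1\<close> serves as
  the witness.\<close>

lemma height_time:
  assumes "s1 \<le> s2" "v + s1 * sin \<theta> \<le> h" "h \<le> v + s2 * sin \<theta>"
  obtains s where "s1 \<le> s" "s \<le> s2" "v + s * sin \<theta> = h"
proof (cases "sin \<theta> = 0")
  case True
  then show ?thesis using that[of s1] assms by simp
next
  case False
  then have p: "0 < sin \<theta>" using sin_th by simp
  show ?thesis
    using that[of "(h - v) / sin \<theta>"] assms p by (simp add: field_simps)
qed

lemma height_mono: "s1 \<le> s2 \<Longrightarrow> v + s1 * sin \<theta> \<le> v + s2 * sin \<theta>"
  using sin_th by (simp add: mult_right_mono)

lemma step_entry_height:
  assumes "step j k a b u v" shows "v + t j * sin \<theta> \<le> Y k (Suc a)"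
      "0 < a \<Longrightarrow> Y k a < v + t j * sin \<theta> \<and> v + t j * sin \<theta> < Y k (Suc a)"
proof -
  show 1: "0 < a \<Longrightarrow> Y k a < v + t j * sin \<theta> \<and> v + t j * sin \<theta> < Y k (Suc a)" using assms
      unfolding step_def Y_hgt by fastforce
  show "v + t j * sin \<theta> \<le> Y k (Suc a)"
  proof (cases "a = 0")
    case True
    then show ?thesis using assms unfolding step_def by simp
  qed (use 1 in auto)
qed

lemma step_exit_height:
  assumes "step j k a b u v" shows "Y k b \<le> v + t (j + 1) * sin \<theta>"
      "b < n \<Longrightarrow> Y k b < v + t (j + 1) * sin \<theta> \<and> v + t (j + 1) * sin \<theta> < Y k (Suc b)"
proof -
  show 1: "b < n \<Longrightarrow> Y k b < v + t (j + 1) * sin \<theta> \<and> v + t (j + 1) * sin \<theta> < Y k (Suc b)"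
      using assms unfolding step_def Y_hgt by fastforce
  show "Y k b \<le> v + t (j + 1) * sin \<theta>"
  proof (cases "b = n")
    case True
    then show ?thesis using assms unfolding step_def by simp
  next
    case False
    then have "b < n" using assms unfolding step_def by simp
    then show ?thesis using 1 by simp
  qed
qed

lemma step_basic:
  assumes "step j k a b u v"
  shows "k < m" "a < n" "0 < b" "b \<le> n" "(k, (2 * n - a) mod (2 * n)) \<in> c j" "(k, b) \<in> c (j + 1)"
    "0 < a \<Longrightarrow> redge k a" "b < n \<Longrightarrow> redge k b" "t j < t (j + 1)"
  using assms unfolding step_def by (auto simp: t_less)

lemma step_order:
  assumes "step j k a b u v" shows "a \<le> b"
proof (rule ccontr)
  assume "\<not> a \<le> b"
  note S = step_basic[OF assms]
  have b: "b < n" "0 < a" using \<open>\<not> a \<le> b\<close> S by auto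
  have "v + t (j + 1) * sin \<theta> < Y k (Suc b)" using step_exit_height[OF assms] b by simp
  also have "\<dots> \<le> Y k a" using Y_mono[OF S(1), of "Suc b" a] \<open>\<not> a \<le> b\<close> S by simp
  also have "\<dots> < v + t j * sin \<theta>" using step_entry_height[OF assms] b by simp
  also have "\<dots> \<le> v + t (j + 1) * sin \<theta>" using S(9) by (intro height_mono) simp
  finally show False by simp
qed

text \<open>A trapezoid cannot be crossed from bottom to top at an angle below that of its slanted edge.\<close>

lemma step_gap:
  assumes "step j k a b u v" "a < i" "i < b" shows "\<not> redge k i"
proof
  assume r: "redge k i"
  note S = step_basic[OF assms(1)]
  note K = redge_facts[OF r]
  have "v + t j * sin \<theta> \<le> Y k i"
    using step_entry_height(1)[OF assms(1)] Y_mono[OF S(1), of "Suc a" i] assms K by simp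
  moreover have e2: "Y k (Suc i) \<le> v + t (j + 1) * sin \<theta>"
    using step_exit_height(1)[OF assms(1)] Y_mono[OF S(1), of "Suc i" b] assms S by simp
  moreover have le: "Y k i \<le> Y k (Suc i)" using Y_le_Suc K by simp
  ultimately obtain s1 where s1: "t j \<le> s1" "s1 \<le> t (j + 1)" "v + s1 * sin \<theta> = Y k i"
    using height_time[of "t j" "t (j + 1)" v "Y k i"] S(9) by force
  obtain s2 where s2: "s1 \<le> s2" "s2 \<le> t (j + 1)" "v + s2 * sin \<theta> = Y k (Suc i)"
    using height_time[of s1 "t (j + 1)" v "Y k (Suc i)"] s1 e2 le by force
  have "\<bar>u + s1 * cos \<theta>\<bar> \<le> X k i"
    using step_rep[OF assms(1) s1(1,2)] s1(3) polygon_width_vertex[OF S(1)] K by simp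
  moreover have "\<bar>u + s2 * cos \<theta>\<bar> \<le> X k (Suc i)"
    using step_rep[OF assms(1) _ s2(2)] s1(1) s2(1,3) polygon_width_vertex[OF S(1)] K by simp
  ultimately have x: "(s2 - s1) * cos \<theta> \<le> X k i + X k (Suc i)" by (simp add: left_diff_distrib abs_le_iff)
  have y: "(s2 - s1) * sin \<theta> = hgt k i" using s1(3) s2(3) by (simp add: Y_hgt left_diff_distrib)
  have "hgt k i * cos \<theta> = ((s2 - s1) * cos \<theta>) * sin \<theta>" unfolding y[symmetric] by simp
  also have "\<dots> \<le> (X k i + X k (Suc i)) * sin \<theta>" using x sin_th by (rule mult_right_mono)
  finally show False using slanted[OF r] by (simp add: mult.commute)
qed

text \<open>If \<open>a < b\<close>, the edges strictly between them are degenerate by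
  \<open>step_gap\<close>, so the top of trapezoid \<open>a\<close> is at the height of vertex
  \<open>b\<close>. The exit level then counts this one height in addition to those counted for the
  entry.\<close>

lemma step_level:
  assumes "step j k a b u v"
  shows "bm_level m n (k, b) = bm_level m n (k, (2 * n - a) mod (2 * n)) + (if a = b then 0 else 1)"
proof -
  note S = step_basic[OF assms]
  let ?H = "bm_heights m n k"
  have fin: "finite ?H" by (simp add: heights_eq)
  show ?thesis
  proof (cases "a = b")
    case True
    then show ?thesis using level_entry[OF S(1,2)] level_exit[OF S(1,3)] S by simp
  next
    case False
    then have ab: "a < b" using step_order[OF assms] by simp
    have const: "Y k (Suc (a + d)) = Y k (Suc a)" if "a + d < b" for d
      using that
    proof (induction d)
      case (Suc d)
      have "\<not> redge k (a + Suc d)" using step_gap[OF assms, of "a + Suc d"] Suc.prems by simp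
      then have "len k (a + Suc d) = 0"
        using S(1,4) Suc.prems len_nonneg[OF S(1), of "a + Suc d"] by (auto simp: redge_iff)
      then have "Y k (Suc (a + Suc d)) = Y k (a + Suc d)" unfolding Y_Suc by simp
      then show ?case using Suc by simp
    qed simp
    have Yb: "Y k b = Y k (Suc a)" using const[of "b - Suc a"] ab by simp
    have mem: "Y k (Suc a) \<in> ?H" using ab S(4) by (auto simp: heights_eq)
    have "bm_level m n (k, b) = card (insert (Y k (Suc a)) {h \<in> ?H. h < Y k (Suc a)})"
    proof (cases "b = n")
      case True
      have "?H = insert (Y k (Suc a)) {h \<in> ?H. h < Y k (Suc a)}"
      proof -
        have "h \<le> Y k (Suc a)" if "h \<in> ?H" for h
          using that Y_mono[OF S(1), of _ n] True Yb by (auto simp: heights_eq)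
        then show ?thesis using mem by force
      qed
      then show ?thesis using level_top True by simp
    next
      case False
      then have b: "b < n" using S by simp
      have bb: "Y k b < Y k (Suc b)" using hgt_pos[OF S(8)[OF b]] by (simp add: Y_hgt)
      have "{h \<in> ?H. h < Y k (Suc b)} = insert (Y k (Suc a)) {h \<in> ?H. h < Y k (Suc a)}"
      proof -
        have "h \<le> Y k (Suc a)" if "h \<in> ?H" "h < Y k (Suc b)" for h
        proof -
          obtain j where j: "j \<le> n" "h = Y k j" using \<open>h \<in> ?H\<close> by (auto simp: heights_eq)
          have "j \<le> b"
          proof (rule ccontr)
            assume "\<not> j \<le> b"
            then have "Y k (Suc b) \<le> Y k j" using Y_mono[OF S(1), of "Suc b" j] j by simp
            then show False using that j by simp
          qed
          then show ?thesis using Y_mono[OF S(1), of j b] S(4) j Yb by simp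
        qed
        then show ?thesis using mem bb Yb by force
      qed
      then show ?thesis using level_exit[OF S(1,3) b] by simp
    qed
    also have "\<dots> = Suc (card {h \<in> ?H. h < Y k (Suc a)})" using fin by simp
    finally show ?thesis using level_entry[OF S(1,2)] False by simp
  qed
qed

lemma entry_left: "a < n \<Longrightarrow> bm_left_side n ((2 * n - a) mod (2 * n))"
  by (cases "a = 0") (auto simp: bm_left_side_def)

text \<open>A letter has only one edge on each side, so the existential definition of a crossing can
  refer to no polygon but that of the step. Type \<open>0\<close> thus means leaving through the
  trapezoid of entry.\<close>

lemma step_crossing:
  assumes "step j k a b u v"
  shows "bm_crossing m n (c j) (c (j + 1)) d \<longleftrightarrow> d = (if a = b then 0 else 1)"
proof
  note S = step_basic[OF assms]
  have L: "bm_left_side n ((2 * n - a) mod (2 * n))" using entry_left S by simp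
  have R: "bm_right_side n b" using S by (simp add: bm_right_side_def)
  {
    assume "bm_crossing m n (c j) (c (j + 1)) d"
    then obtain k1 i1 i1' where 1: "(k1, i1) \<in> c j" "(k1, i1') \<in> c (j + 1)" "bm_left_side n i1"
        "bm_right_side n i1'"
      "bm_level m n (k1, i1') = bm_level m n (k1, i1) + d" by (auto simp: bm_crossing_def)
    have "k1 = k" "i1 = (2 * n - a) mod (2 * n)"
        using letter_side_unique[OF c_letter 1(1) S(5)] 1(3) L by auto
    moreover have "i1' = b" using letter_side_unique[OF c_letter 1(2) S(6)] 1(4) R by auto
    ultimately show "d = (if a = b then 0 else 1)" using 1(5) step_level[OF assms] by simp
  }
  assume "d = (if a = b then 0 else 1)"
  then show "bm_crossing m n (c j) (c (j + 1)) d"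
    unfolding bm_crossing_def using S L R step_level[OF assms] by blast
qed

text \<open>The left hand side is the slanted edge of trapezoid \<open>i\<close> at height
  \<open>r\<close>. Both lines start at the bottom left corner, and at the top they are at
  \<open>X k (Suc i)\<close> and \<open>wd k i - X k (Suc i)\<close>; the comparison there is
  \<open>2 * X k (Suc i) \<le> wd k i\<close>.\<close>

lemma diag_left:
  assumes "redge k i" "0 < r" "r < hgt k i"
  shows "- X k i + (X k i + X k (Suc i)) * (r / hgt k i) \<le> M * r - rr k i r"
proof -
  note K = redge_facts[OF assms(1)] and R = redge_nb[OF assms(1)]
  define q where "q = r / hgt k i"
  have q: "0 < q" "r = q * hgt k i" using assms by (auto simp: q_def)
  have h: "ct i * hgt k i = X k (Suc i) - X k i" using rr_hgt[OF K(2,3), of k] by (simp add: rr_def)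
  have "rr (nb k i) (n - i) (hgt k i) = X (nb k i) (Suc (n - i))"
      using rr_hgt[of "n - i" "nb k i"] R K by simp
  moreover have "Suc (n - i) \<le> n" using K(2,3) by linarith
  then have "0 \<le> X (nb k i) (Suc (n - i))" using X_nonneg R(1) by (simp add: redge_iff)
  ultimately have "2 * X k (Suc i) \<le> wd k i"
    using rr_nb[OF assms(1), of "hgt k i"] rr_hgt[OF K(2,3), of k] by linarith
  then have "q * (2 * X k (Suc i)) \<le> q * wd k i" using q by (intro mult_left_mono) auto
  moreover have "M * r = q * wd k i" using q wd_M[OF assms(1)] by simp
  moreover have "rr k i r = X k i + q * (X k (Suc i) - X k i)" unfolding rr_def h[symmetric]
      by (simp add: q)
  ultimately show ?thesis unfolding q_def[symmetric] by (simp add: algebra_simps)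
qed

text \<open>The counterpart in the second trapezoid: diagonal and slanted edge now end at a common
  top right corner, and at the bottom the slanted edge is further right by
  \<open>2 * X k i\<close>.\<close>

lemma diag_right:
  assumes "redge k i" "0 < r" "r < hgt k i"
  shows "M * r - rr k i r - wd k i / 2 \<le>
    - X (nb k i) (n - i) + (X (nb k i) (n - i) + X (nb k i) (Suc (n - i))) * (r / hgt k i)"
proof -
  note K = redge_facts[OF assms(1)] and R = redge_nb[OF assms(1)]
  define q where "q = r / hgt k i"
  have q: "0 < q" "q < 1" "r = q * hgt k i" using assms by (auto simp: q_def)
  have h: "ct i * hgt k i = X k (Suc i) - X k i" using rr_hgt[OF K(2,3), of k] by (simp add: rr_def)
  have "rr (nb k i) (n - i) (hgt k i) = X (nb k i) (Suc (n - i))"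
      using rr_hgt[of "n - i" "nb k i"] R K by simp
  then have X'': "X (nb k i) (Suc (n - i)) = wd k i / 2 - X k (Suc i)"
    using rr_nb[OF assms(1), of "hgt k i"] rr_hgt[OF K(2,3), of k] by simp
  have X': "X (nb k i) (n - i) = wd k i / 2 - X k i" by (simp add: wd_def field_simps)
  have "0 \<le> X k i" using X_nonneg K by simp
  then have "q * X k i \<le> 1 * X k i" using q by (intro mult_right_mono) auto
  moreover have "M * r = q * wd k i" using q wd_M[OF assms(1)] by simp
  moreover have "rr k i r = X k i + q * (X k (Suc i) - X k i)" unfolding rr_def h[symmetric]
      by (simp add: q)
  ultimately show ?thesis unfolding q_def[symmetric] X' X'' by (simp add: algebra_simps)
qed

lemma diag_bounds:
  assumes "redge k i" "0 < r" "r < hgt k i"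
  shows "- rr k i r < M * r - rr k i r" "M * r - rr k i r < wd k i - rr k i r"
  using assms M_pos[OF assms(1)] wd_M[OF assms(1)] by auto

lemma diag_point:
  assumes "redge k i" "0 < r" "r < hgt k i"
  shows "M * r - rr k i r \<le> rr k i r \<Longrightarrow> phi k i (Complex (M * r - rr k i r) r) = pt k i (M * r - rr k i r) r"
    "rr k i r \<le> M * r - rr k i r \<Longrightarrow> phi k i (Complex (M * r - rr k i r) r)
        = pt (nb k i) (n - i) (M * r - rr k i r - wd k i / 2) r"
proof -
  note B = diag_bounds[OF assms]
  show "phi k i (Complex (M * r - rr k i r) r) = pt k i (M * r - rr k i r) r"
      if "M * r - rr k i r \<le> rr k i r"
    using phi_first[OF assms, of "M * r - rr k i r" 0] B that by (simp add: abs_le_iff)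
  show "phi k i (Complex (M * r - rr k i r) r)
      = pt (nb k i) (n - i) (M * r - rr k i r - wd k i / 2) r" if "rr k i r \<le> M * r - rr k i r"
  proof -
    have "\<bar>M * r - rr k i r - wd k i / 2\<bar> \<le> rr (nb k i) (n - i) r"
      using B that rr_nb[OF assms(1), of r] unfolding abs_le_iff by linarith
    then show ?thesis using phi_second[OF assms, of "M * r - rr k i r" 0] by simp
  qed
qed

lemma diag_rep:
  assumes "redge k i" "0 < r" "r < hgt k i" "p = phi k i (Complex (M * r - rr k i r) r)" "(k1, z1) \<in> p"
  shows "k1 = k \<Longrightarrow> z1 = cp k (M * r - rr k i r) (Y k i + r) \<and> M * r - rr k i r \<le> rr k i r"
    "k1 = nb k i \<Longrightarrow> z1 = cp (nb k i) (M * r - rr k i r - wd k i / 2) (Y (nb k i) (n - i) + r)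
        \<and> rr k i r \<le> M * r - rr k i r"
    "k1 = k \<or> k1 = nb k i"
proof -
  note B = diag_bounds[OF assms(1-3)] and P = diag_point[OF assms(1-3)] and R = redge_nb[OF assms(1)]
  have t': "r < hgt (nb k i) (n - i)" using R assms by simp
  define x where "x = M * r - rr k i r"
  have B: "- rr k i r < x" "x < wd k i - rr k i r" using B by (auto simp: x_def)
  have main: "(k1 = k \<and> z1 = cp k x (Y k i + r) \<and> x \<le> rr k i r) \<or> (k1 = nb k i \<and> z1
      = cp (nb k i) (x - wd k i / 2) (Y (nb k i) (n - i) + r) \<and> rr k i r \<le> x)"
  proof -
    consider "x < rr k i r" | "x = rr k i r" | "rr k i r < x" by linarith
    then show ?thesis
    proof cases
      case 1
      then have "p = {(k, cp k x (Y k i + r))}" using P(1) pt_inner[OF assms(1-3), of x] B assms(4)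
          by (simp add: x_def[symmetric])
      then show ?thesis using assms(5) 1 by simp
    next
      case 2
      then have "p = pt k i (rr k i r) r" using P(1) assms(4) by (simp add: x_def[symmetric])
      then show ?thesis using assms(5) 2 pt_right[OF assms(1-3)] rr_nb[OF assms(1), of r] by auto
    next
      case 3
      have "\<bar>x - wd k i / 2\<bar> < rr (nb k i) (n - i) r"
        using B 3 rr_nb[OF assms(1), of r] unfolding abs_less_iff by linarith
      then have "p = {(nb k i, cp (nb k i) (x - wd k i / 2) (Y (nb k i) (n - i) + r))}"
        using P(2) pt_inner[OF R(1) assms(2) t', of "x - wd k i / 2"] 3 assms(4)
            by (simp add: x_def[symmetric])
      then show ?thesis using assms(5) 3 by simp
    qed
  qed
  then show "k1 = k \<Longrightarrow> z1 = cp k (M * r - rr k i r) (Y k i + r) \<and> M * r - rr k i r \<le> rr k i r"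
    "k1 = nb k i \<Longrightarrow> z1 = cp (nb k i) (M * r - rr k i r - wd k i / 2) (Y (nb k i) (n - i) + r)
        \<and> rr k i r \<le> M * r - rr k i r"
    "k1 = k \<or> k1 = nb k i"
    using R(4) unfolding x_def by auto
qed

text \<open>The time window ties a crossing of the diagonal to this occurrence of the letter, since
  the same letter may occur at other positions of the sequence.\<close>

definition hit :: "int \<Rightarrow> real \<Rightarrow> bool" where
  "hit j s \<longleftrightarrow> t (j - 1) < s \<and> s < t (j + 1) \<and> bm_on_edge m n (c j) (f (bm_flip m n (\<gamma> s)))"

section \<open>Marked letters and crossings of the diagonals\<close>

lemma on_gluing:
  assumes "redge k i" "(k, i) \<in> l" "l \<in> bm_letters m n"
  shows "bm_on_edge m n l (f (bm_flip m n (\<gamma> s))) \<longleftrightarrow> (\<exists>r. 0 < r \<and> r < hgt k i \<and> \<gamma> s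
      = phi k i (Complex (M * r - rr k i r) r))"
  using derived_gluing[OF shear assms(1) reg] letter_edges[OF assms(3,2)] by simp

lemma on_edge_time:
  assumes "l \<in> bm_letters m n" "bm_on_edge m n l (\<gamma> s)"
  obtains j where "s = t j" "c j = l"
proof -
  have "s \<in> range t" using onany_iff assms unfolding onany_def by blast
  then obtain j where j: "s = t j" by blast
  then show ?thesis using that[of j] on_edge_unique[OF reg c_letter c_edge assms(1)] assms(2) by blast
qed

lemma hit_horizontal:
  assumes "bm_horizontal_letter m n (c j)" shows "hit j s \<longleftrightarrow> s = t j"
proof -
  have D: "bm_on_edge m n (c j) (f (bm_flip m n (\<gamma> s))) \<longleftrightarrow> bm_on_edge m n (c j) (\<gamma> s)" for s
    using derived_horizontal[OF shear c_letter assms] reg by blast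
  show ?thesis
  proof
    assume h: "hit j s"
    then obtain j' where "s = t j'" using on_edge_time[OF c_letter] D unfolding hit_def by blast
    then show "s = t j" using h t_less unfolding hit_def
        by (metis antisym_conv3 add1_zle_eq diff_add_cancel not_less)
  next
    assume "s = t j"
    then show "hit j s" unfolding hit_def D using c_edge t_less by simp
  qed
qed

text \<open>The letter ends one step as right edge \<open>i\<close> and begins the next as the left
  side of trapezoid \<open>n - i\<close> of the neighbour. The three-letter word is thus described
  inside the cylinder of \<open>(k, i)\<close>.\<close>

lemma gluing_steps:
  assumes "bm_gluing_letter m n (c j)"
  obtains k i a b u v u' v' where "redge k i" "(k, i) \<in> c j" "step (j - 1) k a i u v"
      "step j (nb k i) (n - i) b u' v'"
proof -
  obtain k i where ki: "redge k i" "c j = {(k, i), (nb k i, opp i)}"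
      using gluing_letter_iff[OF c_letter] assms by blast
  note K = redge_facts[OF ki(1)]
  obtain k1 a b1 u v where s1: "step (j - 1) k1 a b1 u v" using step_exists by blast
  have "(k1, b1) \<in> c j" "bm_right_side n b1" "bm_right_side n i"
    using step_basic[OF s1] K by (auto simp: bm_right_side_def)
  moreover have m: "(k, i) \<in> c j" using ki(2) by blast
  ultimately have 1: "k1 = k" "b1 = i" using letter_side_unique[OF c_letter, of k1 b1 j k i] by blast+
  obtain k2 a2 b u' v' where s2: "step j k2 a2 b u' v'" using step_exists by blast
  have o: "opp i = i + n" using K by (simp add: opp_cases)
  have "(k2, (2 * n - a2) mod (2 * n)) \<in> c j" "bm_left_side n ((2 * n - a2) mod (2 * n))"
      "bm_left_side n (opp i)"
    using step_basic[OF s2] entry_left o K by (auto simp: bm_left_side_def)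
  moreover have "(nb k i, opp i) \<in> c j" using ki(2) by blast
  ultimately have "k2 = nb k i" "(2 * n - a2) mod (2 * n) = opp i"
    using letter_side_unique[OF c_letter, of k2 "(2 * n - a2) mod (2 * n)" j "nb k i" "opp i"] by blast+
  then have 2: "k2 = nb k i" "(2 * n - a2) mod (2 * n) = i + n" using o by auto
  have "a2 = n - i" using 2(2) step_basic(2)[OF s2] K by (cases "a2 = 0") auto
  then show ?thesis using that[OF ki(1) m, of a u v b u' v'] s1 s2 1 2(1) by simp
qed

text \<open>\<open>x\<close> and \<open>y\<close> are the coordinates of the trajectory in the strip of \<open>phi k i\<close>.\<close>

lemma gluing_hit:
  assumes ki: "redge k i" "(k, i) \<in> c j" and s1: "step (j - 1) k a i u v" and s2: "step j (nb k i) (n -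
      i) b u' v'"
  defines "y \<equiv> \<lambda>s. v - Y k i + s * sin \<theta>" and "x \<equiv> \<lambda>s. u + s * cos \<theta>"
  shows "\<And>s. t (j - 1) < s \<Longrightarrow> s < t (j + 1) \<Longrightarrow>
      hit j s \<longleftrightarrow> 0 < y s \<and> y s < hgt k i \<and> x s = M * y s - rr k i (y s)"
    and "0 < y (t j)" "y (t j) < hgt k i"
    and "\<And>s. u' + s * cos \<theta> = x s - wd k i / 2" "\<And>s. v' + s * sin \<theta> = Y (nb k i) (n - i) + y s"
proof -
  note K = redge_facts[OF ki(1)] and R = redge_nb[OF ki(1)]
  have j1: "j - 1 + 1 = j" by simp
  obtain r where r: "0 < r" "r < hgt k i" "v + t j * sin \<theta> = Y k i + r" "u + t j * cos \<theta> = rr k i r"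
    using s1 K(3) unfolding step_def j1 by blast
  have "t (j - 1) < t j" by (simp add: t_less)
  then have "(k, cp k (rr k i r) (Y k i + r)) \<in> \<gamma> (t j)"
    using step_rep(2)[OF s1, of "t j"] r by simp
  then have "\<gamma> (t j) = pt k i (rr k i r) r" using regular_rep(3)[OF reg] by (simp add: pt_def)
  then have "(nb k i, cp (nb k i) (- rr (nb k i) (n - i) r) (Y (nb k i) (n - i) + r)) \<in> \<gamma> (t j)"
    using pt_right[OF ki(1) r(1,2)] by simp
  moreover have "(nb k i, cp (nb k i) (u' + t j * cos \<theta>) (v' + t j * sin \<theta>)) \<in> \<gamma> (t j)"
    using step_rep(2)[OF s2, of "t j"] by (simp add: t_le)
  ultimately have "cp (nb k i) (u' + t j * cos \<theta>) (v' + t j * sin \<theta>)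
      = cp (nb k i) (- rr (nb k i) (n - i) r) (Y (nb k i) (n - i) + r)"
    using rep_unique[OF reg] by blast
  \<comment> \<open>Comparing the two representatives at time \<open>t j\<close> shows that both
    steps are the same line in the strip, up to the gluing shift.\<close>
  then have uv: "u' = u - wd k i / 2" "v' = v - Y k i + Y (nb k i) (n - i)"
    using r rr_nb[OF ki(1), of r] by auto
  show xx: "u' + s * cos \<theta> = x s - wd k i / 2" for s by (simp add: uv x_def)
  show yy: "v' + s * sin \<theta> = Y (nb k i) (n - i) + y s" for s by (simp add: uv y_def)
  have yt: "y (t j) = r" using r by (simp add: y_def)
  then show "0 < y (t j)" "y (t j) < hgt k i" using r by auto
  have vy: "v + s * sin \<theta> = Y k i + y s" for s by (simp add: y_def)
  fix s assume s: "t (j - 1) < s" "s < t (j + 1)"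
  have H: "hit j s \<longleftrightarrow> (\<exists>r. 0 < r \<and> r < hgt k i \<and> \<gamma> s = phi k i (Complex (M * r - rr k i r) r))"
    unfolding hit_def using s on_gluing[OF ki c_letter] by simp
  show "hit j s \<longleftrightarrow> 0 < y s \<and> y s < hgt k i \<and> x s = M * y s - rr k i (y s)"
  proof (cases "s \<le> t j")
    case True
    have rep: "(k, cp k (x s) (Y k i + y s)) \<in> \<gamma> s" "cp k (x s) (Y k i + y s) \<in> bm_polygon m n k"
      using step_rep(2,3)[OF s1, of s] s True by (simp_all add: vy x_def)
    show ?thesis
    proof
      assume "hit j s"
      then obtain r where r: "0 < r" "r < hgt k i" "\<gamma> s = phi k i (Complex (M * r - rr k i r) r)"
          using H by blast
      then have "x s = M * r - rr k i r" "y s = r" using diag_rep(1)[OF ki(1) r rep(1)] by auto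
      then show "0 < y s \<and> y s < hgt k i \<and> x s = M * y s - rr k i (y s)" using r by simp
    next
      assume h: "0 < y s \<and> y s < hgt k i \<and> x s = M * y s - rr k i (y s)"
      have "\<bar>x s\<bar> \<le> rr k i (y s)" using polygon_width[OF K(1-3) rep(2)] .
      then have "phi k i (Complex (M * y s - rr k i (y s)) (y s)) = pt k i (x s) (y s)"
        using diag_point(1)[OF ki(1), of "y s"] h by (simp add: abs_le_iff)
      also have "\<dots> = \<gamma> s" using regular_rep(3)[OF reg rep(1)] by (simp add: pt_def)
      finally show "hit j s" using H h by metis
    qed
  next
    case False
    have rep: "(nb k i, cp (nb k i) (x s - wd k i / 2) (Y (nb k i) (n - i) + y s)) \<in> \<gamma> s"
       "cp (nb k i) (x s - wd k i / 2) (Y (nb k i) (n - i) + y s) \<in> bm_polygon m n (nb k i)"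
      using step_rep(2,3)[OF s2, of s] s False by (simp_all add: xx yy)
    show ?thesis
    proof
      assume "hit j s"
      then obtain r where r: "0 < r" "r < hgt k i" "\<gamma> s = phi k i (Complex (M * r - rr k i r) r)"
          using H by blast
      then have "x s = M * r - rr k i r" "y s = r" using diag_rep(2)[OF ki(1) r rep(1)] by auto
      then show "0 < y s \<and> y s < hgt k i \<and> x s = M * y s - rr k i (y s)" using r by simp
    next
      assume h: "0 < y s \<and> y s < hgt k i \<and> x s = M * y s - rr k i (y s)"
      have "\<bar>x s - wd k i / 2\<bar> \<le> rr (nb k i) (n - i) (y s)"
        using polygon_width[OF _ _ _ rep(2)] redge_facts[OF R(1)] by simp
      then have "rr k i (y s) \<le> x s" using rr_nb[OF ki(1), of "y s"] by (simp add: abs_le_iff)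
      then have "phi k i (Complex (M * y s - rr k i (y s)) (y s))
          = pt (nb k i) (n - i) (x s - wd k i / 2) (y s)"
        using diag_point(2)[OF ki(1), of "y s"] h by simp
      also have "\<dots> = \<gamma> s" using regular_rep(3)[OF reg rep(1)] by (simp add: pt_def)
      finally show "hit j s" using H h by metis
    qed
  qed
qed

text \<open>\<open>p\<close> is the time of entry into the parallelogram: the crossing
  \<open>j - 1\<close> on its left side if \<open>a = i\<close>, otherwise the passage through its
  bottom. Relative to the diagonal the left side has value \<open>- M * r\<close>, and the bottom a
  nonnegative one that is positive because the bottom left vertex is avoided.\<close>

lemma gluing_lower:
  assumes ki: "redge k i" and s1: "step (j - 1) k a i u v" and y0: "0 < v - Y k i + t j * sin \<theta>"
  defines "y \<equiv> \<lambda>s. v - Y k i + s * sin \<theta>" and "x \<equiv> \<lambda>s. u + s * cos \<theta>"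
  shows "\<exists>p. t (j - 1) \<le> p \<and> p < t j \<and> (\<forall>s. t (j - 1) < s \<longrightarrow> s \<le> t j \<longrightarrow> (0 < y s \<longleftrightarrow> p < s))
    \<and> (if a = i then x p - M * y p + rr k i (y p) < 0 else 0 < x p - M * y p + rr k i (y p))"
proof -
  note K = redge_facts[OF ki] and S = step_basic[OF s1]
  have tt: "t (j - 1) < t j" by (simp add: t_less)
  show ?thesis
  proof (cases "a = i")
    case True
    then obtain r where r: "0 < r" "r < hgt k i" "v + t (j - 1) * sin \<theta> = Y k i + r"
        "u + t (j - 1) * cos \<theta> = - rr k i r"
      using s1 K(2) unfolding step_def by blast
    have yr: "y (t (j - 1)) = r" "x (t (j - 1)) = - rr k i r" using r by (simp_all add: y_def x_def)
    have "0 < y s" if "t (j - 1) < s" for s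
    proof -
      have "t (j - 1) * sin \<theta> \<le> s * sin \<theta>" using that sin_th by (intro mult_right_mono) auto
      then have "y (t (j - 1)) \<le> y s" by (simp add: y_def)
      then show ?thesis using yr r by simp
    qed
    moreover have "0 < M * r" using M_pos[OF ki] r by simp
    ultimately show ?thesis using True yr tt by (intro exI[of _ "t (j - 1)"]) auto
  next
    case False
    then have ai: "a < i" using step_order[OF s1] by simp
    have "v + t (j - 1) * sin \<theta> \<le> Y k i"
      using step_entry_height(1)[OF s1] Y_mono[OF K(1), of "Suc a" i] ai K by simp
    then obtain p where p: "t (j - 1) \<le> p" "p \<le> t j" "v + p * sin \<theta> = Y k i"
      using height_time[of "t (j - 1)" "t j" v "Y k i"] y0 tt by force
    have yp: "y p = 0" using p by (simp add: y_def)
    have "p \<noteq> t j" using yp y0 by (auto simp: y_def)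
    have "sin \<theta> \<noteq> 0" using yp y0 by (auto simp: y_def)
    then have sp: "0 < sin \<theta>" using sin_th by simp
    have ys: "y s = (s - p) * sin \<theta>" for s using yp by (simp add: y_def algebra_simps)
    have st: "cp k (x p) (Y k i) \<in> bm_polygon m n k" "cp k (x p) (Y k i) \<notin> bm_verts m n k"
      using step_rep(3,4)[OF s1, of p] p by (simp_all add: x_def)
    have "\<bar>x p\<bar> \<le> X k i" using polygon_width_vertex[OF K(1,2) _ st(1)] K by simp
    moreover have "x p \<noteq> - X k i" using st(2) K unfolding verts_iff by (metis less_imp_le)
    ultimately have "0 < x p + X k i" by linarith
    then show ?thesis using p ys sp False \<open>p \<noteq> t j\<close> yp
      by (intro exI[of _ p]) (auto simp: zero_less_mult_iff)
  qed
qed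

text \<open>\<open>p\<close> is the time of exit from the parallelogram: the crossing
  \<open>j + 1\<close> on its right side if \<open>n - i = b\<close>, otherwise the passage through
  its top. The right side lies to the right of the diagonal, the top to its left, strictly because
  the top right vertex is avoided.\<close>

lemma gluing_upper:
  assumes ki: "redge k i" and s2: "step j (nb k i) (n - i) b u' v'"
  assumes xx: "\<And>s. u' + s * cos \<theta> = x s - wd k i / 2" and yy: "\<And>s. v' + s * sin \<theta>
      = Y (nb k i) (n - i) + y s"
    and y0: "y (t j) < hgt k i"
  shows "\<exists>p. t j < p \<and> p \<le> t (j + 1) \<and> (\<forall>s. t j \<le> s \<longrightarrow> s < t (j + 1) \<longrightarrow> (y s < hgt k i \<longleftrightarrow> s < p))
    \<and> (if n - i = b then 0 < x p - M * y p + rr k i (y p) else x p - M * y p + rr k i (y p) < 0)"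
proof -
  note R = redge_nb[OF ki] and S = step_basic[OF s2]
  note K = redge_facts[OF R(1)]
  have tt: "t j < t (j + 1)" by (simp add: t_less)
  have ydiff: "y s - y s' = (s - s') * sin \<theta>" for s s' using yy[of s] yy[of s'] by (simp add: algebra_simps)
  show ?thesis
  proof (cases "n - i = b")
    case True
    then obtain r where r: "0 < r" "r < hgt k i" "y (t (j + 1)) = r"
        "x (t (j + 1)) - wd k i / 2 = rr (nb k i) (n - i) r"
      using s2 K(3) R(3) unfolding step_def xx yy by auto
    have "y s < hgt k i" if "s < t (j + 1)" for s
    proof -
      have "0 \<le> (t (j + 1) - s) * sin \<theta>" using that sin_th by simp
      then show ?thesis using ydiff[of "t (j + 1)" s] r by linarith
    qed
    moreover have "M * r < wd k i" using diag_bounds(2)[OF ki r(1,2)] by simp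
    moreover have "x (t (j + 1)) = wd k i - rr k i r" using r(4) rr_nb[OF ki, of r] by simp
    ultimately show ?thesis using True r(3) tt by (intro exI[of _ "t (j + 1)"]) auto
  next
    case False
    then have ai: "n - i < b" using step_order[OF s2] by simp
    have h: "Y (nb k i) (Suc (n - i)) = Y (nb k i) (n - i) + hgt k i" using R(3) by (simp add: Y_hgt)
    have top: "Y (nb k i) (Suc (n - i)) \<le> v' + t (j + 1) * sin \<theta>"
      using step_exit_height(1)[OF s2] Y_mono[OF K(1), of "Suc (n - i)" b] ai S(4) by simp
    have "v' + t j * sin \<theta> \<le> Y (nb k i) (Suc (n - i))" using y0 unfolding yy h by simp
    then obtain p where p: "t j \<le> p" "p \<le> t (j + 1)" "v' + p * sin \<theta> = Y (nb k i) (Suc (n - i))"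
      using height_time[of "t j" "t (j + 1)" v' "Y (nb k i) (Suc (n - i))"] top tt by force
    have yp: "y p = hgt k i" using p(3) unfolding yy h by simp
    have "p \<noteq> t j" using yp y0 by auto
    have "sin \<theta> \<noteq> 0" using yp y0 ydiff[of p "t j"] by auto
    then have sp: "0 < sin \<theta>" using sin_th by simp
    have ys: "y s - hgt k i = (s - p) * sin \<theta>" for s using yp ydiff[of s p] by simp
    have ys': "y s < hgt k i \<longleftrightarrow> s < p" for s
    proof -
      have "y s < hgt k i \<longleftrightarrow> (s - p) * sin \<theta> < 0" unfolding ys[symmetric] by simp
      then show ?thesis using sp by (simp add: mult_less_0_iff)
    qed
    have st: "cp (nb k i) (x p - wd k i / 2) (Y (nb k i) (Suc (n - i))) \<in> bm_polygon m n (nb k i)"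
       "cp (nb k i) (x p - wd k i / 2) (Y (nb k i) (Suc (n - i))) \<notin> bm_verts m n (nb k i)"
      using step_rep(3,4)[OF s2 p(1,2)] unfolding p(3) unfolding xx by auto
    have si: "0 < Suc (n - i)" "Suc (n - i) \<le> n" using K by auto
    have "\<bar>x p - wd k i / 2\<bar> \<le> X (nb k i) (Suc (n - i))" using polygon_width_vertex[OF K(1) si st(1)] .
    moreover have "x p - wd k i / 2 \<noteq> X (nb k i) (Suc (n - i))" using st(2) si unfolding verts_iff by metis
    ultimately have "x p - wd k i / 2 < X (nb k i) (Suc (n - i))" by linarith
    moreover have "X (nb k i) (Suc (n - i)) = wd k i / 2 - rr k i (hgt k i)"
      using rr_hgt[OF K(2,3), of "nb k i"] R(3) rr_nb[OF ki, of "hgt k i"] by simp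
    ultimately have "x p - M * y p + rr k i (y p) < 0" using wd_M[OF ki] yp by simp
    then show ?thesis using p ys' False \<open>p \<noteq> t j\<close>
      by (intro exI[of _ p]) auto
  qed
qed

text \<open>Left side and top are on one side of the diagonal, bottom and right side on the other.
  So equal types of the two crossings mean opposite signs at entry and exit, and hence one crossing
  of the diagonal; unequal types mean equal signs and none.\<close>

lemma gluing_marked:
  assumes g: "bm_gluing_letter m n (c j)"
  shows "bm_marked m n c j \<longleftrightarrow> (\<exists>s. hit j s)" "hit j s \<Longrightarrow> hit j s' \<Longrightarrow> s = s'"
proof -
  obtain k i a b u v u' v' where ki: "redge k i" "(k, i) \<in> c j" and s1: "step (j - 1) k a i u v"
    and s2: "step j (nb k i) (n - i) b u' v'" by (rule gluing_steps[OF g])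
  define y where "y s = v - Y k i + s * sin \<theta>" for s
  define x where "x s = u + s * cos \<theta>" for s
  note H = gluing_hit[OF ki s1 s2, folded y_def x_def]
  \<comment> \<open>The horizontal distance to the diagonal is affine in time, because both
    coordinates and the half width \<open>rr\<close> are.\<close>
  define A where "A = u - M * (v - Y k i) + X k i + ct i * (v - Y k i)"
  define B where "B = cos \<theta> - M * sin \<theta> + ct i * sin \<theta>"
  have G: "x s - M * y s + rr k i (y s) = A + B * s" for s
    by (simp add: x_def y_def A_def B_def rr_def algebra_simps)
  obtain p where p: "t (j - 1) \<le> p" "p < t j" "\<And>s. t (j - 1) < s \<Longrightarrow> s \<le> t j \<Longrightarrow> 0 < y s \<longleftrightarrow> p < s"
    "if a = i then A + B * p < 0 else 0 < A + B * p"
    using gluing_lower[OF ki(1) s1, folded y_def x_def, OF H(2)] unfolding G by blast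
  obtain q where q: "t j < q" "q \<le> t (j + 1)" "\<And>s. t j \<le> s \<Longrightarrow> s < t (j + 1) \<Longrightarrow> y s < hgt k i \<longleftrightarrow> s < q"
    "if n - i = b then 0 < A + B * q else A + B * q < 0"
    using gluing_upper[OF ki(1) s2 H(4,5,3)] unfolding G by blast
  have mono: "y s \<le> y s'" if "s \<le> s'" for s s' using that sin_th by (simp add: y_def mult_right_mono)
  have hit: "hit j s \<longleftrightarrow> p < s \<and> s < q \<and> A + B * s = 0" for s
  proof (cases "t (j - 1) < s \<and> s < t (j + 1)")
    case True
    have "0 < y s \<and> y s < hgt k i \<longleftrightarrow> p < s \<and> s < q"
    proof (cases "s \<le> t j")
      case le: True
      have "y s < hgt k i" using mono[OF le] H(3) by simp
      then show ?thesis using p(3)[of s] True le q(1) by auto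
    next
      case gt: False
      have "0 < y s" using mono[of "t j" s] gt H(2) by simp
      then show ?thesis using q(3)[of s] True gt p(2) by auto
    qed
    then show ?thesis using H(1)[of s] True G[of s] by auto
  next
    case False
    then show ?thesis using p(1) q(2) unfolding hit_def by auto
  qed
  have c1: "bm_crossing m n (c (j - 1)) (c j) d \<longleftrightarrow> d = (if a = i then 0 else 1)" for d
    using step_crossing[OF s1, of d] by simp
  have "bm_marked m n c j \<longleftrightarrow> (a = i) = (n - i = b)"
    using g unfolding bm_marked_def bm_word_def c1 step_crossing[OF s2] by (auto simp: bm_gluing_letter_def)
  also have "\<dots> \<longleftrightarrow> (A + B * p) * (A + B * q) < 0"
    using p(4) q(4) by (auto simp: mult_less_0_iff split: if_splits)
  also have "\<dots> \<longleftrightarrow> (\<exists>s. hit j s)"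
  proof
    assume "(A + B * p) * (A + B * q) < 0"
    then show "\<exists>s. hit j s" using affine_root[of p q A B] p(2) q(1) hit by auto
  next
    assume "\<exists>s. hit j s"
    then obtain s where s: "p < s" "s < q" "A + B * s = 0" using hit by blast
    have "(A + B * p) * (A + B * q) \<noteq> 0" using p(4) q(4) by (auto split: if_splits)
    then show "(A + B * p) * (A + B * q) < 0" using affine_no_root[OF s(1,2), of A B] s(3) by linarith
  qed
  finally show "bm_marked m n c j \<longleftrightarrow> (\<exists>s. hit j s)" .
  assume "hit j s" "hit j s'"
  then have e: "A + B * s = 0" "A + B * s' = 0" using hit by auto
  show "s = s'"
  proof (cases "B = 0")
    \<comment> \<open>A constant function would vanish identically, against its strict sign at
      \<open>p\<close>.\<close>
    case True
    then show ?thesis using e p(4) by (auto split: if_splits)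
  next
    case False
    then show ?thesis using e by (metis add_left_cancel mult_cancel_left)
  qed
qed

lemma marked_hit: "bm_marked m n c j \<longleftrightarrow> (\<exists>s. hit j s)"
proof (cases "bm_gluing_letter m n (c j)")
  case False
  then have "bm_horizontal_letter m n (c j)" by (simp add: bm_gluing_letter_def)
  then show ?thesis using hit_horizontal by (auto simp: bm_marked_def)
qed (use gluing_marked in blast)

lemma hit_unique: "hit j s \<Longrightarrow> hit j s' \<Longrightarrow> s = s'"
  using hit_horizontal gluing_marked(2) unfolding bm_gluing_letter_def by metis

lemma step_inner:
  assumes "step j k a b u v" "t j < s" "s < t (j + 1)"
  shows "\<gamma> s = {(k, cp k (u + s * cos \<theta>) (v + s * sin \<theta>))}"
  using assms unfolding step_def by blast

text \<open>Within one polygon, the diagonal of its exit edge lies below and the diagonal of its entry edge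
  above the slanted edge of the trapezoid.\<close>

lemma derived_inner:
  assumes st: "step j k1 a b u v" and s: "t j < s" "s < t (j + 1)"
    and l: "l \<in> bm_letters m n" "bm_gluing_letter m n l" "bm_on_edge m n l (f (bm_flip m n (\<gamma> s)))"
  defines "x \<equiv> u + s * cos \<theta>" and "y \<equiv> v + s * sin \<theta>"
  shows "l = c (j + 1) \<and> b < n \<and> redge k1 b \<and> 0 < y - Y k1 b \<and> y - Y k1 b < hgt k1 b \<and>
       - X k1 b + (X k1 b + X k1 (Suc b)) * ((y - Y k1 b) / hgt k1 b) \<le> x
    \<or> l = c j \<and> 0 < a \<and> redge k1 a \<and> 0 < y - Y k1 a \<and> y - Y k1 a < hgt k1 a \<and>
       x \<le> - X k1 a + (X k1 a + X k1 (Suc a)) * ((y - Y k1 a) / hgt k1 a)"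
proof -
  note S = step_basic[OF st]
  obtain k i where ki: "redge k i" "l = {(k, i), (nb k i, opp i)}"
      using gluing_letter_iff[OF l(1)] l(2) by blast
  note K = redge_facts[OF ki(1)] and R = redge_nb[OF ki(1)]
  note K' = redge_facts[OF R(1)]
  have kl: "(k, i) \<in> l" "(nb k i, opp i) \<in> l" using ki by auto
  obtain r where r: "0 < r" "r < hgt k i" "\<gamma> s = phi k i (Complex (M * r - rr k i r) r)"
    using on_gluing[OF ki(1) kl(1) l(1)] l(3) by blast
  have mem: "(k1, cp k1 x y) \<in> \<gamma> s" using step_inner[OF st s] by (simp add: x_def y_def)
  note D = diag_rep[OF ki(1) r mem]
  have le: "t j \<le> s" "s \<le> t (j + 1)" using s by auto
  consider "k1 = k" | "k1 = nb k i" using D(3) by blast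
  then show ?thesis
  proof cases
    case 1
    have xy: "x = M * r - rr k i r" "y = Y k i + r" using D(1)[OF 1] 1 by auto
    have L: "- X k i + (X k i + X k (Suc i)) * (r / hgt k i) \<le> x"
        using diag_left[OF ki(1) r(1,2)] xy by simp
    have up: "y \<le> v + t (j + 1) * sin \<theta>" unfolding y_def using le by (intro height_mono)
    have "b = i"
    proof (rule ccontr)
      assume "b \<noteq> i"
      then consider "b < i" | "i < b" by linarith
      then show False
      proof cases
        case lt: 1
        then have "v + t (j + 1) * sin \<theta> < Y k (Suc b)" using step_exit_height(2)[OF st] K 1 by simp
        also have "\<dots> \<le> Y k i" using Y_mono[OF K(1), of "Suc b" i] lt K by simp
        finally show False using up xy r by simp
      next
        case gt: 2
        \<comment> \<open>Here the trajectory would leave the trapezoid through its top. Starting to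
          the right of the slanted edge, it has at most the horizontal room of the rest of that
          edge, too little for its smaller slope.\<close>
        have top: "Y k (Suc i) \<le> v + t (j + 1) * sin \<theta>"
          using step_exit_height(1)[OF st] Y_mono[OF K(1), of "Suc i" b] gt S(4) 1 by simp
        have "v + s * sin \<theta> \<le> Y k (Suc i)" using xy r by (simp add: y_def Y_hgt)
        then obtain w where w: "s \<le> w" "w \<le> t (j + 1)" "v + w * sin \<theta> = Y k (Suc i)"
          using height_time[OF le(2), of v "Y k (Suc i)"] top by blast
        have "\<bar>u + w * cos \<theta>\<bar> \<le> X k (Suc i)"
          using step_rep(3)[OF st, of w] w le polygon_width_vertex[OF K(1), of "Suc i"] K 1 by simp
        then have "x + (w - s) * cos \<theta> \<le> X k (Suc i)" by (simp add: x_def abs_le_iff algebra_simps)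
        then have e1: "(w - s) * cos \<theta> \<le> (X k i + X k (Suc i)) * (1 - r / hgt k i)" using L
            by (simp add: algebra_simps)
        have e2: "(w - s) * sin \<theta> = hgt k i - r" using w(3) xy(2) by (simp add: y_def Y_hgt algebra_simps)
        have h: "0 < hgt k i" using r by simp
        have "(hgt k i - r) * cos \<theta> = ((w - s) * cos \<theta>) * sin \<theta>" unfolding e2[symmetric] by simp
        also have "\<dots> \<le> ((X k i + X k (Suc i)) * (1 - r / hgt k i)) * sin \<theta>" using e1 sin_th
            by (rule mult_right_mono)
        also have "\<dots> = (sin \<theta> * (X k i + X k (Suc i))) * ((hgt k i - r) / hgt k i)" using h
            by (simp add: field_simps)
        also have "\<dots> < (cos \<theta> * hgt k i) * ((hgt k i - r) / hgt k i)"
          using slanted[OF ki(1)] r h by (intro mult_strict_right_mono) auto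
        also have "\<dots> = (hgt k i - r) * cos \<theta>" using h by simp
        finally show False by simp
      qed
    qed
    moreover have "l = c (j + 1)" using letter_eqI[OF l(1) c_letter kl(1)] S(6) 1 \<open>b = i\<close> by simp
    ultimately show ?thesis using 1 ki(1) K r xy L by simp
  next
    case 2
    have xy: "x = M * r - rr k i r - wd k i / 2" "y = Y k1 (n - i) + r" using D(2)[OF 2] 2 by auto
    have h: "hgt k1 (n - i) = hgt k i" "redge k1 (n - i)" using R 2 by auto
    note K1 = redge_facts[OF h(2)]
    have L: "x \<le> - X k1 (n - i) + (X k1 (n - i) + X k1 (Suc (n - i))) * (r / hgt k i)"
        using diag_right[OF ki(1) r(1,2)] xy 2 by simp
    have up: "v + t j * sin \<theta> \<le> y" unfolding y_def using le by (intro height_mono)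
    have "a = n - i"
    proof (rule ccontr)
      assume "a \<noteq> n - i"
      then consider "n - i < a" | "a < n - i" by linarith
      then show False
      proof cases
        case gt: 1
        have "Y k1 (Suc (n - i)) \<le> Y k1 a" using Y_mono[OF K1(1), of "Suc (n - i)" a] gt S(2) by simp
        also have "\<dots> < v + t j * sin \<theta>" using step_entry_height(2)[OF st] gt by simp
        finally show False using up xy r h by (simp add: Y_hgt)
      next
        case lt: 2
        \<comment> \<open>The reverse situation: entering through the bottom, the trajectory would
          have to reach a point to the left of the slanted edge, for which it is too flat.\<close>
        have bot: "v + t j * sin \<theta> \<le> Y k1 (n - i)"
        proof -
          have "Y k1 (Suc a) \<le> Y k1 (n - i)" using lt by (intro Y_mono K1(1)) auto
          then show ?thesis using step_entry_height(1)[OF st] by simp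
        qed
        have "Y k1 (n - i) \<le> v + s * sin \<theta>" using xy r by (simp add: y_def)
        then obtain w where w: "t j \<le> w" "w \<le> s" "v + w * sin \<theta> = Y k1 (n - i)"
          using height_time[OF le(1) bot] by blast
        have "\<bar>u + w * cos \<theta>\<bar> \<le> X k1 (n - i)"
          using step_rep(3)[OF st, of w] w le polygon_width_vertex[OF K1(1), of "n - i"] K1 by simp
        then have "- X k1 (n - i) \<le> x - (s - w) * cos \<theta>" by (simp add: x_def abs_le_iff algebra_simps)
        then have e1: "(s - w) * cos \<theta> \<le> (X k1 (n - i) + X k1 (Suc (n - i))) * (r / hgt k i)"
            using L by linarith
        have e2: "(s - w) * sin \<theta> = r" using w(3) xy(2) by (simp add: y_def algebra_simps)
        have h0: "0 < hgt k i" using r by simp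
        have "r * cos \<theta> = ((s - w) * cos \<theta>) * sin \<theta>" unfolding e2[symmetric] by simp
        also have "\<dots> \<le> ((X k1 (n - i) + X k1 (Suc (n - i))) * (r / hgt k i)) * sin \<theta>"
            using e1 sin_th by (rule mult_right_mono)
        also have "\<dots> = (sin \<theta> * (X k1 (n - i) + X k1 (Suc (n - i)))) * (r / hgt k i)" by simp
        also have "\<dots> < (cos \<theta> * hgt k i) * (r / hgt k i)"
          using slanted[OF h(2)] r h0 unfolding h(1) by (intro mult_strict_right_mono) auto
        also have "\<dots> = r * cos \<theta>" using h0 by simp
        finally show False by simp
      qed
    qed
    moreover have "(2 * n - (n - i)) mod (2 * n) = opp i" using K by (simp add: opp_cases)
    then have "l = c j" using letter_eqI[OF l(1) c_letter kl(2)] S(5) 2 \<open>a = n - i\<close> by simp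
    ultimately show ?thesis using h K1 r xy L by simp
  qed
qed

text \<open>The completeness half: every edge crossing of the derived trajectory comes from a nearby
  letter of the original sequence. Strictly inside a step, \<open>derived_inner\<close> leaves only
  the two letters bounding it.\<close>

lemma derived_hit:
  assumes l: "l \<in> bm_letters m n" "bm_on_edge m n l (f (bm_flip m n (\<gamma> s)))"
  shows "\<exists>j. c j = l \<and> hit j s"
proof -
  have on_t: "\<exists>j. c j = l \<and> hit j s" if on: "bm_on_edge m n l (\<gamma> s)"
  proof -
    obtain j where "s = t j" "c j = l" by (rule on_edge_time[OF l(1) on])
    then show ?thesis using l(2) unfolding hit_def by (auto simp: t_less)
  qed
  show ?thesis
  proof (cases "bm_horizontal_letter m n l")
    case True
    then have "bm_on_edge m n l (\<gamma> s)" using derived_horizontal[OF shear l(1) True] l(2) reg by blast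
    then show ?thesis by (rule on_t)
  next
    case False
    then have g: "bm_gluing_letter m n l" by (simp add: bm_gluing_letter_def)
    obtain j where j: "t j \<le> s" "s < t (j + 1)" by (rule t_between)
    show ?thesis
    proof (cases "s = t j")
      case True
      obtain k i where ki: "redge k i" "l = {(k, i), (nb k i, opp i)}"
          using gluing_letter_iff[OF l(1)] g by blast
      obtain r where r: "0 < r" "r < hgt k i" "\<gamma> s = phi k i (Complex (M * r - rr k i r) r)"
        using on_gluing[OF ki(1) _ l(1), of s] l(2) ki(2) by auto
      \<comment> \<open>At a crossing time the point has two representatives. A diagonal point off
        the edge \<open>l\<close> has only one, so the diagonal is met exactly on that edge, and the
        crossing is of \<open>l\<close> itself.\<close>
      have "\<not> (\<exists>k z. \<gamma> s = {(k, z)})"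
      proof
        assume "\<exists>k z. \<gamma> s = {(k, z)}"
        then obtain k1 z1 where 1: "\<gamma> s = {(k1, z1)}" by blast
        obtain i1 where "(k1, i1) \<in> c j" "z1 \<in> bm_edge m n k1 i1"
          using on_edge_rep[OF reg c_letter c_edge, of k1 z1 j] 1 True by blast
        then have "(k1, i1) \<in> bm_edges m n" "z1 \<in> bm_edge m n k1 i1" using letter_edges[OF c_letter]
            by blast+
        then have "\<gamma> s = {(k1, z1), (nb k1 i1, z1 + trn k1 i1)}"
          using cl_edge[of k1 i1 z1] regular_rep(3,4)[OF reg, of k1 z1 s] 1 by auto
        then show False using 1 nb_edge(5)[OF \<open>(k1, i1) \<in> bm_edges m n\<close>] by auto
      qed
      moreover note B = diag_bounds[OF ki(1) r(1,2)] and P = diag_point[OF ki(1) r(1,2)] and R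
          = redge_nb[OF ki(1)]
      have "M * r - rr k i r = rr k i r"
      proof (rule ccontr)
        assume ne: "M * r - rr k i r \<noteq> rr k i r"
        have "\<exists>k z. \<gamma> s = {(k, z)}"
        proof (cases "M * r - rr k i r < rr k i r")
          case True
          then show ?thesis using P(1) pt_inner[OF ki(1) r(1,2), of "M * r - rr k i r"] B r(3) by auto
        next
          case False
          then have "\<bar>M * r - rr k i r - wd k i / 2\<bar> < rr (nb k i) (n - i) r"
            using B ne rr_nb[OF ki(1), of r] unfolding abs_less_iff by linarith
          then show ?thesis using P(2) pt_inner[OF R(1) r(1), of "M * r - rr k i r - wd k i / 2"] R(3)
              r False by auto
        qed
        then show False using calculation by blast
      qed
      then have "\<gamma> s = pt k i (rr k i r) r" using P(1) r(3) by simp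
      then have "bm_on_edge m n l (\<gamma> s)" using on_gluing_edge_iff[OF ki(1) reg] r ki(2) by blast
      then show ?thesis by (rule on_t)
    next
      case False
      then have s: "t j < s" "s < t (j + 1)" using j by auto
      obtain k a b u v where st: "step j k a b u v" using step_exists by blast
      have "l = c (j + 1) \<or> l = c j" using derived_inner[OF st s l(1) g l(2)] by blast
      then show ?thesis
      proof
        assume "l = c (j + 1)"
        moreover have "t (j + 1) < t (j + 1 + 1)" by (simp add: t_less)
        ultimately have "hit (j + 1) s" using s l(2) unfolding hit_def by simp
        then show ?thesis using \<open>l = c (j + 1)\<close> by blast
      next
        assume "l = c j"
        moreover have "t (j - 1) < t j" by (simp add: t_less)
        ultimately have "hit j s" using s l(2) unfolding hit_def by simp
        then show ?thesis using \<open>l = c j\<close> by blast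
      qed
    qed
  qed
qed

text \<open>The two edges of one letter lie in different polygons, whereas entry and exit of a step
  are different edges of the same polygon.\<close>

lemma consecutive_letters:
  assumes "step j k a b u v" shows "c j \<noteq> c (j + 1)"
proof
  assume e: "c j = c (j + 1)"
  note S = step_basic[OF assms]
  have "(k, b) \<in> bm_edges m n" "c j = {(k, b), (nb k b, opp b)}"
      using letter_edges[OF c_letter S(6)] e by auto
  moreover have "(2 * n - a) mod (2 * n) \<noteq> b" using S(2,3,4) by (cases "a = 0") auto
  ultimately show False using S(5) nb_edge(5)[of k b] by auto
qed

text \<open>Only neighbouring letters have overlapping windows. In the wrong order, both hits would
  fall into one step, and the trajectory would pass from the lower to the upper side of the slanted
  edge if both trapezoids coincide, or descend if they do not. Equal times would put a regular point
  on two letters.\<close>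

lemma hit_mono:
  assumes "hit j s" "hit j' s'" "j < j'" shows "s < s'"
proof (cases "j' = j + 1")
  case False
  then have "t (j + 1) \<le> t (j' - 1)" using assms(3) by (simp add: t_le)
  then show ?thesis using assms unfolding hit_def by linarith
next
  case j': True
  have h: "t (j - 1) < s" "s < t (j + 1)" "bm_on_edge m n (c j) (f (bm_flip m n (\<gamma> s)))"
    "t j < s'" "s' < t (j + 1 + 1)" "bm_on_edge m n (c (j + 1)) (f (bm_flip m n (\<gamma> s')))"
    using assms unfolding hit_def j' by auto
  show ?thesis
  proof (rule ccontr)
    assume "\<not> s < s'"
    then have ss: "s' \<le> s" by simp
    then have i: "t j < s" "t j < s'" "s < t (j + 1)" "s' < t (j + 1)" using h by auto
    have g: "bm_gluing_letter m n (c j)" "bm_gluing_letter m n (c (j + 1))"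
      using hit_horizontal[of j s] hit_horizontal[of "j + 1" s'] assms i j'
          unfolding bm_gluing_letter_def by auto
    obtain k a b u v where st: "step j k a b u v" using step_exists by blast
    note ne = consecutive_letters[OF st]
    have L: "0 < a" "redge k a" "v + s * sin \<theta> - Y k a < hgt k a"
      "u + s * cos \<theta> \<le> - X k a + (X k a + X k (Suc a)) * ((v + s * sin \<theta> - Y k a) / hgt k a)"
      using derived_inner[OF st i(1,3) c_letter g(1) h(3)] ne by auto
    have R: "redge k b" "0 < v + s' * sin \<theta> - Y k b"
      "- X k b + (X k b + X k (Suc b)) * ((v + s' * sin \<theta> - Y k b) / hgt k b) \<le> u + s' * cos \<theta>"
      using derived_inner[OF st i(2,4) c_letter g(2) h(6)] ne by auto
    show False
    proof (cases "a = b")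
      case False
      then have "Y k (Suc a) \<le> Y k b" using step_order[OF st] Y_mono[of k "Suc a" b] step_basic(1,4)[OF
          st] by simp
      then have "v + s * sin \<theta> < v + s' * sin \<theta>" using L R by (simp add: Y_hgt)
      moreover have "v + s' * sin \<theta> \<le> v + s * sin \<theta>" using ss by (rule height_mono)
      ultimately show False by simp
    next
      case True
      define D where "D = X k a + X k (Suc a)"
      have hp: "0 < hgt k a" using hgt_pos L(2) by simp
      define P where "P = v + s * sin \<theta> - Y k a"
      define Q where "Q = v + s' * sin \<theta> - Y k a"
      have "(s - s') * cos \<theta> \<le> D * (P / hgt k a) - D * (Q / hgt k a)"
        using L(4) R(3) True by (simp add: D_def P_def Q_def left_diff_distrib)
      also have "\<dots> = (P - Q) * D / hgt k a" using hp by (simp add: field_simps)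
      also have "P - Q = (s - s') * sin \<theta>" by (simp add: P_def Q_def algebra_simps)
      finally have le: "(s - s') * (cos \<theta> * hgt k a) \<le> (s - s') * (sin \<theta> * D)" using hp
          by (simp add: field_simps)
      have "s = s'"
      proof (rule ccontr)
        assume "s \<noteq> s'"
        then have "0 < s - s'" using ss by simp
        then have "(s - s') * (sin \<theta> * D) < (s - s') * (cos \<theta> * hgt k a)"
          using slanted[OF L(2)] unfolding D_def by (rule mult_strict_left_mono[rotated])
        then show False using le by simp
      qed
      moreover have "f (bm_flip m n (\<gamma> s)) \<in> regular" using shear_regular[OF shear] flip_regular reg
          by blast
      ultimately have "c j = c (j + 1)" using on_edge_unique[OF _ c_letter h(3) c_letter] h(6) by simp
      then show False using ne by simp
    qed
  qed
qed

text \<open>Makes \<open>lin_unbounded\<close> applicable, so that the derived trajectory crosses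
  edges at arbitrarily early and late times; this yields marked letters unbounded in both
  directions.\<close>

lemma lin_derived: "lin (sh M (- cnj (cis \<theta>))) (\<lambda>s. f (bm_flip m n (\<gamma> s)))"
  unfolding lin_def
proof (intro allI conjI)
  fix s
  have r: "bm_flip m n (\<gamma> s) \<in> regular" using flip_regular reg by blast
  then show "f (bm_flip m n (\<gamma> s)) \<in> regular" using shear_regular[OF shear] by blast
  obtain e1 where e1: "e1 > 0" "\<And>h. \<bar>h\<bar> < e1 \<Longrightarrow> bm_move m n (\<gamma> s) (of_real h * cis \<theta>) (\<gamma> (s + h))"
    using lin_gamma by (auto simp: lin_def)
  obtain e2 where e2: "e2 > 0" "\<And>w q. norm w < e2 \<Longrightarrow> bm_move m n (bm_flip m n (\<gamma> s)) w q
      \<Longrightarrow> bm_move m n (f (bm_flip m n (\<gamma> s))) (sh M w) (f q)"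
    using shear_facts(5)[OF shear r] by blast
  have "bm_move m n (f (bm_flip m n (\<gamma> s))) (of_real h * sh M (- cnj (cis \<theta>))) (f (bm_flip m n (\<gamma> (s +
      h))))" if "\<bar>h\<bar> < min e1 e2" for h
  proof -
    have "bm_move m n (\<gamma> s) (of_real h * cis \<theta>) (\<gamma> (s + h))" using that e1(2) by simp
    then have "bm_move m n (bm_flip m n (\<gamma> s)) (- cnj (of_real h * cis \<theta>)) (bm_flip m n (\<gamma> (s + h)))"
      by (rule flip_move)
    moreover have "norm (- cnj (of_real h * cis \<theta>)) < e2" using that by (simp add: norm_mult)
    ultimately have "bm_move m n (f (bm_flip m n (\<gamma> s))) (sh M (- cnj (of_real h * cis \<theta>))) (f (bm_flip
        m n (\<gamma> (s + h))))"
      using e2(2) by blast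
    moreover have "sh M (- cnj (of_real h * cis \<theta>)) = of_real h * sh M (- cnj (cis \<theta>))"
      by (simp add: sh_def complex_eq_iff algebra_simps)
    ultimately show ?thesis by simp
  qed
  then show "\<exists>e>0. \<forall>h. \<bar>h\<bar> < e \<longrightarrow> bm_move m n (f (bm_flip m n (\<gamma> s))) (of_real h * sh M (- cnj (cis \<theta>)))
      (f (bm_flip m n (\<gamma> (s + h))))"
    using e1(1) e2(1) by (intro exI[of _ "min e1 e2"]) auto
qed

lemma derived_nonzero: "sh M (- cnj (cis \<theta>)) \<noteq> 0"
proof
  assume "sh M (- cnj (cis \<theta>)) = 0"
  then have z: "Re (sh M (- cnj (cis \<theta>))) = 0" "Im (sh M (- cnj (cis \<theta>))) = 0" by simp_all
  have "sin \<theta> = 0" using z(2) by simp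
  then show False using z(1) cos_th by (simp add: sh_def)
qed

lemma derived_sequence:
  "\<exists>\<phi> :: int \<Rightarrow> int. strict_mono \<phi> \<and> range \<phi> = {j. bm_marked m n c j} \<and>
     bm_cutting_sequence m n (f \<circ> bm_flip m n \<circ> \<gamma>) (c \<circ> \<phi>)"
proof -
  define J where "J = {j. bm_marked m n c j}"
  \<comment> \<open>By \<open>hit_unique\<close> the choice is forced for marked positions; at other
    positions the value of \<open>T\<close> is arbitrary.\<close>
  define T where "T j = (SOME s. hit j s)" for j
  have T: "hit j (T j)" if "j \<in> J" for j
    using that marked_hit someI_ex[of "hit j"] by (auto simp: J_def T_def)
  note U = lin_unbounded[OF lin_derived derived_nonzero]
  have above: "\<exists>j\<in>J. B < j" for B
  proof -
    obtain s l where s: "t (B + 1) < s" "l \<in> bm_letters m n" "bm_on_edge m n l (f (bm_flip m n (\<gamma> s)))"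
      using U(1)[of "t (B + 1)"] by (auto simp: onany_def)
    obtain j where j: "hit j s" using derived_hit[OF s(2,3)] by blast
    then have "t (B + 1) < t (j + 1)" using s(1) unfolding hit_def by linarith
    then show ?thesis using j marked_hit by (auto simp: t_less J_def)
  qed
  have below: "\<exists>j\<in>J. j < B" for B
  proof -
    obtain s l where s: "s < t (B - 1)" "l \<in> bm_letters m n" "bm_on_edge m n l (f (bm_flip m n (\<gamma> s)))"
      using U(2)[of "t (B - 1)"] by (auto simp: onany_def)
    obtain j where j: "hit j s" using derived_hit[OF s(2,3)] by blast
    then have "t (j - 1) < t (B - 1)" using s(1) unfolding hit_def by linarith
    then show ?thesis using j marked_hit by (auto simp: t_less J_def)
  qed
  obtain \<phi> :: "int \<Rightarrow> int" where \<phi>: "strict_mono \<phi>" "range \<phi> = J"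
    using int_set_enumeration[of J] above below by blast
  have \<phi>J: "\<phi> i \<in> J" for i using \<phi>(2) by blast
  have "bm_cutting_sequence m n (f \<circ> bm_flip m n \<circ> \<gamma>) (c \<circ> \<phi>)"
    unfolding bm_cutting_sequence_def
  proof (intro exI[of _ "T \<circ> \<phi>"] conjI allI)
    show "strict_mono (T \<circ> \<phi>)"
      using hit_mono[OF T[OF \<phi>J] T[OF \<phi>J]] \<phi>(1) by (auto simp: strict_mono_def)
    have "s \<in> range (T \<circ> \<phi>) \<longleftrightarrow> (\<exists>l\<in>bm_letters m n. bm_on_edge m n l (f (bm_flip m n (\<gamma> s))))" for s
    proof
      assume "s \<in> range (T \<circ> \<phi>)"
      then obtain i where "s = T (\<phi> i)" by auto
      then have "bm_on_edge m n (c (\<phi> i)) (f (bm_flip m n (\<gamma> s)))" using T[OF \<phi>J[of i]]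
          by (simp add: hit_def)
      then show "\<exists>l\<in>bm_letters m n. bm_on_edge m n l (f (bm_flip m n (\<gamma> s)))" using c_letter by blast
    next
      assume "\<exists>l\<in>bm_letters m n. bm_on_edge m n l (f (bm_flip m n (\<gamma> s)))"
      then obtain j where j: "hit j s" using derived_hit by blast
      then have jJ: "j \<in> J" using marked_hit by (auto simp: J_def)
      then obtain i where i: "j = \<phi> i" using \<phi>(2) by blast
      have "s = T j" using hit_unique[OF j T[OF jJ]] .
      then show "s \<in> range (T \<circ> \<phi>)" using i by auto
    qed
    then show "range (T \<circ> \<phi>) = {s. \<exists>l\<in>bm_letters m n. bm_on_edge m n l ((f \<circ> bm_flip m n \<circ> \<gamma>) s)}"
      by (simp add: set_eq_iff)
    fix i
    show "(c \<circ> \<phi>) i \<in> bm_letters m n" using c_letter by simp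
    show "bm_on_edge m n ((c \<circ> \<phi>) i) ((f \<circ> bm_flip m n \<circ> \<gamma>) ((T \<circ> \<phi>) i))"
      using T[OF \<phi>J[of i]] by (simp add: hit_def)
  qed
  then show ?thesis using \<phi> unfolding J_def by blast
qed

end

theorem theorem7p1:
  fixes m n :: nat and M :: real
  assumes "m \<ge> 2" and "n \<ge> 3"
    and "M = 2 * cot (pi / real n) + 2 * (cos (pi / real m) / sin (pi / real n))"
  shows "(\<forall>C \<in> bm_cylinders m n. \<exists>W H. bm_flat_cylinder m n C W H \<and> M = W / H) \<and>
    (\<forall>S\<^sub>M \<theta> \<gamma> c.
       bm_shear m n M S\<^sub>M \<longrightarrow>
       0 \<le> \<theta> \<longrightarrow> \<theta> < bm_theta m n \<longrightarrow>
       bm_trajectory m n \<theta> \<gamma> \<longrightarrow>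
       bm_cutting_sequence m n \<gamma> c \<longrightarrow>
       (\<exists>\<phi> :: int \<Rightarrow> int. strict_mono \<phi> \<and> range \<phi> = {j. bm_marked m n c j} \<and>
          bm_cutting_sequence m n (S\<^sub>M \<circ> bm_flip m n \<circ> \<gamma>) (c \<circ> \<phi>)))"
proof (intro conjI ballI allI impI)
  interpret bouw_moeller m n by standard (use assms in auto)
  fix C assume "C \<in> bm_cylinders m n"
  then obtain k i where ki: "redge k i" "C = Cyl k i" by (rule cylinders_eq)
  have "M = wd k i / hgt k i" using wd_hgt[OF ki(1)] hgt_pos[OF ki(1)] assms(3) by simp
  then show "\<exists>W H. bm_flat_cylinder m n C W H \<and> M = W / H" using flat_cylinder[OF ki(1)] ki(2) by blast
next
  fix S\<^sub>M \<theta> \<gamma> c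
  assume a: "bm_shear m n M S\<^sub>M" "0 \<le> \<theta>" "\<theta> < bm_theta m n" "bm_trajectory m n \<theta> \<gamma>"
      "bm_cutting_sequence m n \<gamma> c"
  obtain t :: "int \<Rightarrow> real" where t: "strict_mono t"
      "range t = {s. \<exists>l\<in>bm_letters m n. bm_on_edge m n l (\<gamma> s)}"
    "\<And>j. c j \<in> bm_letters m n" "\<And>j. bm_on_edge m n (c j) (\<gamma> (t j))"
    using a(5) unfolding bm_cutting_sequence_def by blast
  interpret bm_derived m n \<theta> \<gamma> c t M S\<^sub>M
    by standard (use assms a t in auto)
  show "\<exists>\<phi> :: int \<Rightarrow> int. strict_mono \<phi> \<and> range \<phi> = {j. bm_marked m n c j} \<and>
      bm_cutting_sequence m n (S\<^sub>M \<circ> bm_flip m n \<circ> \<gamma>) (c \<circ> \<phi>)"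
    by (rule derived_sequence)
qed

end
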